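(* Let $\Omega\subset\mathbb{R}^n$ be a domain, and suppose that $1<p<n$, $1\leq\beta<\frac{n}{p}$, $0\leq\gamma\leq n$, and $\frac{1}{q}=\frac{1}{p}-\frac{\beta}{n}$. If $\Omega$ admits a $p$-Sobolev embedding, then there is a constant $C>0$, independent of $f$, such that for every $f\in W^{1,p}(\Omega)$ $$\|M_{\varphi,\beta,\Omega}f\|_{W^{1,q}(\Omega)}\leq C\|f\|_{W^{1,p}(\Omega)}.$$
   Context: For $\gamma\ge 0$ put $\varphi(t)=(1+t)^{\gamma}$ for $t\geq 0$. For $0\leq\beta<n$ and a domain $\Omega\subset\mathbb{R}^n$ with complement $\Omega^c=\mathbb{R}^n\setminus\Omega$, the local fractional new maximal operator is $$M_{\varphi,\beta,\Omega}f(x)=\sup_{0<r<\mathrm{dist}(x,\Omega^c)}\frac{r^{\beta}(1+r^n)^{\frac{\gamma\beta}{n}}}{\varphi(|B(x,r)|)\,|B(x,r)|}\int_{B(x,r)}|f(y)|\,dy,\qquad x\in\Omega,$$ where $B(x,r)$ is the ball with center $x$ and radius $r$ and $|\cdot|$ is Lebesgue measure; if $\Omega=\mathbb{R}^n$ the supremum is over all $r>0$. The Sobolev space $W^{1,p}(\Omega)$ consists of the functions $f:\Omega\to\mathbb{R}$ with $\|f\|_{W^{1,p}(\Omega)}=\|f\|_{L^p(\Omega)}+\|\nabla f\|_{L^p(\Omega)}<\infty$, where $\nabla f$ is the weak gradient. For $1<p<n$, $\Omega$ admits a $p$-Sobolev embedding if there is a constant $C>0$ with $\|f\|_{L^{\tilde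 q}(\Omega)}\leq C\|f\|_{W^{1,p}(\Omega)}$ for all $f\in W^{1,p}(\Omega)$, where $\frac{1}{\tilde q}=\frac1p-\frac1n$. *)

theory Defs
  imports "HOL-Analysis.Analysis"
begin

text \<open>
  A function on \<open>\<Omega>\<close> is represented by a total function; its values outside \<open>\<Omega>\<close> play no role.
\<close>

definition domain_set :: "'a::euclidean_space set \<Rightarrow> bool" where
  "domain_set \<Omega> \<longleftrightarrow> open \<Omega> \<and> connected \<Omega> \<and> \<Omega> \<noteq> {}"

definition Lp_space :: "real \<Rightarrow> 'a::euclidean_space set \<Rightarrow> ('a \<Rightarrow> 'b::euclidean_space) set" where
  "Lp_space p \<Omega> = {f \<in> borel_measurable (lebesgue_on \<Omega>).
     integrable (lebesgue_on \<Omega>) (\<lambda>x. norm (f x) powr p)}"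

text \<open>Only meaningful for members of \<open>Lp_space p \<Omega>\<close>, as the Bochner integral is total.\<close>

definition Lp_norm :: "real \<Rightarrow> 'a::euclidean_space set \<Rightarrow> ('a \<Rightarrow> 'b::euclidean_space) \<Rightarrow> real" where
  "Lp_norm p \<Omega> f = (\<integral>x. norm (f x) powr p \<partial>lebesgue_on \<Omega>) powr (1 / p)"

primrec Ck :: "nat \<Rightarrow> ('a::euclidean_space \<Rightarrow> real) \<Rightarrow> bool" where
  "Ck 0 f \<longleftrightarrow> continuous_on UNIV f"
| "Ck (Suc k) f \<longleftrightarrow> f differentiable_on UNIV \<and>
     (\<forall>b\<in>Basis. Ck k (\<lambda>x. frechet_derivative f (at x) b))"

text \<open>The space $C_c^\infty(\Omega)$, each function being extended by zero to the whole space.\<close>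

definition test_functions :: "'a::euclidean_space set \<Rightarrow> ('a \<Rightarrow> real) set" where
  "test_functions \<Omega> = {\<psi>. (\<forall>k. Ck k \<psi>) \<and>
     compact (closure {x. \<psi> x \<noteq> 0}) \<and> closure {x. \<psi> x \<noteq> 0} \<subseteq> \<Omega>}"

definition locally_integrable :: "'a::euclidean_space set \<Rightarrow> ('a \<Rightarrow> 'b::euclidean_space) \<Rightarrow> bool" where
  "locally_integrable \<Omega> f \<longleftrightarrow> (\<forall>K. compact K \<and> K \<subseteq> \<Omega> \<longrightarrow> integrable (lebesgue_on K) f)"

definition is_weak_gradient :: "'a::euclidean_space set \<Rightarrow> ('a \<Rightarrow> real) \<Rightarrow> ('a \<Rightarrow> 'a) \<Rightarrow> bool" where
  "is_weak_gradient \<Omega> f g \<longleftrightarrow> locally_integrable \<Omega> f \<and> locally_integrable \<Omega> g \<and>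
     (\<forall>\<psi>\<in>test_functions \<Omega>. \<forall>b\<in>Basis.
        (\<integral>x. f x * frechet_derivative \<psi> (at x) b \<partial>lebesgue_on \<Omega>) =
        - (\<integral>x. (g x \<bullet> b) * \<psi> x \<partial>lebesgue_on \<Omega>))"

text \<open>
  On an open set the weak gradient is unique up to a null set, so the choice of representative
  affects neither its membership in an $L^p$ space nor its norm.
\<close>

definition weak_gradient :: "'a::euclidean_space set \<Rightarrow> ('a \<Rightarrow> real) \<Rightarrow> 'a \<Rightarrow> 'a" where
  "weak_gradient \<Omega> f = (SOME g. is_weak_gradient \<Omega> f g)"

definition Sobolev_space :: "real \<Rightarrow> 'a::euclidean_space set \<Rightarrow> ('a \<Rightarrow> real) set" where
  "Sobolev_space p \<Omega> = {f \<in> Lp_space p \<Omega>.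
     (\<exists>g. is_weak_gradient \<Omega> f g) \<and> weak_gradient \<Omega> f \<in> Lp_space p \<Omega>}"

definition Sobolev_norm :: "real \<Rightarrow> 'a::euclidean_space set \<Rightarrow> ('a \<Rightarrow> real) \<Rightarrow> real" where
  "Sobolev_norm p \<Omega> f = Lp_norm p \<Omega> f + Lp_norm p \<Omega> (weak_gradient \<Omega> f)"

text \<open>The exponent \<open>qt\<close> is the solution of \<open>1 / qt = 1 / p - 1 / n\<close>, for \<open>1 < p < n\<close>.\<close>

definition admits_Sobolev_embedding :: "real \<Rightarrow> 'a::euclidean_space set \<Rightarrow> bool" where
  "admits_Sobolev_embedding p \<Omega> \<longleftrightarrow>
     (let qt = 1 / (1 / p - 1 / real DIM('a)) in
       \<exists>C>0. \<forall>f\<in>Sobolev_space p \<Omega>.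
         f \<in> Lp_space qt \<Omega> \<and> Lp_norm qt \<Omega> f \<le> C * Sobolev_norm p \<Omega> f)"

definition phi :: "real \<Rightarrow> real \<Rightarrow> real" where
  "phi \<gamma> t = (1 + t) powr \<gamma>"

text \<open>
  \<open>infdist x {} = 0\<close>, so the whole space needs a separate clause.
\<close>

definition admissible_radii :: "'a::euclidean_space set \<Rightarrow> 'a \<Rightarrow> real set" where
  "admissible_radii \<Omega> x = {r. 0 < r \<and> (\<Omega> = UNIV \<or> r < infdist x (- \<Omega>))}"

text \<open>The supremum may be infinite, hence the extended value.\<close>

definition local_max ::
  "real \<Rightarrow> real \<Rightarrow> 'a::euclidean_space set \<Rightarrow> ('a \<Rightarrow> real) \<Rightarrow> 'a \<Rightarrow> ennreal" where
  "local_max \<gamma> \<beta> \<Omega> f x =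
     (SUP r\<in>admissible_radii \<Omega> x.
        ennreal (r powr \<beta> * (1 + r ^ DIM('a)) powr (\<gamma> * \<beta> / real DIM('a)) /
                 (phi \<gamma> (measure lebesgue (ball x r)) * measure lebesgue (ball x r))) *
        (\<integral>\<^sup>+y. ennreal \<bar>f y\<bar> \<partial>lebesgue_on (ball x r)))"

end

theory Submission
  imports Defs
begin

text \<open>
  Write \<open>u\<close> for the maximal function: a supremum of \<open>W r\<close> times the average of
  \<open>\<bar>f\<bar>\<close> over \<open>B(x, r)\<close>, where \<open>W r \<le> C r\<^sup>\<beta>\<close> and
  \<open>\<bar>W' r\<bar> \<le> C r\<^bsup>\<beta> - 1\<^esup>\<close>. Moving a ball along a segment while its radius
  changes at a rate at most 1 changes such an average by at most the integral over the segment of \<open>G = C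
  (M\<^bsub>\<beta> - 1\<^esub> f + M\<^sub>\<beta> \<bar>\<nabla>f\<bar>)\<close>; this is seen on mollifications of
  \<open>f\<close>. The supremum inherits the inequality \<open>\<bar>u x - u x'\<bar> \<le> \<bar>x - x'\<bar>
  \<integral> G\<close>, because the radius can be taken to follow the distance to the boundary. Hence the difference
  quotients of \<open>u\<close>, averaged over small balls, are dominated by \<open>M\<^sub>0 G\<close>, and suitable
  convex combinations of them converge to a weak gradient with \<open>\<bar>\<nabla>u\<bar> \<le> C M\<^sub>0 G\<close>.
  The bound in \<open>L\<^sup>q\<close> follows from the mapping properties of the fractional maximal functions:
  \<open>M\<^sub>0\<close> is bounded on \<open>L\<^sup>q\<close>, \<open>M\<^sub>\<beta>\<close> sends
  \<open>L\<^sup>p\<close> to \<open>L\<^sup>q\<close>, and \<open>M\<^bsub>\<beta> - 1\<^esub>\<close> sends to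
  \<open>L\<^sup>q\<close> the space \<open>L\<^bsup>p n / (n - p)\<^esup>\<close> that contains \<open>f\<close> by
  the Sobolev embedding.
\<close>

section \<open>Fractional maximal functions\<close>

text \<open>On the whole space the radius can stay fixed while the ball moves, and only averages of
  the gradient appear. Near the boundary the radius has to shrink with the distance to the
  complement; the weight is then differentiated as well, at the cost of a term of order \<beta> - 1
  in \<open>f\<close> itself. This term explains two hypotheses: \<beta> \<ge> 1 keeps the order
  nonnegative, and the embedding puts \<open>f\<close> into L^s with 1/s = 1/p - 1/n, so that 1/s -
  (\<beta> - 1)/n = 1/p - \<beta>/n = 1/q and both terms land in the same space. The functions are
  extended by zero, possibly with jumps at the boundary: \<open>G\<close> only has to bound local
  averages from above, so global maximal functions of the extensions serve. The parameter \<gamma>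
  enters through the two bounds on \<open>W\<close> alone. On a single segment the integral of
  \<open>G\<close> may be infinite; it is controlled only after averaging over the end point, which
  is why difference quotients are formed of ball averages of \<open>u\<close>, and why the gradient
  bound carries a further maximal function \<open>M_0\<close>.\<close>

definition epow :: "ennreal \<Rightarrow> real \<Rightarrow> ennreal" where
  "epow x p = (if x = top then top else ennreal (enn2real x powr p))"

lemma epow_ennreal: "0 \<le> x \<Longrightarrow> epow (ennreal x) p = ennreal (x powr p)"
  by (simp add: epow_def)

lemma epow_top [simp]: "epow top p = top"
  by (simp add: epow_def)

lemma epow_0 [simp]: "epow 0 p = 0"
  by (simp add: epow_def)

lemma epow_mono: "0 \<le> p \<Longrightarrow> x \<le> y \<Longrightarrow> epow x p \<le> epow y p"
  by (cases x; cases y) (auto simp: epow_ennreal intro!: ennreal_leI powr_mono2 simp: top_unique)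

text \<open>Valid for every real \<open>p\<close>, because 0 and \<open>top\<close> are fixed by
  every exponent and \<open>0 * top = 0\<close>.\<close>

lemma epow_mult: "epow (x * y) p = epow x p * epow y p"
  by (cases x; cases y)
     (auto simp: epow_ennreal ennreal_mult[symmetric] powr_mult ennreal_top_mult ennreal_mult_top)

lemma epow_epow: "epow (epow x p) q = epow x (p * q)"
  by (cases x) (auto simp: epow_ennreal powr_powr)

lemma epow_1 [simp]: "epow x 1 = x"
  by (cases x) (auto simp: epow_ennreal)

lemma epow_add: "epow x (p + q) = epow x p * epow x q"
  by (cases x) (auto simp: epow_ennreal powr_add ennreal_mult)

lemma epow_eq_top_iff [simp]: "epow x p = top \<longleftrightarrow> x = top"
  by (cases x) (auto simp: epow_ennreal)

lemma epow_eq_0_iff [simp]: "epow x p = 0 \<longleftrightarrow> x = 0"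
  by (cases x) (auto simp: epow_ennreal)

lemma epow_measurable [measurable]:
  "f \<in> borel_measurable M \<Longrightarrow> (\<lambda>x. epow (f x) p) \<in> borel_measurable M"
proof -
  assume [measurable]: "f \<in> borel_measurable M"
  have "(\<lambda>x. if f x \<in> {top} then top else ennreal (enn2real (f x) powr p)) \<in> borel_measurable M"
    by measurable
  then show ?thesis by (simp add: epow_def)
qed

text \<open>Bounding the sum by twice its larger term works for every nonnegative exponent, so the
  lemma serves both for an exponent and for its reciprocal.\<close>

lemma epow_add_le:
  assumes "0 \<le> p" shows "epow (x + y) p \<le> ennreal (2 powr p) * (epow x p + epow y p)"
proof -
  have *: "epow (x + y) p \<le> ennreal (2 powr p) * (epow x p + epow y p)" if "x \<le> y" for x y
  proof -
    have "epow (x + y) p \<le> epow (ennreal 2 * y) p"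
      using that assms by (intro epow_mono) (simp_all add: mult_2 ennreal_numeral add_right_mono)
    also have "\<dots> = ennreal (2 powr p) * epow y p"
      by (subst epow_mult) (simp add: epow_ennreal del: ennreal_numeral)
    also have "\<dots> \<le> ennreal (2 powr p) * (epow x p + epow y p)"
      by (intro mult_left_mono) auto
    finally show ?thesis .
  qed
  show ?thesis
    using *[of x y] *[of y x] linear[of x y] by (auto simp: add.commute)
qed

definition eLp :: "real \<Rightarrow> ('a::euclidean_space \<Rightarrow> ennreal) \<Rightarrow> ennreal" where
  "eLp p f = epow (\<integral>\<^sup>+x. epow (f x) p \<partial>lborel) (1 / p)"

lemma eLp_mono_AE: "0 < p \<Longrightarrow> AE x in lborel. f x \<le> g x \<Longrightarrow> eLp p f \<le> eLp p g"
  unfolding eLp_def by (intro epow_mono nn_integral_mono_AE) (auto intro: epow_mono elim!: eventually_mono)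

lemma eLp_cmult:
  assumes [measurable]: "f \<in> borel_measurable borel" and "0 < p"
  shows "eLp p (\<lambda>x. c * f x) = c * eLp p f"
  using assms(2) unfolding eLp_def
  by (simp add: epow_mult nn_integral_cmult epow_epow)

text \<open>A triangle inequality up to a constant: \<open>epow_add_le\<close> with exponent
  \<open>p\<close> contributes a factor 2 after the root is taken, and with exponent
  \<open>1 / p\<close> it contributes \<open>2 powr (1 / p)\<close>.\<close>

lemma eLp_add_le:
  assumes [measurable]: "f \<in> borel_measurable borel" "g \<in> borel_measurable borel" and p: "0 < p"
  shows "eLp p (\<lambda>x. f x + g x) \<le> ennreal (2 * 2 powr (1 / p)) * (eLp p f + eLp p g)"
proof -
  have "(\<integral>\<^sup>+x. epow (f x + g x) p \<partial>lborel)
      \<le> (\<integral>\<^sup>+x. ennreal (2 powr p) * (epow (f x) p + epow (g x) p) \<partial>lborel)"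
    using p by (intro nn_integral_mono epow_add_le) auto
  also have "\<dots> = ennreal (2 powr p) * ((\<integral>\<^sup>+x. epow (f x) p \<partial>lborel) + (\<integral>\<^sup>+x. epow (g x) p \<partial>lborel))"
    by (subst nn_integral_cmult) (auto simp: nn_integral_add)
  finally have "eLp p (\<lambda>x. f x + g x)
      \<le> epow (ennreal (2 powr p) * ((\<integral>\<^sup>+x. epow (f x) p \<partial>lborel) + (\<integral>\<^sup>+x. epow (g x) p \<partial>lborel))) (1 / p)"
    unfolding eLp_def using p by (intro epow_mono) auto
  also have "\<dots> = 2 * epow ((\<integral>\<^sup>+x. epow (f x) p \<partial>lborel) + (\<integral>\<^sup>+x. epow (g x) p \<partial>lborel)) (1 / p)"
    using p by (simp add: epow_mult epow_ennreal powr_powr)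
  also have "\<dots> \<le> 2 * (ennreal (2 powr (1/p)) * (eLp p f + eLp p g))"
    unfolding eLp_def using p by (intro mult_left_mono epow_add_le) auto
  also have "\<dots> = ennreal (2 * 2 powr (1 / p)) * (eLp p f + eLp p g)"
    by (simp add: ennreal_mult mult.assoc)
  finally show ?thesis .
qed

lemma eLp_finite_AE:
  assumes [measurable]: "f \<in> borel_measurable borel" and "0 < p" "eLp p f < top"
  shows "AE x in lborel. f x < top"
proof -
  have "(\<integral>\<^sup>+x. epow (f x) p \<partial>lborel) \<noteq> top"
    using assms(3) by (auto simp: eLp_def top.not_eq_extremum[symmetric])
  then have "AE x in lborel. epow (f x) p \<noteq> \<infinity>"
    by (intro nn_integral_PInf_AE) auto
  then show ?thesis by (simp add: top.not_eq_extremum[symmetric] infinity_ennreal_def)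
qed

text \<open>For the weight \<open>r powr (\<alpha> - DIM('a))\<close> this is the fractional maximal function up to a constant.\<close>

definition fmax :: "real \<Rightarrow> ('a::euclidean_space \<Rightarrow> ennreal) \<Rightarrow> 'a \<Rightarrow> ennreal" where
  "fmax \<alpha> f x = (SUP r\<in>{0<..}. ennreal (r powr (\<alpha> - real DIM('a))) * (\<integral>\<^sup>+y. f y * indicator (ball x r) y \<partial>lborel))"

lemma fmax_upper:
  fixes f :: "'a::euclidean_space \<Rightarrow> ennreal"
  shows "0 < r \<Longrightarrow> ennreal (r powr (\<alpha> - real DIM('a))) * (\<integral>\<^sup>+y. f y * indicator (ball x r) y \<partial>lborel) \<le> fmax \<alpha> f x"
  unfolding fmax_def by (rule SUP_upper) auto

section \<open>Lower semicontinuity and measurability of maximal functions\<close>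

lemma admissible_radii_ball_subset:
  assumes "r \<in> admissible_radii \<Omega> x" shows "ball x r \<subseteq> \<Omega>"
proof
  fix y assume y: "y \<in> ball x r"
  show "y \<in> \<Omega>"
  proof (rule ccontr)
    assume "y \<notin> \<Omega>"
    then have "infdist x (- \<Omega>) \<le> dist x y" by (intro infdist_le) auto
    with assms y \<open>y \<notin> \<Omega>\<close> show False by (auto simp: admissible_radii_def)
  qed
qed

lemma admissible_radii_stable:
  assumes "r \<in> admissible_radii \<Omega> x"
  obtains e where "0 < e" "\<And>y. dist x y < e \<Longrightarrow> r \<in> admissible_radii \<Omega> y"
proof (cases "\<Omega> = UNIV")
  case True
  with assms that[of 1] show ?thesis by (auto simp: admissible_radii_def)
next
  case False
  show ?thesis
  proof (rule that[of "infdist x (- \<Omega>) - r"])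
    show "0 < infdist x (- \<Omega>) - r" using assms False by (auto simp: admissible_radii_def)
    fix y assume "dist x y < infdist x (- \<Omega>) - r"
    then show "r \<in> admissible_radii \<Omega> y"
      using assms False infdist_triangle[of x "- \<Omega>" y]
      by (auto simp: admissible_radii_def)
  qed
qed

text \<open>The smaller balls leave room to move the centre without leaving the original ball. For
  small \<open>k\<close> the radius may be negative and the ball empty.\<close>

lemma set_nn_integral_ball_approx:
  fixes f :: "'a::euclidean_space \<Rightarrow> ennreal"
  assumes [measurable]: "f \<in> borel_measurable borel"
  shows "(SUP k. (\<integral>\<^sup>+y. f y * indicator (ball x (r - 1 / real (Suc k))) y \<partial>lborel))
       = (\<integral>\<^sup>+y. f y * indicator (ball x r) y \<partial>lborel)"
proof -
  have *: "(\<Union>k. ball x (r - 1 / real (Suc k))) = ball x r"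
  proof safe
    fix y assume "y \<in> ball x r"
    then have "0 < r - dist x y" by simp
    then obtain k where "inverse (real (Suc k)) < r - dist x y"
      using reals_Archimedean by blast
    then show "y \<in> (\<Union>k. ball x (r - 1 / real (Suc k)))"
      by (intro UN_I[of k]) (auto simp: inverse_eq_divide)
  next
    fix y k assume "y \<in> ball x (r - 1 / real (Suc k))"
    then show "y \<in> ball x r"
      by (simp) (smt (verit) of_nat_0_le_iff zero_le_divide_1_iff)
  qed
  have inc: "incseq (\<lambda>k. ball x (r - 1 / real (Suc k)))"
  proof (rule incseq_SucI)
    fix k
    have "1 / real (Suc (Suc k)) \<le> 1 / real (Suc k)" by (simp add: field_simps)
    then show "ball x (r - 1 / real (Suc k)) \<subseteq> ball x (r - 1 / real (Suc (Suc k)))" by auto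
  qed
  have "(SUP k. emeasure (density lborel f) (ball x (r - 1 / real (Suc k))))
      = emeasure (density lborel f) (\<Union>k. ball x (r - 1 / real (Suc k)))"
    by (rule SUP_emeasure_incseq) (use inc in auto)
  then show ?thesis unfolding * by (simp add: emeasure_density)
qed

text \<open>A slightly smaller ball around \<open>x\<close> already exceeds the level, and it lies
  in the ball of radius \<open>r\<close> around every nearby \<open>y\<close>. The radius itself is
  kept, so the weight \<open>w\<close> may be arbitrary.\<close>

lemma open_superlevel_maximal:
  fixes f :: "'a::euclidean_space \<Rightarrow> ennreal"
  assumes [measurable]: "f \<in> borel_measurable borel" and \<Omega>: "open \<Omega>"
  shows "open {x\<in>\<Omega>. a < (SUP r\<in>admissible_radii \<Omega> x. w r * (\<integral>\<^sup>+y. f y * indicator (ball x r) y \<partial>lborel))}"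
proof (unfold open_dist, intro ballI)
  fix x assume "x \<in> {x\<in>\<Omega>. a < (SUP r\<in>admissible_radii \<Omega> x. w r * (\<integral>\<^sup>+y. f y * indicator (ball x r) y \<partial>lborel))}"
  then obtain r where x: "x \<in> \<Omega>" and r: "r \<in> admissible_radii \<Omega> x"
    and a: "a < w r * (\<integral>\<^sup>+y. f y * indicator (ball x r) y \<partial>lborel)"
    by (auto simp: less_SUP_iff)
  have "a < (SUP k. w r * (\<integral>\<^sup>+y. f y * indicator (ball x (r - 1 / real (Suc k))) y \<partial>lborel))"
    using a by (subst SUP_mult_left_ennreal[symmetric], subst set_nn_integral_ball_approx) auto
  then obtain k where k: "a < w r * (\<integral>\<^sup>+y. f y * indicator (ball x (r - 1 / real (Suc k))) y \<partial>lborel)"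
    by (auto simp: less_SUP_iff)
  obtain e where e: "0 < e" "\<And>y. dist x y < e \<Longrightarrow> r \<in> admissible_radii \<Omega> y"
    using admissible_radii_stable[OF r] by blast
  obtain d where d: "d > 0" "ball x d \<subseteq> \<Omega>" using \<Omega> x open_contains_ball by blast
  let ?e = "min d (min e (1 / real (Suc k)))"
  show "\<exists>e>0. \<forall>y. dist y x < e \<longrightarrow> y \<in> {x\<in>\<Omega>. a < (SUP r\<in>admissible_radii \<Omega> x. w r * (\<integral>\<^sup>+y. f y * indicator (ball x r) y \<partial>lborel))}"
  proof (intro exI[of _ ?e] conjI allI impI)
    show "0 < ?e" using e d by simp
    fix y assume y: "dist y x < ?e"
    have sub: "ball x (r - 1 / real (Suc k)) \<subseteq> ball y r"
    proof
      fix z assume "z \<in> ball x (r - 1 / real (Suc k))"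
      with y dist_triangle[of y z x] show "z \<in> ball y r" by simp
    qed
    have "a < w r * (\<integral>\<^sup>+y. f y * indicator (ball x (r - 1 / real (Suc k))) y \<partial>lborel)" by (rule k)
    also have "\<dots> \<le> w r * (\<integral>\<^sup>+z. f z * indicator (ball y r) z \<partial>lborel)"
      using sub by (intro mult_left_mono nn_integral_mono) (auto split: split_indicator)
    also have "\<dots> \<le> (SUP r\<in>admissible_radii \<Omega> y. w r * (\<integral>\<^sup>+z. f z * indicator (ball y r) z \<partial>lborel))"
      using e(2)[of y] y by (intro SUP_upper) (auto simp: dist_commute)
    finally have "a < \<dots>" .
    moreover have "y \<in> \<Omega>" using d y by (auto simp: subset_eq dist_commute)
    ultimately show "y \<in> {x\<in>\<Omega>. a < (SUP r\<in>admissible_radii \<Omega> x. w r * (\<integral>\<^sup>+y. f y * indicator (ball x r) y \<partial>lborel))}"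
      by simp
  qed
qed

lemma fmax_eq_admissible:
  "fmax \<alpha> f (x::'a) = (SUP r\<in>admissible_radii UNIV x. ennreal (r powr (\<alpha> - real DIM('a))) * (\<integral>\<^sup>+y. f y * indicator (ball x r) y \<partial>lborel))"
  for f :: "'a::euclidean_space \<Rightarrow> ennreal"
  by (simp add: fmax_def admissible_radii_def greaterThan_def)

lemma fmax_measurable [measurable]:
  fixes f :: "'a::euclidean_space \<Rightarrow> ennreal"
  assumes [measurable]: "f \<in> borel_measurable borel"
  shows "fmax \<alpha> f \<in> borel_measurable borel"
proof (rule borel_measurableI_greater)
  fix a :: ennreal
  show "{x \<in> space borel. a < fmax \<alpha> f x} \<in> sets borel"
    using open_superlevel_maximal[of f UNIV a] unfolding fmax_eq_admissible by simp
qed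

section \<open>Weak type and strong type bounds of order 0\<close>

lemma emeasure_lborel_ball:
  fixes x :: "'a::euclidean_space"
  assumes "0 \<le> r"
  shows "emeasure lborel (ball x r) = ennreal (unit_ball_vol (real DIM('a)) * r ^ DIM('a))"
  using emeasure_ball[OF assms, of x] by simp

lemma ball_sets_borel [measurable]: "ball (x::'a::metric_space) r \<in> sets borel"
  by simp

text \<open>Every point of the superlevel set is the centre of a ball with mass above
  \<open>l * r ^ n\<close>. Vitali's lemma selects disjoint ones whose fivefold enlargements still
  cover the set, and disjointness bounds the sum of their masses by the integral of
  \<open>f\<close>. As \<open>fmax\<close> is not normalised by the volume, the constant contains
  \<open>unit_ball_vol\<close>.\<close>

lemma fmax_weak_type:
  fixes f :: "'a::euclidean_space \<Rightarrow> ennreal"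
  assumes [measurable]: "f \<in> borel_measurable borel" and l: "0 < l"
  shows "emeasure lborel {x. ennreal l < fmax 0 f x}
     \<le> ennreal (5 ^ DIM('a) * unit_ball_vol (real DIM('a)) / l) * (\<integral>\<^sup>+y. f y \<partial>lborel)"
proof (cases "(\<integral>\<^sup>+y. f y \<partial>lborel) = top")
  case True
  have "ennreal c * top = top" if "0 < c" for c using that by (simp add: ennreal_mult_top)
  from this[of "5 ^ DIM('a) * unit_ball_vol (real DIM('a)) / l"] l show ?thesis unfolding True by simp
next
  case False
  define n where "n = DIM('a)"
  have n: "0 < n" unfolding n_def by simp
  define v where "v = unit_ball_vol (real n)"
  have v: "0 < v" unfolding v_def by simp
  obtain I where I: "(\<integral>\<^sup>+y. f y \<partial>lborel) = ennreal I" "0 \<le> I"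
    using False by (cases "\<integral>\<^sup>+y. f y \<partial>lborel") auto
  define K where "K = {x. ennreal l < fmax 0 f x}"
  define J where "J x r = (\<integral>\<^sup>+y. f y * indicator (ball x r) y \<partial>lborel)" for x r
  have "\<exists>r>0. ennreal l < ennreal (r powr (- real n)) * J x r" if "x \<in> K" for x
    using that unfolding K_def fmax_def J_def n_def by (auto simp: less_SUP_iff)
  then obtain r where r: "\<And>x. x \<in> K \<Longrightarrow> 0 < r x"
    and lr: "\<And>x. x \<in> K \<Longrightarrow> ennreal l < ennreal (r x powr (- real n)) * J x (r x)" by metis
  have J_le: "J x r \<le> ennreal I" for x r
    unfolding J_def I(1)[symmetric] by (intro nn_integral_mono) (auto split: split_indicator)
  have key: "ennreal (r x ^ n) \<le> ennreal (1 / l) * J x (r x)" if "x \<in> K" for x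
  proof -
    obtain j where j: "J x (r x) = ennreal j" "0 \<le> j"
      using J_le[of x "r x"] by (cases "J x (r x)") (auto simp: top_unique)
    have "l < r x powr (- real n) * j"
      using lr[OF that] l j by (simp add: ennreal_mult[symmetric] ennreal_less_iff)
    then have "r x ^ n \<le> 1 / l * j"
      using r[OF that] l by (simp add: powr_minus powr_realpow field_simps)
    then show ?thesis using j l by (simp add: ennreal_mult[symmetric] del: times_divide_eq_left)
  qed
  \<comment> \<open>Vitali's lemma asks for bounded radii. A radius above 1 is at most its own power
    \<open>r x ^ n\<close>, and the finite integral bounds the latter.\<close>
  have bound: "r x \<le> max 1 (I / l)" if "x \<in> K" for x
  proof (cases "r x \<le> 1")
    case False
    have "ennreal (r x ^ n) \<le> ennreal (1 / l) * ennreal I"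
      using key[OF that] J_le[of x "r x"] by (meson mult_left_mono order_trans zero_le)
    then have "r x ^ n \<le> I / l"
      using I l by (simp add: ennreal_mult[symmetric] ennreal_le_iff divide_nonneg_pos)
    moreover have "r x \<le> r x ^ n" using False n by (simp add: self_le_power)
    ultimately show ?thesis by simp
  qed simp
  obtain C where C: "countable C" "C \<subseteq> K"
     "pairwise (\<lambda>i j. disjnt (cball i (r i)) (cball j (r j))) C"
     and cov: "\<And>i. i\<in>K \<Longrightarrow> \<exists>j. j \<in> C \<and> \<not> disjnt (cball i (r i)) (cball j (r j)) \<and> cball i (r i) \<subseteq> ball j (5 * r j)"
    using Vitali_covering_lemma_cballs_balls[of K r "max 1 (I / l)" "\<lambda>x. x"] r bound by (metis (no_types, lifting))
  have disj: "disjoint_family_on (\<lambda>j. ball j (r j)) C"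
    using C(3) ball_subset_cball unfolding disjoint_family_on_def pairwise_def disjnt_def by blast
  \<comment> \<open>The sum over the countable family is written as an integral for the counting
    measure, so that it can be exchanged with the integral over space.\<close>
  have "emeasure lborel K \<le> (\<integral>\<^sup>+x. (\<integral>\<^sup>+j. indicator (ball j (5 * r j)) x \<partial>count_space C) \<partial>lborel)"
  proof -
    have "K \<in> sets borel" unfolding K_def by measurable
    then have "emeasure lborel K = (\<integral>\<^sup>+x. indicator K x \<partial>lborel)" by simp
    also have "\<dots> \<le> (\<integral>\<^sup>+x. (\<integral>\<^sup>+j. indicator (ball j (5 * r j)) x \<partial>count_space C) \<partial>lborel)"
    proof (intro nn_integral_mono)
      fix x show "indicator K x \<le> (\<integral>\<^sup>+j. indicator (ball j (5 * r j)) x \<partial>count_space C)"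
      proof (cases "x \<in> K")
        case True
        from cov[OF True] r[OF True] obtain j where j: "j \<in> C" "x \<in> ball j (5 * r j)" by force
        have "1 = (\<integral>\<^sup>+i. indicator {j} i \<partial>count_space C)"
          using j by (subst nn_integral_indicator) auto
        also have "\<dots> \<le> (\<integral>\<^sup>+j. indicator (ball j (5 * r j)) x \<partial>count_space C)"
          using j by (intro nn_integral_mono) (auto split: split_indicator)
        finally show ?thesis using True by simp
      qed simp
    qed
    finally show ?thesis .
  qed
  also have "\<dots> = (\<integral>\<^sup>+j. (\<integral>\<^sup>+x. indicator (ball j (5 * r j)) x \<partial>lborel) \<partial>count_space C)"
    using nn_integral_count_space_nn_integral[of C "\<lambda>j. indicator (ball j (5 * r j))" lborel] C(1) by simp
  also have "\<dots> \<le> (\<integral>\<^sup>+j. ennreal (5 ^ n * v / l) * J j (r j) \<partial>count_space C)"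
  proof (intro nn_integral_mono)
    fix j assume "j \<in> space (count_space C)"
    then have j: "j \<in> K" using C by auto
    have "(\<integral>\<^sup>+x. indicator (ball j (5 * r j)) x \<partial>lborel) = ennreal (v * (5 * r j) ^ n)"
      using r[OF j] unfolding v_def n_def by (simp add: emeasure_lborel_ball)
    also have "\<dots> = ennreal (5 ^ n * v) * ennreal (r j ^ n)"
      using v r[OF j] by (simp add: ennreal_mult[symmetric] power_mult_distrib mult_ac)
    also have "\<dots> \<le> ennreal (5 ^ n * v) * (ennreal (1 / l) * J j (r j))"
      by (intro mult_left_mono key[OF j]) auto
    also have "\<dots> = ennreal (5 ^ n * v / l) * J j (r j)"
      using v l by (simp add: mult.assoc[symmetric] ennreal_mult[symmetric])
    finally show "(\<integral>\<^sup>+x. indicator (ball j (5 * r j)) x \<partial>lborel) \<le> \<dots>" .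
  qed
  also have "\<dots> = ennreal (5 ^ n * v / l) * (\<integral>\<^sup>+j. J j (r j) \<partial>count_space C)"
    by (rule nn_integral_cmult) simp
  also have "(\<integral>\<^sup>+j. J j (r j) \<partial>count_space C) = (\<integral>\<^sup>+j. emeasure (density lborel f) (ball j (r j)) \<partial>count_space C)"
    by (simp add: J_def emeasure_density)
  also have "\<dots> = emeasure (density lborel f) (\<Union>j\<in>C. ball j (r j))"
    by (rule emeasure_UN_countable[symmetric]) (use C disj in auto)
  also have "\<dots> \<le> emeasure (density lborel f) UNIV"
    by (rule emeasure_mono) auto
  also have "\<dots> = (\<integral>\<^sup>+y. f y \<partial>lborel)" by (simp add: emeasure_density)
  finally show ?thesis unfolding K_def v_def n_def by (simp add: mult_left_mono)
qed

lemma nn_integral_powr_from_0: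
  assumes "-1 < a" "0 \<le> c"
  shows "(\<integral>\<^sup>+x. ennreal (x powr a) * indicator {0..c} x \<partial>lborel) = ennreal (c powr (a + 1) / (a + 1))"
proof -
  have "((\<lambda>x. x powr a) has_integral (c powr (a + 1) / (a + 1))) {0..c}"
    by (rule has_integral_powr_from_0[OF assms])
  then have "((\<lambda>x. if x \<in> {0..c} then x powr a else 0) has_integral (c powr (a + 1) / (a + 1))) UNIV"
    by (subst has_integral_restrict_UNIV) 
  then have "((\<lambda>x. indicator {0..c} x * x powr a) has_integral (c powr (a + 1) / (a + 1))) UNIV"
    by (rule has_integral_eq[rotated]) (simp add: indicator_def)
  then have "(\<integral>\<^sup>+x. ennreal (indicator {0..c} x * x powr a) \<partial>lborel) = ennreal (c powr (a + 1) / (a + 1))"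
    by (intro nn_integral_has_integral_lborel) auto
  then show ?thesis by (simp add: ennreal_mult' ennreal_indicator mult.commute)
qed

text \<open>The one-variable identity behind the layer cake formula. It has to cover
  \<open>x = top\<close>, since a maximal function may be infinite.\<close>

lemma nn_integral_powr_below:
  assumes "0 < p"
  shows "(\<integral>\<^sup>+l. ennreal (l powr (p - 1)) * indicator {l. 0 < l \<and> ennreal l < x} l \<partial>lborel)
       = ennreal (1 / p) * epow x p"
proof (cases x)
  case (real c)
  have "(\<integral>\<^sup>+l. ennreal (l powr (p - 1)) * indicator {l. 0 < l \<and> ennreal l < x} l \<partial>lborel)
      = (\<integral>\<^sup>+l. ennreal (l powr (p - 1)) * indicator {0..c} l \<partial>lborel)"
  proof (rule nn_integral_cong_AE)
    have "AE l in lborel. l \<noteq> 0 \<and> l \<noteq> c"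
      using AE_lborel_singleton[of 0] AE_lborel_singleton[of c] by eventually_elim auto
    then show "AE l in lborel. ennreal (l powr (p - 1)) * indicator {l. 0 < l \<and> ennreal l < x} l
        = ennreal (l powr (p - 1)) * indicator {0..c} l"
      by eventually_elim (use real in \<open>auto simp: ennreal_less_iff split: split_indicator\<close>)
  qed
  then show ?thesis using real assms
    by (simp add: nn_integral_powr_from_0 epow_ennreal ennreal_mult[symmetric])
next
  case top
  have "ennreal (k powr p / p) \<le> (\<integral>\<^sup>+l. ennreal (l powr (p - 1)) * indicator {l. 0 < l \<and> ennreal l < x} l \<partial>lborel)"
    if "0 \<le> k" for k
  proof -
    have "ennreal (k powr p / p) = (\<integral>\<^sup>+l. ennreal (l powr (p - 1)) * indicator {0..k} l \<partial>lborel)"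
      using nn_integral_powr_from_0[of "p - 1" k] assms that by simp
    also have "\<dots> \<le> (\<integral>\<^sup>+l. ennreal (l powr (p - 1)) * indicator {l. 0 < l \<and> ennreal l < x} l \<partial>lborel)"
      using top by (intro nn_integral_mono) (auto split: split_indicator)
    finally show ?thesis .
  qed
  note le = this
  \<comment> \<open>With \<open>k = (p * a) powr (1 / p)\<close> the lower bound
    \<open>k powr p / p\<close> equals \<open>a\<close>.\<close>
  have *: "ennreal a \<le> (\<integral>\<^sup>+l. ennreal (l powr (p - 1)) * indicator {l. 0 < l \<and> ennreal l < x} l \<partial>lborel)"
    if "0 \<le> a" for a
    using le[of "(p * a) powr (1/p)"] that assms by (simp add: powr_powr abs_mult)
  have "(\<integral>\<^sup>+l. ennreal (l powr (p - 1)) * indicator {l. 0 < l \<and> ennreal l < x} l \<partial>lborel) = top"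
  proof (rule ccontr)
    assume "\<not> ?thesis"
    then obtain b where b: "(\<integral>\<^sup>+l. ennreal (l powr (p - 1)) * indicator {l. 0 < l \<and> ennreal l < x} l \<partial>lborel) = ennreal b" "0 \<le> b"
      by (cases "\<integral>\<^sup>+l. ennreal (l powr (p - 1)) * indicator {l. 0 < l \<and> ennreal l < x} l \<partial>lborel") auto
    with *[of "b + 1"] show False by simp
  qed
  then show ?thesis using top assms by (simp add: ennreal_mult_top)
qed

text \<open>The part of \<open>f\<close> below \<open>l / (2 * v)\<close> contributes at most
  \<open>l / 2\<close> to the maximal function, so the weak-type bound at height
  \<open>l / 2\<close> is paid only for the part above. This is the truncation step of Marcinkiewicz
  interpolation.\<close>

lemma fmax_weak_type_truncated:
  fixes f :: "'a::euclidean_space \<Rightarrow> ennreal"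
  assumes [measurable]: "f \<in> borel_measurable borel" and l: "0 < l"
  defines "v \<equiv> unit_ball_vol (real DIM('a))"
  shows "emeasure lborel {x. ennreal l < fmax 0 f x}
     \<le> ennreal (2 * 5 ^ DIM('a) * v / l) * (\<integral>\<^sup>+y. f y * indicator {y. ennreal l < ennreal (2 * v) * f y} y \<partial>lborel)"
proof -
  define g where "g y = f y * indicator {y. ennreal l < ennreal (2 * v) * f y} y" for y
  have [measurable]: "g \<in> borel_measurable borel" unfolding g_def by measurable
  have v: "0 < v" unfolding v_def by simp
  have fg: "f y \<le> g y + ennreal (l / (2 * v))" for y
  proof (cases "ennreal l < ennreal (2 * v) * f y")
    case False
    show ?thesis
    proof (cases "f y")
      case (real c)
      then have "2 * v * c \<le> l"
        using False v l by (simp add: ennreal_mult[symmetric] ennreal_less_iff not_less ennreal_le_iff)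
      then have "c \<le> l / (2 * v)" using v by (simp add: field_simps)
      then show ?thesis using False real by (simp add: g_def ennreal_leI)
    next
      case top then show ?thesis using False v by (auto simp: ennreal_mult_top)
    qed
  qed (simp add: g_def)
  have "fmax 0 f x \<le> fmax 0 g x + ennreal (l / 2)" for x
    unfolding fmax_def
  proof (rule SUP_least)
    fix r :: real assume "r \<in> {0<..}" then have r: "0 < r" by simp
    have "(\<integral>\<^sup>+y. f y * indicator (ball x r) y \<partial>lborel)
        \<le> (\<integral>\<^sup>+y. g y * indicator (ball x r) y + ennreal (l / (2 * v)) * indicator (ball x r) y \<partial>lborel)"
      by (intro nn_integral_mono) (auto split: split_indicator simp: fg)
    also have "\<dots> = (\<integral>\<^sup>+y. g y * indicator (ball x r) y \<partial>lborel) + ennreal (l / (2 * v)) * emeasure lborel (ball x r)"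
    proof -
      have "(\<integral>\<^sup>+y. ennreal (l / (2 * v)) * indicator (ball x r) y \<partial>lborel) = ennreal (l / (2 * v)) * emeasure lborel (ball x r)"
        by (rule nn_integral_cmult_indicator) simp
      moreover have "(\<integral>\<^sup>+y. g y * indicator (ball x r) y + ennreal (l / (2 * v)) * indicator (ball x r) y \<partial>lborel)
        = (\<integral>\<^sup>+y. g y * indicator (ball x r) y \<partial>lborel) + (\<integral>\<^sup>+y. ennreal (l / (2 * v)) * indicator (ball x r) y \<partial>lborel)"
        by (rule nn_integral_add) measurable
      ultimately show ?thesis by simp
    qed
    also have "ennreal (l / (2 * v)) * emeasure lborel (ball x r) = ennreal (l / 2 * r ^ DIM('a))"
      using l v r unfolding emeasure_lborel_ball[OF less_imp_le[OF r]] v_def[symmetric]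
      by (simp add: ennreal_mult[symmetric])
    finally have "ennreal (r powr (0 - real DIM('a))) * (\<integral>\<^sup>+y. f y * indicator (ball x r) y \<partial>lborel)
        \<le> ennreal (r powr (0 - real DIM('a))) * ((\<integral>\<^sup>+y. g y * indicator (ball x r) y \<partial>lborel) + ennreal (l / 2 * r ^ DIM('a)))"
      by (intro mult_left_mono) auto
    also have "\<dots> = ennreal (r powr (0 - real DIM('a))) * (\<integral>\<^sup>+y. g y * indicator (ball x r) y \<partial>lborel)
        + ennreal (l / 2)"
    proof -
      have "r powr (0 - real DIM('a)) * (l / 2 * r ^ DIM('a)) = l / 2"
        using r by (simp add: powr_minus powr_realpow field_simps)
      then show ?thesis using l r by (simp only: distrib_left) (simp add: ennreal_mult[symmetric])
    qed
    also have "\<dots> \<le> (SUP r\<in>{0<..}. ennreal (r powr (0 - real DIM('a))) * (\<integral>\<^sup>+y. g y * indicator (ball x r) y \<partial>lborel)) + ennreal (l / 2)"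
      using r by (intro add_right_mono SUP_upper) auto
    finally show "ennreal (r powr (0 - real DIM('a))) * (\<integral>\<^sup>+y. f y * indicator (ball x r) y \<partial>lborel) \<le> \<dots>" .
  qed
  note le = this
  have "ennreal (l / 2) < fmax 0 g x" if "ennreal l < fmax 0 f x" for x
  proof (rule ccontr)
    assume "\<not> ennreal (l / 2) < fmax 0 g x"
    then have "fmax 0 f x \<le> ennreal (l / 2) + ennreal (l / 2)"
      using le[of x] by (meson add_right_mono not_less order_trans)
    also have "\<dots> = ennreal l" using l by (simp add: ennreal_plus[symmetric] del: ennreal_plus)
    finally show False using that by simp
  qed
  then have "emeasure lborel {x. ennreal l < fmax 0 f x} \<le> emeasure lborel {x. ennreal (l / 2) < fmax 0 g x}"
    by (intro emeasure_mono) (auto)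
  also have "\<dots> \<le> ennreal (5 ^ DIM('a) * v / (l / 2)) * (\<integral>\<^sup>+y. g y \<partial>lborel)"
    unfolding v_def using l by (intro fmax_weak_type) auto
  finally show ?thesis by (simp add: g_def mult_ac)
qed

text \<open>The layer cake formula, with the weak-type bound applied to each level.\<close>

lemma fmax_0_integral_le:
  fixes f :: "'a::euclidean_space \<Rightarrow> ennreal"
  assumes [measurable]: "f \<in> borel_measurable borel" and p: "1 < p"
  defines "v \<equiv> unit_ball_vol (real DIM('a))"
  shows "(\<integral>\<^sup>+x. epow (fmax 0 f x) p \<partial>lborel)
    \<le> ennreal (p * (2 * 5 ^ DIM('a) * v) / (p - 1) * (2 * v) powr (p - 1)) * (\<integral>\<^sup>+x. epow (f x) p \<partial>lborel)"
proof -
  define c where "c = 2 * 5 ^ DIM('a) * v"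
  have v: "0 < v" unfolding v_def by simp
  have c: "0 < c" unfolding c_def using v by simp
  let ?L = "lborel :: real measure"
  have "(\<integral>\<^sup>+x. epow (fmax 0 f x) p \<partial>lborel)
      = (\<integral>\<^sup>+x. ennreal p * (\<integral>\<^sup>+l. ennreal (l powr (p - 1)) * indicator {l. 0 < l \<and> ennreal l < fmax 0 f x} l \<partial>?L) \<partial>lborel)"
    using p by (subst nn_integral_powr_below) (auto simp: mult.assoc[symmetric] ennreal_mult[symmetric])
  also have "\<dots> = ennreal p * (\<integral>\<^sup>+x. (\<integral>\<^sup>+l. ennreal (l powr (p - 1)) * indicator {(x, l). 0 < l \<and> ennreal l < fmax 0 f x} (x, l) \<partial>?L) \<partial>lborel)"
    by (subst nn_integral_cmult) (auto simp: indicator_def)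
  also have "(\<integral>\<^sup>+x. (\<integral>\<^sup>+l. ennreal (l powr (p - 1)) * indicator {(x, l). 0 < l \<and> ennreal l < fmax 0 f x} (x, l) \<partial>?L) \<partial>lborel)
     = (\<integral>\<^sup>+l. (\<integral>\<^sup>+x. ennreal (l powr (p - 1)) * indicator {(x, l). 0 < l \<and> ennreal l < fmax 0 f x} (x, l) \<partial>lborel) \<partial>?L)"
    by (rule lborel_pair.Fubini') measurable
  also have "\<dots> \<le> (\<integral>\<^sup>+l. (\<integral>\<^sup>+y. ennreal c * (ennreal (l powr (p - 2)) * (f y * indicator {(l, y). 0 < l \<and> ennreal l < ennreal (2 * v) * f y} (l, y))) \<partial>lborel) \<partial>?L)"
  proof (rule nn_integral_mono)
    fix l :: real
    show "(\<integral>\<^sup>+x. ennreal (l powr (p - 1)) * indicator {(x, l). 0 < l \<and> ennreal l < fmax 0 f x} (x, l) \<partial>lborel)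
        \<le> (\<integral>\<^sup>+y. ennreal c * (ennreal (l powr (p - 2)) * (f y * indicator {(l, y). 0 < l \<and> ennreal l < ennreal (2 * v) * f y} (l, y))) \<partial>lborel)"
    proof (cases "0 < l")
      case True
      have "(\<integral>\<^sup>+x. ennreal (l powr (p - 1)) * indicator {(x, l). 0 < l \<and> ennreal l < fmax 0 f x} (x, l) \<partial>lborel)
        = (\<integral>\<^sup>+x. ennreal (l powr (p - 1)) * indicator {x. ennreal l < fmax 0 f x} x \<partial>lborel)"
        using True by (intro nn_integral_cong) (auto split: split_indicator)
      also have "\<dots> = ennreal (l powr (p - 1)) * emeasure lborel {x. ennreal l < fmax 0 f x}"
        by (subst nn_integral_cmult) auto
      also have "\<dots> \<le> ennreal (l powr (p - 1)) * (ennreal (c / l) * (\<integral>\<^sup>+y. f y * indicator {y. ennreal l < ennreal (2 * v) * f y} y \<partial>lborel))"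
        unfolding c_def v_def by (intro mult_left_mono fmax_weak_type_truncated True) auto
      also have "\<dots> = ennreal (c * l powr (p - 2)) * (\<integral>\<^sup>+y. f y * indicator {y. ennreal l < ennreal (2 * v) * f y} y \<partial>lborel)"
      proof -
        have "l powr (p - 1) * (c / l) = c * l powr (p - 2)"
          using True powr_add[of l "p - 2" 1] by (simp add: field_simps)
        then show ?thesis using c True by (simp add: mult.assoc[symmetric] ennreal_mult[symmetric] del: times_divide_eq_right)
      qed
      also have "\<dots> = (\<integral>\<^sup>+y. ennreal (c * l powr (p - 2)) * (f y * indicator {y. ennreal l < ennreal (2 * v) * f y} y) \<partial>lborel)"
        by (rule nn_integral_cmult[symmetric]) measurable
      also have "\<dots> = (\<integral>\<^sup>+y. ennreal c * (ennreal (l powr (p - 2)) * (f y * indicator {(l, y). 0 < l \<and> ennreal l < ennreal (2 * v) * f y} (l, y))) \<partial>lborel)"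
        using True c by (intro nn_integral_cong) (auto split: split_indicator simp: ennreal_mult mult.assoc)
      finally show ?thesis .
    qed (auto simp: indicator_def)
  qed
  also have "\<dots> = (\<integral>\<^sup>+y. (\<integral>\<^sup>+l. ennreal c * (ennreal (l powr (p - 2)) * (f y * indicator {(l, y). 0 < l \<and> ennreal l < ennreal (2 * v) * f y} (l, y))) \<partial>?L) \<partial>lborel)"
    by (rule lborel_pair.Fubini') measurable
  \<comment> \<open>The inner integral is that of \<open>l powr (p - 2)\<close> up to the height
    \<open>2 * v * f y\<close>; it converges at 0 because \<open>p > 1\<close>.\<close>
  also have "\<dots> = (\<integral>\<^sup>+y. ennreal c * f y * (ennreal (1 / (p - 1)) * epow (ennreal (2 * v) * f y) (p - 1)) \<partial>lborel)"
  proof (rule nn_integral_cong)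
    fix y
    have "(\<integral>\<^sup>+l. ennreal c * (ennreal (l powr (p - 2)) * (f y * indicator {(l, y). 0 < l \<and> ennreal l < ennreal (2 * v) * f y} (l, y))) \<partial>?L)
      = (\<integral>\<^sup>+l. ennreal c * f y * (ennreal (l powr ((p - 1) - 1)) * indicator {l. 0 < l \<and> ennreal l < ennreal (2 * v) * f y} l) \<partial>?L)"
      by (intro nn_integral_cong) (auto split: split_indicator simp: mult_ac)
    also have "\<dots> = ennreal c * f y * (\<integral>\<^sup>+l. ennreal (l powr ((p - 1) - 1)) * indicator {l. 0 < l \<and> ennreal l < ennreal (2 * v) * f y} l \<partial>?L)"
      by (rule nn_integral_cmult) measurable
    also have "\<dots> = ennreal c * f y * (ennreal (1 / (p - 1)) * epow (ennreal (2 * v) * f y) (p - 1))"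
      using p by (subst nn_integral_powr_below) auto
    finally show "(\<integral>\<^sup>+l. ennreal c * (ennreal (l powr (p - 2)) * (f y * indicator {(l, y). 0 < l \<and> ennreal l < ennreal (2 * v) * f y} (l, y))) \<partial>?L) = \<dots>" .
  qed
  also have "\<dots> = (\<integral>\<^sup>+y. ennreal (c / (p - 1) * (2 * v) powr (p - 1)) * epow (f y) p \<partial>lborel)"
  proof (rule nn_integral_cong)
    fix y
    have 1: "epow (f y) p = epow (f y) (p - 1) * f y"
      using epow_add[of "f y" "p - 1" 1] by simp
    have 2: "epow (ennreal (2 * v) * f y) (p - 1) = ennreal ((2 * v) powr (p - 1)) * epow (f y) (p - 1)"
      using v by (subst epow_mult, subst epow_ennreal) auto
    have 3: "ennreal (c / (p - 1) * (2 * v) powr (p - 1)) = ennreal c * ennreal (1 / (p - 1)) * ennreal ((2 * v) powr (p - 1))"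
      using c p by (simp add: ennreal_mult[symmetric] del: ennreal_plus)
    show "ennreal c * f y * (ennreal (1 / (p - 1)) * epow (ennreal (2 * v) * f y) (p - 1))
      = ennreal (c / (p - 1) * (2 * v) powr (p - 1)) * epow (f y) p"
      unfolding 1 2 3 by (simp only: mult_ac)
  qed
  also have "\<dots> = ennreal (c / (p - 1) * (2 * v) powr (p - 1)) * (\<integral>\<^sup>+y. epow (f y) p \<partial>lborel)"
    by (rule nn_integral_cmult) measurable
  finally have "(\<integral>\<^sup>+x. epow (fmax 0 f x) p \<partial>lborel) \<le> ennreal p * (ennreal (c / (p - 1) * (2 * v) powr (p - 1)) * (\<integral>\<^sup>+y. epow (f y) p \<partial>lborel))"
    by (simp add: mult_left_mono)
  then show ?thesis using p c by (simp add: c_def[symmetric] mult.assoc[symmetric] ennreal_mult[symmetric])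
qed

section \<open>Maximal functions of positive order\<close>

lemma ball_integral_le_eLp:
  fixes f :: "'a::euclidean_space \<Rightarrow> ennreal"
  assumes [measurable]: "f \<in> borel_measurable borel" and p: "1 < p" and r: "0 < r"
  defines "v \<equiv> unit_ball_vol (real DIM('a))"
  shows "ennreal (r powr (real DIM('a) / p - real DIM('a))) * (\<integral>\<^sup>+y. f y * indicator (ball x r) y \<partial>lborel)
     \<le> ennreal (v + 1) * eLp p f"
proof -
  define n where "n = DIM('a)"
  define I where "I = (\<integral>\<^sup>+y. f y * indicator (ball x r) y \<partial>lborel)"
  have v: "0 < v" unfolding v_def by simp
  \<comment> \<open>A pointwise form of Hoelder's inequality with a free parameter: where
    \<open>f y \<le> t\<close> the first term suffices, and elsewhere \<open>f y\<close> is its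
    power \<open>1 - p\<close> times its power \<open>p\<close>, the first factor being at most
    \<open>t powr (1 - p)\<close>.\<close>
  have young: "f y \<le> ennreal t + ennreal (t powr (1 - p)) * epow (f y) p" if "0 < t" for t y
  proof (cases "f y")
    case (real c)
    show ?thesis
    proof (cases "c \<le> t")
      case True
      then have "f y \<le> ennreal t" using real by (simp add: ennreal_leI)
      then show ?thesis by (simp add: add_increasing2)
    next
      case False
      have "c = c powr (1 - p) * c powr p" using False that by (simp add: powr_add[symmetric])
      also have "\<dots> \<le> t powr (1 - p) * c powr p"
        using False that p by (intro mult_right_mono powr_mono2') auto
      finally have "f y \<le> ennreal (t powr (1 - p)) * epow (f y) p"
        using real by (simp add: epow_ennreal ennreal_mult[symmetric] ennreal_leI)
      then show ?thesis by (simp add: add_increasing)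
    qed
  next
    case top
    then show ?thesis using that by (simp add: ennreal_mult_top)
  qed
  have I_le: "I \<le> ennreal (t * v * r ^ n) + ennreal (t powr (1 - p)) * (\<integral>\<^sup>+y. epow (f y) p \<partial>lborel)" if "0 < t" for t
  proof -
    have "I \<le> (\<integral>\<^sup>+y. ennreal t * indicator (ball x r) y + ennreal (t powr (1 - p)) * epow (f y) p \<partial>lborel)"
      unfolding I_def using young[OF that] by (intro nn_integral_mono) (auto split: split_indicator)
    also have "\<dots> = ennreal t * emeasure lborel (ball x r) + ennreal (t powr (1 - p)) * (\<integral>\<^sup>+y. epow (f y) p \<partial>lborel)"
    proof -
      have "(\<integral>\<^sup>+y. ennreal t * indicator (ball x r) y \<partial>lborel) = ennreal t * emeasure lborel (ball x r)"
        by (rule nn_integral_cmult_indicator) simp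
      moreover have "(\<integral>\<^sup>+y. ennreal (t powr (1 - p)) * epow (f y) p \<partial>lborel) = ennreal (t powr (1 - p)) * (\<integral>\<^sup>+y. epow (f y) p \<partial>lborel)"
        by (rule nn_integral_cmult) measurable
      moreover have "(\<integral>\<^sup>+y. ennreal t * indicator (ball x r) y + ennreal (t powr (1 - p)) * epow (f y) p \<partial>lborel)
        = (\<integral>\<^sup>+y. ennreal t * indicator (ball x r) y \<partial>lborel) + (\<integral>\<^sup>+y. ennreal (t powr (1 - p)) * epow (f y) p \<partial>lborel)"
        by (rule nn_integral_add) measurable
      ultimately show ?thesis by simp
    qed
    also have "ennreal t * emeasure lborel (ball x r) = ennreal (t * v * r ^ n)"
      using that v r unfolding emeasure_lborel_ball[OF less_imp_le[OF r]] v_def n_def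
      by (simp add: ennreal_mult[symmetric] mult_ac)
    finally show ?thesis .
  qed
  have "ennreal (r powr (real n / p - real n)) * I \<le> ennreal (v + 1) * eLp p f"
  proof (cases "(\<integral>\<^sup>+y. epow (f y) p \<partial>lborel)")
    case top
    then show ?thesis using v by (simp add: eLp_def ennreal_mult_top del: ennreal_plus)
  next
    case (real J)
    show ?thesis
    proof (cases "J = 0")
      case True
      \<comment> \<open>With vanishing norm only the first term remains, and \<open>t\<close> can be
        taken arbitrarily small.\<close>
      have "I \<le> 0 + ennreal e" if "0 < e" for e
        using I_le[of "e / (v * r ^ n)"] v r that real True by simp
      then have "I = 0" using ennreal_le_epsilon[of 0 I] by simp
      then show ?thesis by simp
    next
      case False
      with real have J: "0 < J" by simp
      \<comment> \<open>This \<open>t\<close> balances the two terms: they become \<open>v\<close>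
        times and once \<open>J powr (1 / p)\<close>, whence the constant
        \<open>v + 1\<close>.\<close>
      define t where "t = (J / r ^ n) powr (1 / p)"
      have t: "0 < t" unfolding t_def using J r by simp
      have a: "r powr (real n / p - real n) * (t * v * r ^ n) = v * J powr (1 / p)"
        using r J p unfolding t_def
        by (simp add: powr_divide powr_realpow[symmetric] powr_powr powr_diff)
      have b: "r powr (real n / p - real n) * (t powr (1 - p) * J) = J powr (1 / p)"
      proof -
        have "t powr (1 - p) = (J / r powr n) powr (1 / p - 1)"
          unfolding t_def powr_powr using p r by (simp add: field_simps powr_realpow)
        also have "\<dots> = J powr (1 / p - 1) / r powr (real n / p - real n)"
          using r J by (simp add: powr_divide powr_powr algebra_simps)
        finally have "r powr (real n / p - real n) * (t powr (1 - p) * J) = J powr (1 / p - 1) * J"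
          using r by simp
        also have "\<dots> = J powr (1 / p)" using J powr_add[of J "1 / p - 1" 1] by simp
        finally show ?thesis .
      qed
      have "ennreal (r powr (real n / p - real n)) * I
        \<le> ennreal (r powr (real n / p - real n)) * (ennreal (t * v * r ^ n) + ennreal (t powr (1 - p)) * ennreal J)"
        using I_le[OF t] real by (intro mult_left_mono) auto
      also have "\<dots> = ennreal (v * J powr (1 / p) + J powr (1 / p))"
      proof -
        have "ennreal (r powr (real n / p - real n)) * (ennreal (t * v * r ^ n) + ennreal (t powr (1 - p)) * ennreal J)
          = ennreal (r powr (real n / p - real n) * (t * v * r ^ n) + r powr (real n / p - real n) * (t powr (1 - p) * J))"
          using t v r J by (simp add: distrib_left ennreal_mult[symmetric] ennreal_plus[symmetric] del: ennreal_plus)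
        then show ?thesis unfolding a b .
      qed
      also have "\<dots> = ennreal (v + 1) * eLp p f"
        unfolding eLp_def real(2) using J v
        by (simp add: epow_ennreal ennreal_mult[symmetric] distrib_right del: ennreal_plus)
      finally show ?thesis .
    qed
  qed
  then show ?thesis unfolding n_def I_def .
qed

text \<open>Hedberg's inequality \<open>M\<^sub>\<alpha> f \<le> C (M f)\<^bsup>1 - \<alpha> p / n\<^esup> \<parallel>f\<parallel>\<^bsup>\<alpha> p / n\<^esup>\<close> reduces the bound to the case \<open>\<alpha> = 0\<close>.\<close>

lemma fmax_strong_type:
  fixes p q \<alpha> :: real
  assumes p: "1 < p" and \<alpha>: "0 \<le> \<alpha>" and q: "0 < q" "1 / q = 1 / p - \<alpha> / real DIM('a)"
  obtains C where "0 < C"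
    "\<And>f::'a::euclidean_space \<Rightarrow> ennreal. f \<in> borel_measurable borel \<Longrightarrow> eLp q (fmax \<alpha> f) \<le> ennreal C * eLp p f"
proof -
  define n where "n = real DIM('a)"
  define v where "v = unit_ball_vol n"
  have n: "0 < n" unfolding n_def by simp
  have v: "0 < v" unfolding v_def using n by simp
  define D where "D = p * (2 * 5 ^ DIM('a) * v) / (p - 1) * (2 * v) powr (p - 1)"
  have D: "0 < D" unfolding D_def using p v by simp
  have strong: "(\<integral>\<^sup>+x. epow (fmax 0 f x) p \<partial>lborel) \<le> ennreal D * (\<integral>\<^sup>+x. epow (f x) p \<partial>lborel)"
    if "f \<in> borel_measurable borel" for f :: "'a \<Rightarrow> ennreal"
    unfolding D_def v_def n_def using fmax_0_integral_le[OF that p] .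
  show thesis
  proof (cases "\<alpha> = 0")
    case True
    then have pq: "q = p" using q p by (simp add: field_simps)
    show thesis
    proof (rule that[of "D powr (1 / p)"])
      fix f :: "'a \<Rightarrow> ennreal" assume [measurable]: "f \<in> borel_measurable borel"
      have "eLp q (fmax \<alpha> f) \<le> epow (ennreal D * (\<integral>\<^sup>+x. epow (f x) p \<partial>lborel)) (1 / p)"
        unfolding eLp_def pq True using p by (intro epow_mono strong) auto
      also have "\<dots> = ennreal (D powr (1 / p)) * eLp p f"
        unfolding eLp_def using D by (simp add: epow_mult epow_ennreal)
      finally show "eLp q (fmax \<alpha> f) \<le> ennreal (D powr (1 / p)) * eLp p f" .
    qed (use D in simp)
  next
    case False
    \<comment> \<open>Chosen so that \<open>\<alpha> - n = (- n) * (1 - \<theta>) + (n / p - n) *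
      \<theta>\<close>: of each ball integral the power \<open>1 - \<theta>\<close> is estimated by
      \<open>fmax 0\<close>, the power \<open>\<theta>\<close> by the norm through
      \<open>ball_integral_le_eLp\<close>.\<close>
    define \<theta> where "\<theta> = \<alpha> * p / n"
    have "0 < 1 / p - \<alpha> / n" using q unfolding n_def by (metis zero_less_divide_1_iff)
    then have \<theta>: "0 < \<theta>" "\<theta> < 1"
      unfolding \<theta>_def using False \<alpha> p n by (auto simp: field_simps)
    \<comment> \<open>Hence the \<open>q\<close>-th power of Hedberg's inequality contains
      \<open>fmax 0 f\<close> exactly to the power \<open>p\<close>, to which the bound of order 0
      applies.\<close>
    have q1: "(1 - \<theta>) * q = p"
    proof -
      have "1 / q = (1 - \<theta>) / p" using q(2) p n unfolding \<theta>_def n_def[symmetric] by (simp add: field_simps)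
      then show ?thesis using q(1) p by (simp add: field_simps)
    qed
    have q2: "p + \<theta> * q = q" using q1 by (simp add: algebra_simps)
    define E where "E = (v + 1) powr \<theta>"
    have E: "0 < E" unfolding E_def using v by simp
    have hedberg: "fmax \<alpha> f x \<le> ennreal E * (epow (fmax 0 f x) (1 - \<theta>) * epow (eLp p f) \<theta>)"
      if [measurable]: "f \<in> borel_measurable borel" for f :: "'a \<Rightarrow> ennreal" and x
      unfolding fmax_def[of \<alpha>]
    proof (rule SUP_least)
      fix r :: real assume "r \<in> {0<..}" then have r: "0 < r" by simp
      define I where "I = (\<integral>\<^sup>+y. f y * indicator (ball x r) y \<partial>lborel)"
      have "(- n) * (1 - \<theta>) + (n / p - n) * \<theta> = \<alpha> - n"
        unfolding \<theta>_def using n p by (simp add: field_simps)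
      then have "r powr (\<alpha> - n) = (r powr (- n)) powr (1 - \<theta>) * (r powr (n / p - n)) powr \<theta>"
        by (simp add: powr_powr powr_add[symmetric])
      then have "ennreal (r powr (\<alpha> - n)) * I
          = ennreal ((r powr (- n)) powr (1 - \<theta>) * (r powr (n / p - n)) powr \<theta>) * (epow I (1 - \<theta>) * epow I \<theta>)"
        by (simp add: epow_add[symmetric])
      also have "\<dots> = epow (ennreal (r powr (- n)) * I) (1 - \<theta>) * epow (ennreal (r powr (n / p - n)) * I) \<theta>"
        by (simp add: epow_mult epow_ennreal ennreal_mult mult_ac)
      also have "\<dots> \<le> epow (fmax 0 f x) (1 - \<theta>) * epow (ennreal (v + 1) * eLp p f) \<theta>"
      proof (rule mult_mono)
        have "ennreal (r powr (- n)) * I \<le> fmax 0 f x"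
          using fmax_upper[OF r, of 0 f x] unfolding I_def n_def by simp
        then show "epow (ennreal (r powr (- n)) * I) (1 - \<theta>) \<le> epow (fmax 0 f x) (1 - \<theta>)"
          using \<theta> by (intro epow_mono) auto
        have "ennreal (r powr (n / p - n)) * I \<le> ennreal (v + 1) * eLp p f"
          unfolding I_def n_def v_def by (rule ball_integral_le_eLp[OF that p r])
        then show "epow (ennreal (r powr (n / p - n)) * I) \<theta> \<le> epow (ennreal (v + 1) * eLp p f) \<theta>"
          using \<theta> by (intro epow_mono) auto
      qed auto
      also have "\<dots> = ennreal E * (epow (fmax 0 f x) (1 - \<theta>) * epow (eLp p f) \<theta>)"
        unfolding E_def using v by (simp add: epow_mult epow_ennreal mult_ac del: ennreal_plus)
      finally show "ennreal (r powr (\<alpha> - real DIM('a))) * (\<integral>\<^sup>+y. f y * indicator (ball x r) y \<partial>lborel) \<le> \<dots>"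
        unfolding I_def n_def .
    qed
    show thesis
    proof (rule that[of "E * D powr (1 / q)"])
      fix f :: "'a \<Rightarrow> ennreal" assume [measurable]: "f \<in> borel_measurable borel"
      have "(\<integral>\<^sup>+x. epow (fmax \<alpha> f x) q \<partial>lborel)
          \<le> (\<integral>\<^sup>+x. epow (ennreal E * (epow (fmax 0 f x) (1 - \<theta>) * epow (eLp p f) \<theta>)) q \<partial>lborel)"
        using q by (intro nn_integral_mono epow_mono hedberg) auto
      also have "\<dots> = (\<integral>\<^sup>+x. ennreal (E powr q) * epow (eLp p f) (\<theta> * q) * epow (fmax 0 f x) p \<partial>lborel)"
        using E by (intro nn_integral_cong) (simp add: epow_mult epow_epow q1 q1[unfolded mult.commute[of _ q]] epow_ennreal mult_ac)
      also have "\<dots> = ennreal (E powr q) * epow (eLp p f) (\<theta> * q) * (\<integral>\<^sup>+x. epow (fmax 0 f x) p \<partial>lborel)"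
        by (rule nn_integral_cmult) measurable
      also have "\<dots> \<le> ennreal (E powr q) * epow (eLp p f) (\<theta> * q) * (ennreal D * (\<integral>\<^sup>+x. epow (f x) p \<partial>lborel))"
        by (intro mult_left_mono strong) auto
      also have "(\<integral>\<^sup>+x. epow (f x) p \<partial>lborel) = epow (eLp p f) p"
        unfolding eLp_def epow_epow using p by simp
      also have "ennreal (E powr q) * epow (eLp p f) (\<theta> * q) * (ennreal D * epow (eLp p f) p)
          = ennreal (E powr q) * ennreal D * epow (eLp p f) (p + \<theta> * q)"
        by (simp add: epow_add mult_ac)
      also have "\<dots> = ennreal (E powr q) * ennreal D * epow (eLp p f) q" by (simp only: q2)
      finally have "eLp q (fmax \<alpha> f) \<le> epow (ennreal (E powr q) * ennreal D * epow (eLp p f) q) (1 / q)"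
        unfolding eLp_def[of q] using q(1) by (intro epow_mono) auto
      also have "\<dots> = ennreal (E * D powr (1 / q)) * eLp p f"
      proof -
        have "epow (ennreal (E powr q)) (1 / q) = ennreal E" "epow (epow (eLp p f) q) (1 / q) = eLp p f"
          using E q(1) by (simp_all add: epow_ennreal powr_powr epow_epow)
        moreover have "epow (ennreal D) (1 / q) = ennreal (D powr (1 / q))"
          using D by (simp add: epow_ennreal)
        moreover have "ennreal (E * D powr (1 / q)) = ennreal E * ennreal (D powr (1 / q))"
          using E by (intro ennreal_mult) auto
        ultimately show ?thesis by (simp only: epow_mult)
      qed
      finally show "eLp q (fmax \<alpha> f) \<le> ennreal (E * D powr (1 / q)) * eLp p f" .
    qed (use E D in simp)
  qed
qed

section \<open>Convolution\<close>

lemma lborel_translate: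
  fixes f :: "'a::euclidean_space \<Rightarrow> ennreal"
  assumes [measurable]: "f \<in> borel_measurable borel"
  shows "(\<integral>\<^sup>+x. f (a + x) \<partial>lborel) = (\<integral>\<^sup>+x. f x \<partial>lborel)"
  using nn_integral_distr[of "(+) a" lborel borel f] by (simp add: lborel_distr_plus)

definition transl_dist :: "('a::euclidean_space \<Rightarrow> 'b::{banach, second_countable_topology}) \<Rightarrow> 'a \<Rightarrow> ennreal" where
  "transl_dist f z = (\<integral>\<^sup>+x. ennreal (norm (f (z + x) - f x)) \<partial>lborel)"

text \<open>The error \<open>f - g\<close> occurs once translated and once in place; translation
  invariance makes the two contributions equal.\<close>

lemma transl_dist_le:
  assumes [measurable]: "f \<in> borel_measurable borel" "g \<in> borel_measurable borel"
  shows "transl_dist f z \<le> transl_dist g z + 2 * (\<integral>\<^sup>+x. ennreal (norm (f x - g x)) \<partial>lborel)"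
proof -
  have "transl_dist f z \<le> (\<integral>\<^sup>+x. ennreal (norm (f (z + x) - g (z + x))) + (ennreal (norm (g (z + x) - g x)) + ennreal (norm (f x - g x))) \<partial>lborel)"
    unfolding transl_dist_def
  proof (rule nn_integral_mono)
    fix x
    have "norm (f (z + x) - f x) \<le> norm (f (z + x) - g (z + x)) + (norm (g (z + x) - g x) + norm (f x - g x))"
      by norm
    then show "ennreal (norm (f (z + x) - f x)) \<le> ennreal (norm (f (z + x) - g (z + x))) + (ennreal (norm (g (z + x) - g x)) + ennreal (norm (f x - g x)))"
      by (simp add: ennreal_plus[symmetric] ennreal_leI del: ennreal_plus)
  qed
  also have "\<dots> = (\<integral>\<^sup>+x. ennreal (norm (f (z + x) - g (z + x))) \<partial>lborel) + (transl_dist g z + (\<integral>\<^sup>+x. ennreal (norm (f x - g x)) \<partial>lborel))"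
    unfolding transl_dist_def by (simp add: nn_integral_add)
  also have "(\<integral>\<^sup>+x. ennreal (norm (f (z + x) - g (z + x))) \<partial>lborel) = (\<integral>\<^sup>+x. ennreal (norm (f x - g x)) \<partial>lborel)"
    by (rule lborel_translate[of "\<lambda>x. ennreal (norm (f x - g x))"]) measurable
  finally show ?thesis by (simp add: mult_2 add_ac)
qed

lemma transl_dist_add:
  assumes [measurable]: "f \<in> borel_measurable borel" "g \<in> borel_measurable borel"
  shows "transl_dist (\<lambda>x. f x + g x) z \<le> transl_dist f z + transl_dist g z"
proof -
  have "transl_dist (\<lambda>x. f x + g x) z \<le> (\<integral>\<^sup>+x. ennreal (norm (f (z + x) - f x)) + ennreal (norm (g (z + x) - g x)) \<partial>lborel)"
    unfolding transl_dist_def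
  proof (rule nn_integral_mono)
    fix x
    have "norm (f (z + x) + g (z + x) - (f x + g x)) \<le> norm (f (z + x) - f x) + norm (g (z + x) - g x)"
      by norm
    then show "ennreal (norm (f (z + x) + g (z + x) - (f x + g x))) \<le> ennreal (norm (f (z + x) - f x)) + ennreal (norm (g (z + x) - g x))"
      by (simp add: ennreal_plus[symmetric] ennreal_leI del: ennreal_plus)
  qed
  also have "\<dots> = transl_dist f z + transl_dist g z"
    unfolding transl_dist_def by (simp add: nn_integral_add)
  finally show ?thesis .
qed

text \<open>Openness gives \<open>indicator U x \<le> liminf indicator U (x + z\<^sub>k)\<close>, so only the set that is lost has to be estimated.\<close>

lemma transl_dist_indicator_open:
  fixes U :: "'a::euclidean_space set" and c :: "'b::{banach, second_countable_topology}"
  assumes U: "open U" "emeasure lborel U < \<infinity>" and z: "z \<longlonglongrightarrow> 0"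
  shows "(\<lambda>k. transl_dist (\<lambda>x. indicator U x *\<^sub>R c) (z k)) \<longlonglongrightarrow> 0"
proof -
  define lost where "lost w = (\<integral>\<^sup>+x. ennreal (indicator U x * (1 - indicator U (w + x))) \<partial>lborel)" for w
  have [measurable]: "U \<in> sets borel" using U by simp
  have lost0: "(\<lambda>k. lost (w k)) \<longlonglongrightarrow> 0" if w: "w \<longlonglongrightarrow> 0" for w
  proof -
    have "(\<lambda>k. lost (w k)) \<longlonglongrightarrow> (\<integral>\<^sup>+x. 0 \<partial>(lborel :: 'a measure))"
      unfolding lost_def
    proof (rule nn_integral_dominated_convergence[where w="\<lambda>x. indicator U x"])
      show "(\<integral>\<^sup>+x. indicator U x \<partial>lborel) < \<infinity>" using U by simp
      show "AE x in lborel. (\<lambda>i. ennreal (indicator U x * (1 - indicator U (w i + x)))) \<longlonglongrightarrow> 0"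
      proof (rule AE_I2)
        fix x
        show "(\<lambda>i. ennreal (indicator U x * (1 - indicator U (w i + x)))) \<longlonglongrightarrow> 0"
        proof (cases "x \<in> U")
          case True
          have "(\<lambda>i. w i + x) \<longlonglongrightarrow> x" using tendsto_add[OF w tendsto_const[of x]] by simp
          then have "eventually (\<lambda>i. w i + x \<in> U) sequentially"
            using U(1) True by (rule topological_tendstoD)
          then have "eventually (\<lambda>i. ennreal (indicator U x * (1 - indicator U (w i + x))) = 0) sequentially"
            by eventually_elim simp
          then show ?thesis by (rule tendsto_eventually)
        qed simp
      qed
    qed (auto split: split_indicator)
    then show ?thesis by simp
  qed
  have eq: "transl_dist (\<lambda>x. indicator U x *\<^sub>R c) w = ennreal (norm c) * (lost w + lost (- w))" for w
  proof -
    have "transl_dist (\<lambda>x. indicator U x *\<^sub>R c) w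
      = (\<integral>\<^sup>+x. ennreal (norm c) * (ennreal (indicator U x * (1 - indicator U (w + x))) + ennreal (indicator U (w + x) * (1 - indicator U (- w + (w + x))))) \<partial>lborel)"
      unfolding transl_dist_def by (intro nn_integral_cong) (auto split: split_indicator)
    also have "\<dots> = ennreal (norm c) * (lost w + (\<integral>\<^sup>+x. ennreal (indicator U (w + x) * (1 - indicator U (- w + (w + x)))) \<partial>lborel))"
      unfolding lost_def by (subst nn_integral_cmult, measurable, subst nn_integral_add, measurable)
    also have "(\<integral>\<^sup>+x. ennreal (indicator U (w + x) * (1 - indicator U (- w + (w + x)))) \<partial>lborel) = lost (- w)"
      unfolding lost_def
      by (rule lborel_translate[of "\<lambda>x. ennreal (indicator U x * (1 - indicator U (- w + x)))"]) measurable
    finally show ?thesis .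
  qed
  have "(\<lambda>k. ennreal (norm c) * (lost (z k) + lost (- z k))) \<longlonglongrightarrow> ennreal (norm c) * (0 + 0)"
    using z by (intro ennreal_tendsto_cmult tendsto_add lost0) (auto intro: tendsto_minus_cancel)
  then show ?thesis unfolding eq by simp
qed

text \<open>Induction over integrable functions: sums and limits are handled by the stability of
  \<open>transl_dist\<close>, and the indicator of a Borel set is first replaced by that of an open
  set of slightly larger measure.\<close>

lemma L1_translation_continuous:
  fixes f :: "'a::euclidean_space \<Rightarrow> 'b::{banach, second_countable_topology}"
  assumes "integrable lborel f" and "0 < e"
  shows "eventually (\<lambda>z. transl_dist f z \<le> ennreal e) (nhds 0)"
  using assms
proof (induction arbitrary: e rule: integrable_induct)
  case (base A c)
  show ?case
  proof (rule sequentially_imp_eventually_nhds_within[of UNIV 0, simplified], intro allI impI)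
    fix z :: "nat \<Rightarrow> 'a" assume z: "z \<longlonglongrightarrow> 0"
    \<comment> \<open>The measure of \<open>U - A\<close> enters twice and is multiplied by
      \<open>norm c\<close>; this \<open>d\<close> keeps its share below \<open>e / 2\<close>, and
      the summand 1 covers \<open>c = 0\<close>.\<close>
    define d where "d = e / (4 * (norm c + 1))"
    have pos: "0 < 4 * (norm c + 1)" by (simp add: add_nonneg_pos)
    have d: "0 < d" unfolding d_def using base.prems pos by (intro divide_pos_pos)
    have "d * (4 * (norm c + 1)) = e" unfolding d_def using pos by simp
    then have d2: "2 * (norm c * d) \<le> e / 2" using d by (simp add: algebra_simps)
    have A [measurable]: "A \<in> sets borel" using base by simp
    obtain U where U: "open U" "A \<subseteq> U" "emeasure lborel (U - A) < d"
      using outer_regular_lborel[OF A d] by blast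
    have [measurable]: "U \<in> sets borel" using U by simp
    have "emeasure lborel U \<le> emeasure lborel (A \<union> (U - A))" by (rule emeasure_mono) auto
    also have "\<dots> \<le> emeasure lborel A + emeasure lborel (U - A)" by (rule emeasure_subadditive) auto
    also have "\<dots> < \<infinity>" using base(2) U(3) by (simp add: ennreal_add_eq_top less_top[symmetric]) (metis infinity_ennreal_def ennreal_less_top less_trans top.not_eq_extremum)
    finally have fin: "emeasure lborel U < \<infinity>" .
    have "(\<integral>\<^sup>+x. ennreal (norm (indicator A x *\<^sub>R c - indicator U x *\<^sub>R c)) \<partial>lborel)
        = (\<integral>\<^sup>+x. ennreal (norm c) * indicator (U - A) x \<partial>lborel)"
      using U(2) by (intro nn_integral_cong) (auto split: split_indicator)
    also have "\<dots> = ennreal (norm c) * emeasure lborel (U - A)" by (rule nn_integral_cmult_indicator) measurable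
    also have "\<dots> \<le> ennreal (norm c) * ennreal d" using U(3) by (intro mult_left_mono) auto
    finally have "2 * (\<integral>\<^sup>+x. ennreal (norm (indicator A x *\<^sub>R c - indicator U x *\<^sub>R c)) \<partial>lborel) \<le> ennreal 2 * (ennreal (norm c) * ennreal d)"
      by (simp add: mult_left_mono)
    also have "\<dots> = ennreal (2 * (norm c * d))" using d by (simp add: ennreal_mult)
    also have "\<dots> \<le> ennreal (e / 2)" by (rule ennreal_leI) (rule d2)
    finally have AU: "2 * (\<integral>\<^sup>+x. ennreal (norm (indicator A x *\<^sub>R c - indicator U x *\<^sub>R c)) \<partial>lborel) \<le> ennreal (e / 2)" .
    have "eventually (\<lambda>k. transl_dist (\<lambda>x. indicator U x *\<^sub>R c) (z k) < ennreal (e / 2)) sequentially"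
      using transl_dist_indicator_open[OF U(1) fin z, of c] by (rule order_tendstoD) (use base.prems in simp)
    then show "eventually (\<lambda>k. transl_dist (\<lambda>x. indicator A x *\<^sub>R c) (z k) \<le> ennreal e) sequentially"
    proof eventually_elim
      case (elim k)
      have "transl_dist (\<lambda>x. indicator A x *\<^sub>R c) (z k) \<le> ennreal (e / 2) + ennreal (e / 2)"
        using transl_dist_le[of "\<lambda>x. indicator A x *\<^sub>R c" "\<lambda>x. indicator U x *\<^sub>R c" "z k"] elim AU
        by (simp add: add_mono less_imp_le order_trans[OF _ add_mono])
      also have "\<dots> = ennreal e" using base.prems by (simp add: ennreal_plus[symmetric] del: ennreal_plus)
      finally show ?case .
    qed
  qed
next
  case (add f g)
  have [measurable]: "f \<in> borel_measurable borel" "g \<in> borel_measurable borel" using add by auto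
  from add.IH(1)[of "e / 2"] add.IH(2)[of "e / 2"] add.prems
  have "eventually (\<lambda>z. transl_dist f z \<le> ennreal (e / 2)) (nhds 0)" "eventually (\<lambda>z. transl_dist g z \<le> ennreal (e / 2)) (nhds 0)"
    by auto
  then show ?case
  proof eventually_elim
    case (elim z)
    have "transl_dist (\<lambda>x. f x + g x) z \<le> ennreal (e / 2) + ennreal (e / 2)"
      using transl_dist_add[of f g z] elim by (simp add: order_trans[OF _ add_mono])
    also have "\<dots> = ennreal e" using add.prems by (simp add: ennreal_plus[symmetric] del: ennreal_plus)
    finally show ?case .
  qed
next
  case (lim f s)
  have [measurable]: "f \<in> borel_measurable borel" "\<And>i. s i \<in> borel_measurable borel" using lim by auto
  have "(\<lambda>i. (\<integral>\<^sup>+x. ennreal (norm (f x - s i x)) \<partial>lborel)) \<longlonglongrightarrow> 0"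
  proof (rule nn_integral_dominated_convergence_norm[where w="\<lambda>x. 2 * norm (f x)"])
    show "(\<integral>\<^sup>+x. ennreal (2 * norm (f x)) \<partial>lborel) < \<infinity>"
      using lim.hyps(4) unfolding integrable_iff_bounded
      by (simp add: ennreal_mult nn_integral_cmult ennreal_mult_less_top)
  qed (use lim in auto)
  then have "eventually (\<lambda>i. (\<integral>\<^sup>+x. ennreal (norm (f x - s i x)) \<partial>lborel) < ennreal (e / 4)) sequentially"
    by (rule order_tendstoD) (use lim.prems in simp)
  then obtain i where i: "(\<integral>\<^sup>+x. ennreal (norm (f x - s i x)) \<partial>lborel) < ennreal (e / 4)"
    by (auto simp: eventually_sequentially)
  have "2 * (\<integral>\<^sup>+x. ennreal (norm (f x - s i x)) \<partial>lborel) \<le> ennreal 2 * ennreal (e / 4)"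
    using i by (simp add: mult_left_mono)
  also have "\<dots> = ennreal (e / 2)" using lim.prems by (subst ennreal_mult[symmetric]) auto
  finally have i2: "2 * (\<integral>\<^sup>+x. ennreal (norm (f x - s i x)) \<partial>lborel) \<le> ennreal (e / 2)" .
  have "eventually (\<lambda>z. transl_dist (s i) z \<le> ennreal (e / 2)) (nhds 0)"
    using lim.IH[of "e / 2" i] lim.prems by simp
  then show ?case
  proof eventually_elim
    case (elim z)
    have "transl_dist f z \<le> ennreal (e / 2) + ennreal (e / 2)"
      using transl_dist_le[of f "s i" z] elim i2 by (simp add: order_trans[OF _ add_mono])
    also have "\<dots> = ennreal e" using lim.prems by (simp add: ennreal_plus[symmetric] del: ennreal_plus)
    finally show ?case .
  qed
qed

lemma norm_integral_le_integral:
  fixes f :: "'a \<Rightarrow> 'b::{banach, second_countable_topology}"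
  assumes "integrable M f" "integrable M g" "\<And>x. norm (f x) \<le> g x"
  shows "norm (\<integral>x. f x \<partial>M) \<le> (\<integral>x. g x \<partial>M)"
  by (rule order_trans[OF integral_norm_bound integral_mono]) (use assms in auto)

definition conv :: "('a::euclidean_space \<Rightarrow> real) \<Rightarrow> ('a \<Rightarrow> 'b::{banach, second_countable_topology}) \<Rightarrow> 'a \<Rightarrow> 'b" where
  "conv k f x = (\<integral>y. k (x - y) *\<^sub>R f y \<partial>lborel)"

lemma conv_integrable:
  fixes k :: "'a::euclidean_space \<Rightarrow> real" and f :: "'a \<Rightarrow> 'b::{banach, second_countable_topology}"
  assumes f: "integrable lborel f" and [measurable]: "k \<in> borel_measurable borel" and B: "\<And>x. \<bar>k x\<bar> \<le> B"
  shows "integrable lborel (\<lambda>y. k (x - y) *\<^sub>R f y)"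
proof (rule Bochner_Integration.integrable_bound)
  show "integrable lborel (\<lambda>y. B *\<^sub>R f y)" using f by simp
  have [measurable]: "f \<in> borel_measurable borel" using f by auto
  show "(\<lambda>y. k (x - y) *\<^sub>R f y) \<in> borel_measurable lborel" by measurable
  show "AE y in lborel. norm (k (x - y) *\<^sub>R f y) \<le> norm (B *\<^sub>R f y)"
    using B by (intro AE_I2) (auto intro!: mult_right_mono intro: order_trans[OF _ abs_ge_self])
qed

lemma conv_uniform_limit_aux:
  fixes k :: "'a::euclidean_space \<Rightarrow> real" and f :: "'a \<Rightarrow> 'b::{banach, second_countable_topology}"
  assumes f: "integrable lborel f" and [measurable]: "k \<in> borel_measurable borel" and B: "\<And>x. \<bar>k x\<bar> \<le> B"
    and d: "\<And>y. \<bar>k (x - y) - k (x' - y)\<bar> \<le> e"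
  shows "norm (conv k f x - conv k f x') \<le> e * (\<integral>y. norm (f y) \<partial>lborel)"
proof -
  have "conv k f x - conv k f x' = (\<integral>y. k (x - y) *\<^sub>R f y - k (x' - y) *\<^sub>R f y \<partial>lborel)"
    unfolding conv_def by (intro Bochner_Integration.integral_diff[symmetric] conv_integrable[OF f _ B]) measurable
  also have "norm \<dots> \<le> (\<integral>y. e * norm (f y) \<partial>lborel)"
  proof (rule norm_integral_le_integral)
    show "integrable lborel (\<lambda>y. k (x - y) *\<^sub>R f y - k (x' - y) *\<^sub>R f y)"
      by (intro Bochner_Integration.integrable_diff conv_integrable[OF f _ B]) measurable
    show "integrable lborel (\<lambda>y. e * norm (f y))" using f by simp
    fix y
    show "norm (k (x - y) *\<^sub>R f y - k (x' - y) *\<^sub>R f y) \<le> e * norm (f y)"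
      using d[of y] by (simp add: scaleR_left_diff_distrib[symmetric] mult_right_mono)
  qed
  finally show ?thesis by simp
qed

lemma conv_continuous:
  fixes k :: "'a::euclidean_space \<Rightarrow> real" and f :: "'a \<Rightarrow> 'b::{banach, second_countable_topology}"
  assumes f: "integrable lborel f" and B: "\<And>x. \<bar>k x\<bar> \<le> B" and k: "uniformly_continuous_on UNIV k"
  shows "continuous_on UNIV (conv k f)"
proof -
  have [measurable]: "k \<in> borel_measurable borel"
    using k uniformly_continuous_imp_continuous borel_measurable_continuous_onI by blast
  define I where "I = (\<integral>y. norm (f y) \<partial>lborel)"
  have I: "0 \<le> I" unfolding I_def by simp
  show ?thesis
  proof (unfold continuous_on_iff, intro ballI allI impI)
    fix x :: 'a and e :: real assume e: "0 < e"
    have "0 < e / (I + 1)" using e I by simp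
    then obtain d where d: "0 < d" "\<And>x x'. dist x' x < d \<Longrightarrow> dist (k x') (k x) < e / (I + 1)"
      using k unfolding uniformly_continuous_on_def by (metis UNIV_I)
    show "\<exists>d>0. \<forall>x'\<in>UNIV. dist x' x < d \<longrightarrow> dist (conv k f x') (conv k f x) < e"
    proof (intro exI[of _ d] conjI ballI impI d(1))
      fix x' assume "dist x' x < d"
      then have "\<bar>k (x' - y) - k (x - y)\<bar> \<le> e / (I + 1)" for y
        using d(2)[of "x' - y" "x - y"] by (simp add: dist_norm real_norm_def less_imp_le)
      then have "norm (conv k f x' - conv k f x) \<le> e / (I + 1) * I"
        unfolding I_def by (intro conv_uniform_limit_aux[OF f _ B]) auto
      also have "\<dots> < e" using e I by (simp add: field_simps)
      finally show "dist (conv k f x') (conv k f x) < e" by (simp add: dist_norm)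
    qed
  qed
qed

text \<open>Uniform continuity of the gradient makes the linearisation error of \<open>k\<close>
  small uniformly in the point, so that the error can be integrated against
  \<open>f\<close>.\<close>

lemma conv_has_derivative:
  fixes k :: "'a::euclidean_space \<Rightarrow> real" and f :: "'a \<Rightarrow> real"
  assumes f: "integrable lborel f" and B: "\<And>x. \<bar>k x\<bar> \<le> B"
    and k: "\<And>x. (k has_derivative (\<lambda>h. dk x \<bullet> h)) (at x)"
    and dB: "\<And>x. norm (dk x) \<le> B'" and dk: "uniformly_continuous_on UNIV dk"
  shows "(conv k f has_derivative (\<lambda>h. (\<integral>y. f y *\<^sub>R dk (x - y) \<partial>lborel) \<bullet> h)) (at x)"
proof -
  have [measurable]: "f \<in> borel_measurable borel" using f by auto
  have [measurable]: "dk \<in> borel_measurable borel"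
    using dk uniformly_continuous_imp_continuous borel_measurable_continuous_onI by blast
  have "continuous_on UNIV k"
    using k by (intro has_derivative_continuous_on) (auto intro: has_derivative_at_withinI)
  then have [measurable]: "k \<in> borel_measurable borel" by (rule borel_measurable_continuous_onI)
  define I where "I = (\<integral>y. norm (f y) \<partial>lborel)"
  have I: "0 \<le> I" unfolding I_def by simp
  have int_dk: "integrable lborel (\<lambda>y. f y *\<^sub>R dk (x - y))"
  proof (rule Bochner_Integration.integrable_bound)
    show "integrable lborel (\<lambda>y. B' *\<^sub>R f y)" using f by simp
    show "AE y in lborel. norm (f y *\<^sub>R dk (x - y)) \<le> norm (B' *\<^sub>R f y)"
    proof (intro AE_I2)
      fix y have "norm (dk (x - y)) \<le> \<bar>B'\<bar>" using dB[of "x - y"] by simp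
      then show "norm (f y *\<^sub>R dk (x - y)) \<le> norm (B' *\<^sub>R f y)"
        by (simp add: abs_mult mult.commute[of "\<bar>B'\<bar>"] mult_left_mono)
    qed
  qed measurable
  show ?thesis
    unfolding has_derivative_at_alt
  proof (intro conjI allI impI)
    show "bounded_linear (\<lambda>h. (\<integral>y. f y *\<^sub>R dk (x - y) \<partial>lborel) \<bullet> h)"
      by (rule bounded_linear_inner_right)
    fix e :: real assume e: "0 < e"
    \<comment> \<open>The tolerance anticipates the factor \<open>I\<close> from the integration;
      adding 1 covers \<open>I = 0\<close>.\<close>
    have "0 < e / (I + 1)" using e I by simp
    then obtain d where d: "0 < d" "\<And>x x'. dist x' x < d \<Longrightarrow> dist (dk x') (dk x) < e / (I + 1)"
      using dk unfolding uniformly_continuous_on_def by (metis UNIV_I)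
    show "\<exists>d>0. \<forall>x'. norm (x' - x) < d \<longrightarrow>
       norm (conv k f x' - conv k f x - (\<integral>y. f y *\<^sub>R dk (x - y) \<partial>lborel) \<bullet> (x' - x)) \<le> e * norm (x' - x)"
    proof (intro exI[of _ d] conjI allI impI d(1))
      fix x' assume x': "norm (x' - x) < d"
      have rem: "\<bar>k (x' - y) - k (x - y) - dk (x - y) \<bullet> (x' - x)\<bar> \<le> e / (I + 1) * norm (x' - x)" for y
      proof -
        have "norm (k (x' - y) - k (x - y) - dk (x - y) \<bullet> ((x' - y) - (x - y))) \<le> norm ((x' - y) - (x - y)) * (e / (I + 1))"
        proof (rule differentiable_bound_linearization[where f'="\<lambda>w h. dk w \<bullet> h" and S="ball (x - y) d"])
          fix t :: real assume t: "t \<in> {0..1}"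
          have "norm (t *\<^sub>R (x' - x)) \<le> 1 * norm (x' - x)" using t by (simp add: mult_left_le_one_le)
          then show "x - y + t *\<^sub>R (x' - y - (x - y)) \<in> ball (x - y) d"
            using x' by (simp add: dist_norm)
        next
          fix w assume "w \<in> ball (x - y) d"
          then have "norm (dk w - dk (x - y)) \<le> e / (I + 1)"
            using d(2)[of w "x - y"] by (simp add: dist_norm norm_minus_commute less_imp_le)
          moreover have "onorm (\<lambda>h. dk w \<bullet> h - dk (x - y) \<bullet> h) \<le> norm (dk w - dk (x - y))"
            by (rule onorm_le) (metis inner_diff_left Cauchy_Schwarz_ineq2 real_norm_def)
          ultimately show "onorm ((\<lambda>h. dk w \<bullet> h) - (\<lambda>h. dk (x - y) \<bullet> h)) \<le> e / (I + 1)"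
            unfolding fun_diff_def by linarith
        qed (use k d(1) in \<open>auto intro: has_derivative_at_withinI\<close>)
        then show ?thesis by (simp add: mult.commute)
      qed
      have "conv k f x' - conv k f x - (\<integral>y. f y *\<^sub>R dk (x - y) \<partial>lborel) \<bullet> (x' - x)
          = (\<integral>y. (k (x' - y) - k (x - y) - dk (x - y) \<bullet> (x' - x)) * f y \<partial>lborel)"
      proof -
        have i1: "integrable lborel (\<lambda>y. k (x' - y) *\<^sub>R f y)" and i2: "integrable lborel (\<lambda>y. k (x - y) *\<^sub>R f y)"
          by (intro conv_integrable[OF f _ B]; measurable)+
        have i3: "integrable lborel (\<lambda>y. (f y *\<^sub>R dk (x - y)) \<bullet> (x' - x))" by (intro integrable_inner_left int_dk)
        have "(\<integral>y. f y *\<^sub>R dk (x - y) \<partial>lborel) \<bullet> (x' - x) = (\<integral>y. (f y *\<^sub>R dk (x - y)) \<bullet> (x' - x) \<partial>lborel)"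
          by (rule integral_inner_left[symmetric]) (rule int_dk)
        then have "conv k f x' - conv k f x - (\<integral>y. f y *\<^sub>R dk (x - y) \<partial>lborel) \<bullet> (x' - x)
          = (\<integral>y. k (x' - y) *\<^sub>R f y - k (x - y) *\<^sub>R f y - (f y *\<^sub>R dk (x - y)) \<bullet> (x' - x) \<partial>lborel)"
          unfolding conv_def using i1 i2 i3 by (simp only: Bochner_Integration.integral_diff Bochner_Integration.integrable_diff)
        also have "\<dots> = (\<integral>y. (k (x' - y) - k (x - y) - dk (x - y) \<bullet> (x' - x)) * f y \<partial>lborel)"
          by (intro Bochner_Integration.integral_cong) (auto simp: algebra_simps)
        finally show ?thesis .
      qed
      also have "norm \<dots> \<le> (\<integral>y. e / (I + 1) * norm (x' - x) * norm (f y) \<partial>lborel)"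
      proof (rule norm_integral_le_integral)
        have *: "norm ((k (x' - y) - k (x - y) - dk (x - y) \<bullet> (x' - x)) * f y) \<le> e / (I + 1) * norm (x' - x) * norm (f y)" for y
          using mult_right_mono[OF rem[of y] norm_ge_zero[of "f y"]] by (simp add: abs_mult)
        then show "norm ((k (x' - y) - k (x - y) - dk (x - y) \<bullet> (x' - x)) * f y) \<le> e / (I + 1) * norm (x' - x) * norm (f y)" for y .
        show i: "integrable lborel (\<lambda>y. e / (I + 1) * norm (x' - x) * norm (f y))" using f by simp
        show "integrable lborel (\<lambda>y. (k (x' - y) - k (x - y) - dk (x - y) \<bullet> (x' - x)) * f y)"
        proof (rule Bochner_Integration.integrable_bound[OF i])
          show "AE y in lborel. norm ((k (x' - y) - k (x - y) - dk (x - y) \<bullet> (x' - x)) * f y) \<le> norm (e / (I + 1) * norm (x' - x) * norm (f y))"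
            using * by (intro AE_I2) (metis abs_ge_self order_trans real_norm_def)
        qed measurable
      qed
      also have "\<dots> = e / (I + 1) * norm (x' - x) * I" unfolding I_def by simp
      also have "\<dots> \<le> e * norm (x' - x)"
        using e I by (simp add: field_simps mult_left_mono)
      finally show "norm (conv k f x' - conv k f x - (\<integral>y. f y *\<^sub>R dk (x - y) \<partial>lborel) \<bullet> (x' - x)) \<le> e * norm (x' - x)" .
    qed
  qed
qed

lemma lborel_reflect: "distr lborel borel (\<lambda>y. x - y) = (lborel :: 'a::euclidean_space measure)"
  by (subst (2) lborel_affine[of "-1" x]) (auto simp: density_1)

lemma lborel_integral_reflect:
  fixes f :: "'a::euclidean_space \<Rightarrow> 'b::{banach, second_countable_topology}"
  assumes [measurable]: "f \<in> borel_measurable borel"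
  shows "(\<integral>y. f (x - y) \<partial>lborel) = (\<integral>y. f y \<partial>lborel)"
  using integral_distr[of "\<lambda>y. x - y" lborel borel f] by (simp add: lborel_reflect)

text \<open>Since \<open>k\<close> is a probability density, \<open>conv k f x - f x\<close> is an
  average of the differences \<open>f (x - z) - f x\<close> over the support of \<open>k\<close>;
  Tonelli's theorem replaces the norm of the average by the average of the norms.\<close>

lemma conv_L1_bound:
  fixes k :: "'a::euclidean_space \<Rightarrow> real" and f :: "'a \<Rightarrow> 'b::{banach, second_countable_topology}"
  assumes f: "integrable lborel f" and k: "integrable lborel k" "\<And>x. 0 \<le> k x" "(\<integral>x. k x \<partial>lborel) = 1"
    and B: "\<And>x. \<bar>k x\<bar> \<le> B" and e: "\<And>z. k z \<noteq> 0 \<Longrightarrow> transl_dist f (- z) \<le> e"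
  shows "(\<integral>\<^sup>+x. ennreal (norm (conv k f x - f x)) \<partial>lborel) \<le> e"
proof -
  have [measurable]: "f \<in> borel_measurable borel" "k \<in> borel_measurable borel" using f k by auto
  have "norm (conv k f x - f x) \<le> (\<integral>\<^sup>+z. ennreal (k z) * ennreal (norm (f (- z + x) - f x)) \<partial>lborel)" for x
  proof -
    have i1: "integrable lborel (\<lambda>z. k z *\<^sub>R f (x - z))"
    proof -
      have "integrable lborel (\<lambda>y. k (x - y) *\<^sub>R f y)" by (intro conv_integrable[OF f _ B]) measurable
      then show ?thesis
        using integrable_distr_eq[of "\<lambda>y. x - y" lborel borel "\<lambda>y. k (x - y) *\<^sub>R f y"]
        by (simp add: lborel_reflect)
    qed
    have "conv k f x = (\<integral>z. k z *\<^sub>R f (x - z) \<partial>lborel)"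
      unfolding conv_def using lborel_integral_reflect[of "\<lambda>y. k (x - y) *\<^sub>R f y" x] by simp
    then have "conv k f x - f x = (\<integral>z. k z *\<^sub>R f (x - z) \<partial>lborel) - (\<integral>z. k z *\<^sub>R f x \<partial>lborel)"
      using k by simp
    also have "\<dots> = (\<integral>z. k z *\<^sub>R f (x - z) - k z *\<^sub>R f x \<partial>lborel)"
      using i1 k(1) by (intro Bochner_Integration.integral_diff[symmetric]) auto
    finally have "ennreal (norm (conv k f x - f x)) \<le> (\<integral>\<^sup>+z. ennreal (norm (k z *\<^sub>R f (x - z) - k z *\<^sub>R f x)) \<partial>lborel)"
      using integral_norm_bound_ennreal[of lborel "\<lambda>z. k z *\<^sub>R f (x - z) - k z *\<^sub>R f x"] i1 k(1)
      by (simp only:) simp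
    also have "\<dots> = (\<integral>\<^sup>+z. ennreal (k z) * ennreal (norm (f (- z + x) - f x)) \<partial>lborel)"
      using k(2) by (intro nn_integral_cong)
        (simp add: scaleR_right_diff_distrib[symmetric] ennreal_mult[symmetric])
    finally show ?thesis .
  qed
  then have "(\<integral>\<^sup>+x. ennreal (norm (conv k f x - f x)) \<partial>lborel)
     \<le> (\<integral>\<^sup>+x. (\<integral>\<^sup>+z. ennreal (k z) * ennreal (norm (f (- z + x) - f x)) \<partial>lborel) \<partial>lborel)"
    by (intro nn_integral_mono) auto
  also have "\<dots> = (\<integral>\<^sup>+z. (\<integral>\<^sup>+x. ennreal (k z) * ennreal (norm (f (- z + x) - f x)) \<partial>lborel) \<partial>lborel)"
    by (rule lborel_pair.Fubini') measurable
  also have "\<dots> = (\<integral>\<^sup>+z. ennreal (k z) * transl_dist f (- z) \<partial>lborel)"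
    unfolding transl_dist_def by (intro nn_integral_cong nn_integral_cmult) measurable
  also have "\<dots> \<le> (\<integral>\<^sup>+z. ennreal (k z) * e \<partial>lborel)"
  proof (rule nn_integral_mono)
    fix z show "ennreal (k z) * transl_dist f (- z) \<le> ennreal (k z) * e"
      using e[of z] by (cases "k z = 0") (auto intro: mult_left_mono)
  qed
  also have "\<dots> = (\<integral>\<^sup>+z. ennreal (k z) \<partial>lborel) * e" by (rule nn_integral_multc) measurable
  also have "(\<integral>\<^sup>+z. ennreal (k z) \<partial>lborel) = 1"
    using k by (simp add: nn_integral_eq_integral)
  finally show ?thesis by simp
qed

section \<open>Mollification of weakly differentiable functions\<close>

definition expinv :: "nat \<Rightarrow> real \<Rightarrow> real" where
  "expinv m t = (if 0 < t then (1 / t) ^ m * exp (- (1 / t)) else 0)"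

lemma expinv_nonneg: "0 \<le> expinv m t"
  by (simp add: expinv_def)

lemma expinv_eq_0_iff: "expinv m t = 0 \<longleftrightarrow> t \<le> 0"
  by (auto simp: expinv_def)

lemma expinv_0_le_1: "expinv 0 t \<le> 1"
  by (simp add: expinv_def)

lemma expinv_tendsto_0: "(expinv m \<longlongrightarrow> 0) (at 0)"
proof (rule filterlim_split_at)
  have "eventually (\<lambda>t::real. 0 = expinv m t) (at_left 0)"
    by (rule eventually_at_leftI[of "-1"]) (auto simp: expinv_def)
  then show "(expinv m \<longlongrightarrow> 0) (at_left 0)" by (rule tendsto_cong[THEN iffD1]) simp
  have "((\<lambda>t. (inverse t) ^ m / exp (inverse t)) \<longlongrightarrow> (0::real)) (at_right 0)"
    by (rule filterlim_compose[OF tendsto_power_div_exp_0 filterlim_inverse_at_top_right])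
  moreover have "eventually (\<lambda>t::real. (inverse t) ^ m / exp (inverse t) = expinv m t) (at_right 0)"
    by (rule eventually_at_rightI[of 0 1]) (auto simp: expinv_def exp_minus divide_inverse power_inverse)
  ultimately show "(expinv m \<longlongrightarrow> 0) (at_right 0)" by (rule Lim_transform_eventually)
qed

text \<open>The span of the functions \<open>expinv m\<close> is closed under differentiation, so
  smoothness follows from a single induction over the order with \<open>m\<close> arbitrary.\<close>

lemma expinv_DERIV: "(expinv m has_real_derivative (expinv (m + 2) t - real m * expinv (m + 1) t)) (at t)"
proof (cases "t = 0")
  case True
  \<comment> \<open>At 0 the difference quotient of \<open>expinv m\<close> is exactly
    \<open>expinv (m + 1)\<close>, on both sides.\<close>
  have "((\<lambda>h. (expinv m (0 + h) - expinv m 0) / h) \<longlongrightarrow> 0) (at 0)"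
  proof (rule Lim_transform_eventually[OF expinv_tendsto_0[of "m + 1"]])
    show "eventually (\<lambda>h. expinv (m + 1) h = (expinv m (0 + h) - expinv m 0) / h) (at 0)"
      by (rule eventuallyI) (simp add: expinv_def)
  qed
  then show ?thesis using True by (simp add: DERIV_def expinv_def)
next
  case False
  show ?thesis
  proof (cases "0 < t")
    case True
    have "((\<lambda>t. (1 / t) ^ m * exp (- (1 / t))) has_real_derivative (expinv (m + 2) t - real m * expinv (m + 1) t)) (at t)"
    proof -
      have 1: "((\<lambda>t. 1 / t) has_real_derivative - ((1 / t)\<^sup>2)) (at t)"
        using True by (auto intro!: derivative_eq_intros simp: power2_eq_square)
      have 2: "((\<lambda>t. exp (- (1 / t))) has_real_derivative exp (- (1 / t)) * - (- ((1 / t)\<^sup>2))) (at t)"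
        by (intro DERIV_fun_exp DERIV_minus 1)
      have 3: "real m * (- ((1 / t)\<^sup>2) * (1 / t) ^ (m - Suc 0)) = - (real m * (1 / t) ^ (m + 1))"
        by (cases m) (simp_all add: power2_eq_square)
      show ?thesis
      proof (rule DERIV_cong[OF DERIV_mult[OF DERIV_power[OF 1, of m] 2]])
        have 4: "- (real m * u ^ (m + 1)) * E + E * - (- u\<^sup>2) * u ^ m = u ^ (m + 2) * E - real m * (u ^ (m + 1) * E)" for u E :: real
          by (simp add: power2_eq_square algebra_simps)
        have 5: "expinv k t = (1 / t) ^ k * exp (- (1 / t))" for k
          using True by (simp add: expinv_def)
        show "real m * (- ((1 / t)\<^sup>2) * (1 / t) ^ (m - Suc 0)) * exp (- (1 / t)) + exp (- (1 / t)) * - (- (1 / t)\<^sup>2) * (1 / t) ^ m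
          = expinv (m + 2) t - real m * expinv (m + 1) t"
          unfolding 3 5 by (rule 4)
      qed
    qed
    then show ?thesis
    proof (rule has_field_derivative_transform_within_open[where S="{0<..}"])
      show "(1 / s) ^ m * exp (- (1 / s)) = expinv m s" if "s \<in> {0<..}" for s
        using that by (simp add: expinv_def)
    qed (use True in auto)
  next
    case neg: False
    have "((\<lambda>_. 0) has_real_derivative 0) (at t)" by simp
    then have "(expinv m has_real_derivative 0) (at t)"
    proof (rule has_field_derivative_transform_within_open[where S="{..<0}"])
      show "0 = expinv m s" if "s \<in> {..<0}" for s using that by (simp add: expinv_def)
    qed (use neg False in auto)
    then show ?thesis using neg by (simp add: expinv_def)
  qed
qed

lemma Ck_SucI:
  fixes f :: "'a::euclidean_space \<Rightarrow> real"
  assumes "\<And>x. (f has_derivative f' x) (at x)" "\<And>b. b \<in> Basis \<Longrightarrow> Ck k (\<lambda>x. f' x b)"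
  shows "Ck (Suc k) f"
proof -
  have "frechet_derivative f (at x) = f' x" for x
    using frechet_derivative_at[OF assms(1)] by simp
  moreover have "f differentiable_on UNIV"
    using assms(1) by (auto simp: differentiable_on_def differentiable_def)
  ultimately show ?thesis using assms(2) by simp
qed

lemma Ck_SucD_deriv:
  fixes f :: "'a::euclidean_space \<Rightarrow> real"
  assumes "Ck (Suc k) f"
  shows "(f has_derivative frechet_derivative f (at x)) (at x)"
  using assms by (auto simp: differentiable_on_def frechet_derivative_works)

lemma Ck_Suc_imp: "Ck (Suc k) f \<Longrightarrow> Ck k f"
proof (induction k arbitrary: f)
  case 0
  then show ?case by (auto intro: differentiable_imp_continuous_on)
next
  case (Suc k)
  show ?case unfolding Ck.simps(2)[of k f]
  proof (intro conjI ballI)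
    show "f differentiable_on UNIV" using Suc.prems unfolding Ck.simps(2)[of "Suc k" f] by blast
    fix b :: 'a assume "b \<in> Basis"
    then show "Ck k (\<lambda>x. frechet_derivative f (at x) b)"
      using Suc.prems unfolding Ck.simps(2)[of "Suc k" f] by (intro Suc.IH) blast
  qed
qed

lemma Ck_const: "Ck k (\<lambda>x::'a::euclidean_space. c)"
proof (induction k arbitrary: c)
  case (Suc k)
  show ?case by (rule Ck_SucI[where f'="\<lambda>_ _. 0"]) (auto intro: Suc)
qed simp

lemma Ck_add: "Ck k f \<Longrightarrow> Ck k g \<Longrightarrow> Ck k (\<lambda>x. f x + g x)"
proof (induction k arbitrary: f g)
  case (Suc k)
  show ?case
  proof (rule Ck_SucI)
    show "((\<lambda>x. f x + g x) has_derivative (\<lambda>h. frechet_derivative f (at x) h + frechet_derivative g (at x) h)) (at x)" for x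
      using Suc.prems by (intro has_derivative_add Ck_SucD_deriv)
    show "Ck k (\<lambda>x. frechet_derivative f (at x) b + frechet_derivative g (at x) b)" if "b \<in> Basis" for b
      using Suc.prems that by (intro Suc.IH) auto
  qed
qed (auto intro: continuous_on_add)

lemma Ck_mult: "Ck k f \<Longrightarrow> Ck k g \<Longrightarrow> Ck k (\<lambda>x. f x * g x)"
proof (induction k arbitrary: f g)
  case (Suc k)
  show ?case
  proof (rule Ck_SucI)
    show "((\<lambda>x. f x * g x) has_derivative (\<lambda>h. f x * frechet_derivative g (at x) h + frechet_derivative f (at x) h * g x)) (at x)" for x
      using Suc.prems by (intro has_derivative_mult Ck_SucD_deriv)
    show "Ck k (\<lambda>x. f x * frechet_derivative g (at x) b + frechet_derivative f (at x) b * g x)" if "b \<in> Basis" for b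
      using Ck_add[OF Suc.IH[OF Ck_Suc_imp[OF Suc.prems(1)]] Suc.IH[OF _ Ck_Suc_imp[OF Suc.prems(2)]]] Suc.prems that
      by auto
  qed
qed (auto intro: continuous_on_mult)

lemma Ck_affine: "Ck k (\<lambda>y::'a::euclidean_space. (x - y) \<bullet> b)"
proof (cases k)
  case (Suc k')
  show ?thesis unfolding Suc
    by (rule Ck_SucI[where f'="\<lambda>_ h. - (h \<bullet> b)"])
       (auto intro!: derivative_eq_intros Ck_const simp: inner_diff_left)
qed (auto intro!: continuous_intros)

lemma expinv_ball_has_derivative:
  "((\<lambda>y. expinv m (s - (x - y) \<bullet> (x - y))) has_derivative
     (\<lambda>h. (expinv (m + 2) (s - (x - y) \<bullet> (x - y)) - real m * expinv (m + 1) (s - (x - y) \<bullet> (x - y))) * (2 * ((x - y) \<bullet> h)))) (at y)"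
  for x y :: "'a::euclidean_space"
proof -
  have "((\<lambda>y. s - (x - y) \<bullet> (x - y)) has_derivative (\<lambda>h. 2 * ((x - y) \<bullet> h))) (at y)"
    by (rule has_derivative_eq_rhs, rule derivative_intros, rule derivative_intros, rule has_derivative_inner)
      (auto intro!: derivative_eq_intros simp: inner_commute)
  from has_derivative_compose[OF this expinv_DERIV[of m, unfolded has_field_derivative_def]]
  show ?thesis .
qed

text \<open>The squared distance is a polynomial, hence smooth at the centre as well; each
  derivative raises \<open>m\<close> and multiplies by an affine function.\<close>

lemma Ck_expinv_ball: "Ck k (\<lambda>y::'a::euclidean_space. expinv m (s - (x - y) \<bullet> (x - y)))"
proof (induction k arbitrary: m)
  case 0
  then show ?case unfolding Ck.simps
    by (intro has_derivative_continuous_on) (rule has_derivative_at_withinI[OF expinv_ball_has_derivative])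
next
  case (Suc k)
  show ?case
  proof (rule Ck_SucI[OF expinv_ball_has_derivative])
    fix b :: 'a
    have "Ck k (\<lambda>y. (expinv (m + 2) (s - (x - y) \<bullet> (x - y)) + (- real m) * expinv (m + 1) (s - (x - y) \<bullet> (x - y))) * (2 * ((x - y) \<bullet> b)))"
      by (intro Ck_mult Ck_add Suc.IH Ck_const Ck_affine)
    then show "Ck k (\<lambda>y. (expinv (m + 2) (s - (x - y) \<bullet> (x - y)) - real m * expinv (m + 1) (s - (x - y) \<bullet> (x - y))) * (2 * ((x - y) \<bullet> b)))"
      by (simp only: mult_minus_left add_uminus_conv_diff)
  qed
qed

text \<open>The type argument records the space of integration, which \<open>\<rho>\<close> does not
  determine.\<close>

definition bump_mass :: "'a::euclidean_space itself \<Rightarrow> real \<Rightarrow> real" where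
  "bump_mass _ \<rho> = (\<integral>z. expinv 0 (\<rho>\<^sup>2 - z \<bullet> z) \<partial>(lborel :: 'a measure))"

definition bump :: "real \<Rightarrow> 'a::euclidean_space \<Rightarrow> real" where
  "bump \<rho> z = expinv 0 (\<rho>\<^sup>2 - z \<bullet> z) / bump_mass TYPE('a) \<rho>"

text \<open>The gradient of \<open>bump \<rho>\<close> by the chain rule: \<open>expinv 2\<close> is
  the derivative of \<open>expinv 0\<close>.\<close>

definition dbump :: "real \<Rightarrow> 'a::euclidean_space \<Rightarrow> 'a" where
  "dbump \<rho> z = (- 2 * expinv 2 (\<rho>\<^sup>2 - z \<bullet> z) / bump_mass TYPE('a) \<rho>) *\<^sub>R z"

lemma expinv_continuous: "continuous_on A (expinv m)"
  by (rule DERIV_continuous_on) (rule has_field_derivative_at_within[OF expinv_DERIV])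

lemma expinv_measurable [measurable]: "expinv m \<in> borel_measurable borel"
  by (rule borel_measurable_continuous_onI[OF expinv_continuous])

lemma expinv_ball_integrable: "0 < \<rho> \<Longrightarrow> integrable lborel (\<lambda>z::'a::euclidean_space. expinv 0 (\<rho>\<^sup>2 - z \<bullet> z))"
proof (rule Bochner_Integration.integrable_bound)
  assume r: "0 < \<rho>"
  show "integrable lborel (indicator (ball 0 \<rho>) :: 'a \<Rightarrow> real)"
    using emeasure_lborel_ball_finite[of "0::'a" \<rho>] by (intro integrable_real_indicator) auto
  show "AE z::'a in lborel. norm (expinv 0 (\<rho>\<^sup>2 - z \<bullet> z)) \<le> norm (indicator (ball 0 \<rho>) z :: real)"
  proof (rule AE_I2)
    fix z :: 'a
    show "norm (expinv 0 (\<rho>\<^sup>2 - z \<bullet> z)) \<le> norm (indicator (ball 0 \<rho>) z :: real)"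
    proof (cases "z \<in> ball 0 \<rho>")
      case False
      then have "\<rho>\<^sup>2 \<le> z \<bullet> z" using r by (simp add: power2_norm_eq_inner[symmetric] power_mono)
      with False show ?thesis by (simp add: expinv_eq_0_iff)
    qed (use expinv_0_le_1 expinv_nonneg[of 0] in simp)
  qed
qed measurable

lemma bump_mass_pos:
  assumes "0 < \<rho>" shows "0 < bump_mass TYPE('a::euclidean_space) \<rho>"
proof -
  have "bump_mass TYPE('a) \<rho> \<noteq> 0"
  proof
    assume "bump_mass TYPE('a) \<rho> = 0"
    then have "AE z::'a in lborel. expinv 0 (\<rho>\<^sup>2 - z \<bullet> z) = 0"
      unfolding bump_mass_def
      using integral_nonneg_eq_0_iff_AE[OF expinv_ball_integrable[OF assms, where 'a='a]] by (simp add: expinv_nonneg)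
    then have "AE z::'a in lborel. z \<notin> ball 0 \<rho>"
    proof eventually_elim
      case (elim z)
      then have "\<rho>\<^sup>2 \<le> (norm z)\<^sup>2" by (simp add: expinv_eq_0_iff power2_norm_eq_inner)
      then show ?case using assms by (simp add: power2_le_iff_abs_le)
    qed
    then have "ball (0::'a) \<rho> \<in> null_sets lborel" by (simp add: AE_iff_null_sets)
    then have "ennreal (unit_ball_vol (real DIM('a)) * \<rho> ^ DIM('a)) = 0"
      using emeasure_lborel_ball[of \<rho> "0::'a"] assms by (simp add: null_sets_def)
    moreover have "0 < unit_ball_vol (real DIM('a)) * \<rho> ^ DIM('a)" using assms by simp
    ultimately show False by (simp only: ennreal_eq_0_iff)
  qed
  moreover have "0 \<le> bump_mass TYPE('a) \<rho>"
    unfolding bump_mass_def by (simp add: expinv_nonneg)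
  ultimately show ?thesis by simp
qed

lemma bump_nonneg: "0 < \<rho> \<Longrightarrow> 0 \<le> bump \<rho> z"
  for z :: "'a::euclidean_space"
  using bump_mass_pos[of \<rho>, where 'a='a] by (simp add: bump_def expinv_nonneg)

lemma bump_eq_0_iff: "0 < \<rho> \<Longrightarrow> bump \<rho> z = 0 \<longleftrightarrow> \<rho> \<le> norm z"
  for z :: "'a::euclidean_space"
  using bump_mass_pos[of \<rho>, where 'a='a]
  by (simp add: bump_def expinv_eq_0_iff power2_norm_eq_inner[symmetric] power2_le_iff_abs_le abs_le_square_iff[symmetric])

lemma bump_bounded: "0 < \<rho> \<Longrightarrow> \<bar>bump \<rho> z\<bar> \<le> 1 / bump_mass TYPE('a) \<rho>"
  for z :: "'a::euclidean_space"
  using bump_mass_pos[of \<rho>, where 'a='a] expinv_0_le_1 expinv_nonneg[of 0]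
  by (simp add: bump_def divide_right_mono)

lemma bump_integrable: "0 < \<rho> \<Longrightarrow> integrable lborel (bump \<rho> :: 'a::euclidean_space \<Rightarrow> real)"
  unfolding bump_def using expinv_ball_integrable by (intro integrable_divide_zero) auto

lemma bump_integral: "0 < \<rho> \<Longrightarrow> (\<integral>z. bump \<rho> z \<partial>(lborel :: 'a::euclidean_space measure)) = 1"
  using bump_mass_pos[of \<rho>, where 'a='a] unfolding bump_def
  by (simp add: bump_mass_def)

lemma bump_translate_has_derivative:
  "((\<lambda>y. bump \<rho> (x - y)) has_derivative (\<lambda>h. - (dbump \<rho> (x - y) \<bullet> h))) (at y)"
  for x y :: "'a::euclidean_space"
proof -
  have "((\<lambda>y. expinv 0 (\<rho>\<^sup>2 - (x - y) \<bullet> (x - y))) has_derivative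
     (\<lambda>h. expinv 2 (\<rho>\<^sup>2 - (x - y) \<bullet> (x - y)) * (2 * ((x - y) \<bullet> h)))) (at y)"
    using expinv_ball_has_derivative[of 0 "\<rho>\<^sup>2" x y] by (simp only: add_0 of_nat_0 mult_zero_left diff_zero)
  from has_derivative_mult_left[OF this, of "inverse (bump_mass TYPE('a) \<rho>)"]
  show ?thesis
    unfolding bump_def dbump_def divide_inverse by (rule has_derivative_eq_rhs) (simp add: fun_eq_iff)
qed

lemma bump_has_derivative: "(bump \<rho> has_derivative (\<lambda>h. dbump \<rho> z \<bullet> h)) (at z)"
  for z :: "'a::euclidean_space"
proof -
  have "((\<lambda>y. bump \<rho> (0 - y)) has_derivative (\<lambda>h. - (dbump \<rho> (0 - z) \<bullet> h))) (at z)"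
    by (rule bump_translate_has_derivative)
  then show ?thesis by (simp add: bump_def[abs_def] dbump_def)
qed

lemma bump_continuous: "continuous_on A (bump \<rho>)"
  by (intro has_derivative_continuous_on) (rule has_derivative_at_withinI[OF bump_has_derivative])

lemma dbump_continuous: "continuous_on A (dbump \<rho>)"
  unfolding dbump_def divide_inverse
  by (intro continuous_intros continuous_on_compose2[OF expinv_continuous[of UNIV]]) auto

lemma bump_measurable [measurable]: "bump \<rho> \<in> borel_measurable borel"
  by (rule borel_measurable_continuous_onI[OF bump_continuous])

lemma dbump_eq_0: "0 < \<rho> \<Longrightarrow> \<rho> \<le> norm z \<Longrightarrow> dbump \<rho> z = 0"
  for z :: "'a::euclidean_space"
  by (simp add: dbump_def expinv_eq_0_iff power2_norm_eq_inner[symmetric] power_mono)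

lemma compact_support_uniformly_continuous:
  fixes f :: "'a::euclidean_space \<Rightarrow> 'b::real_normed_vector"
  assumes f: "continuous_on UNIV f" and 0: "\<And>z. \<rho> \<le> norm z \<Longrightarrow> f z = 0"
  shows "uniformly_continuous_on UNIV f" "\<exists>B. \<forall>z. norm (f z) \<le> B"
proof -
  have c: "compact (cball (0::'a) (\<rho> + 1))" by simp
  have fc: "continuous_on (cball 0 (\<rho> + 1)) f" using f by (rule continuous_on_subset) simp
  have uc: "uniformly_continuous_on (cball 0 (\<rho> + 1)) f" by (rule compact_uniformly_continuous[OF fc c])
  show "uniformly_continuous_on UNIV f"
    unfolding uniformly_continuous_on_def
  proof (intro allI impI)
    fix e :: real assume e: "0 < e"
    then obtain d where d: "0 < d" "\<And>x x'. x \<in> cball 0 (\<rho> + 1) \<Longrightarrow> x' \<in> cball 0 (\<rho> + 1) \<Longrightarrow> dist x' x < d \<Longrightarrow> dist (f x') (f x) < e"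
      using uc unfolding uniformly_continuous_on_def by metis
    \<comment> \<open>For points at distance below 1, either both lie in the ball of radius
      \<open>\<rho> + 1\<close>, or both lie outside the ball of radius \<open>\<rho>\<close>, where
      \<open>f\<close> vanishes.\<close>
    show "\<exists>d>0. \<forall>x\<in>UNIV. \<forall>x'\<in>UNIV. dist x' x < d \<longrightarrow> dist (f x') (f x) < e"
    proof (intro exI[of _ "min d 1"] conjI ballI impI)
      fix x x' :: 'a assume xx: "dist x' x < min d 1"
      have n: "\<bar>norm x' - norm x\<bar> \<le> dist x' x" by (simp add: dist_norm norm_triangle_ineq3)
      show "dist (f x') (f x) < e"
      proof (cases "norm x \<le> \<rho> \<or> norm x' \<le> \<rho>")
        case True
        then show ?thesis using n xx by (intro d(2)) auto
      next
        case False
        then show ?thesis using 0 e by simp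
      qed
    qed (use d in simp)
  qed
  have "bounded (f ` cball 0 (\<rho> + 1))" by (rule compact_imp_bounded[OF compact_continuous_image[OF fc c]])
  then obtain B where B: "0 < B" "\<And>z. z \<in> cball 0 (\<rho> + 1) \<Longrightarrow> norm (f z) \<le> B"
    by (auto simp: bounded_pos)
  have "norm (f z) \<le> B" for z
  proof (cases "z \<in> cball 0 (\<rho> + 1)")
    case False
    then have "f z = 0" by (intro 0) auto
    then show ?thesis using B by simp
  qed (rule B(2))
  then show "\<exists>B. \<forall>z. norm (f z) \<le> B" by blast
qed

lemma bump_test_function:
  fixes x :: "'a::euclidean_space"
  assumes r: "0 < \<rho>" and sub: "cball x \<rho> \<subseteq> \<Omega>"
  shows "(\<lambda>y. bump \<rho> (x - y)) \<in> test_functions \<Omega>"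
proof -
  have eq: "{y. bump \<rho> (x - y) \<noteq> 0} = ball x \<rho>"
    using r by (auto simp: bump_eq_0_iff dist_norm)
  have "Ck k (\<lambda>y. bump \<rho> (x - y))" for k
    unfolding bump_def divide_inverse by (intro Ck_mult Ck_expinv_ball Ck_const)
  moreover have "closure {y. bump \<rho> (x - y) \<noteq> 0} = cball x \<rho>"
    unfolding eq using r by simp
  ultimately show ?thesis using sub unfolding test_functions_def by (simp only: mem_Collect_eq compact_cball simp_thms)
qed

text \<open>Only the integration by parts identity, over the whole space and in Borel measure. Test
  functions vanish off \<open>\<Omega>\<close>, so for Borel representatives extended by zero it
  coincides with the identity in \<open>is_weak_gradient\<close>; local integrability is carried
  separately.\<close>

definition is_wgrad :: "'a::euclidean_space set \<Rightarrow> ('a \<Rightarrow> real) \<Rightarrow> ('a \<Rightarrow> 'a) \<Rightarrow> bool" where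
  "is_wgrad \<Omega> f D \<longleftrightarrow> (\<forall>\<psi>\<in>test_functions \<Omega>. \<forall>b\<in>Basis.
     (\<integral>x. f x * frechet_derivative \<psi> (at x) b \<partial>lborel) = - (\<integral>x. (D x \<bullet> b) * \<psi> x \<partial>lborel))"

text \<open>The derivative falls on the kernel; as a function of \<open>y\<close>,
  \<open>bump \<rho> (x - y)\<close> is a test function, so the weak gradient takes the derivative
  back. Cutting off with \<open>K\<close> makes the functions globally integrable and is not felt at
  \<open>x\<close>, since the kernel is supported in \<open>cball x \<rho>\<close>.\<close>

lemma mollified_has_derivative:
  fixes f :: "'a::euclidean_space \<Rightarrow> real"
  assumes w: "is_wgrad \<Omega> f D" and r: "0 < \<rho>" and sub: "cball x \<rho> \<subseteq> K" "K \<subseteq> \<Omega>"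
    and f: "integrable lborel (\<lambda>y. indicator K y *\<^sub>R f y)" and D: "integrable lborel (\<lambda>y. indicator K y *\<^sub>R D y)"
  shows "(conv (bump \<rho>) (\<lambda>y. indicator K y *\<^sub>R f y) has_derivative
     (\<lambda>h. conv (bump \<rho>) (\<lambda>y. indicator K y *\<^sub>R D y) x \<bullet> h)) (at x)"
proof -
  let ?f = "\<lambda>y. indicator K y *\<^sub>R f y" and ?D = "\<lambda>y. indicator K y *\<^sub>R D y"
  have [measurable]: "?f \<in> borel_measurable borel" "?D \<in> borel_measurable borel" using f D by auto
  have [measurable]: "(dbump \<rho> :: 'a \<Rightarrow> 'a) \<in> borel_measurable borel"
    by (rule borel_measurable_continuous_onI[OF dbump_continuous])
  obtain B where B: "\<And>z::'a. norm (dbump \<rho> z) \<le> B"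
    using compact_support_uniformly_continuous(2)[OF dbump_continuous dbump_eq_0[OF r]] by blast
  have deriv: "(conv (bump \<rho>) ?f has_derivative (\<lambda>h. (\<integral>y. ?f y *\<^sub>R dbump \<rho> (x - y) \<partial>lborel) \<bullet> h)) (at x)"
    using r by (intro conv_has_derivative[OF f bump_bounded bump_has_derivative B]
        compact_support_uniformly_continuous(1)[OF dbump_continuous dbump_eq_0])
  let ?V = "\<integral>y. ?f y *\<^sub>R dbump \<rho> (x - y) \<partial>lborel"
  have int_dk: "integrable lborel (\<lambda>y. ?f y *\<^sub>R dbump \<rho> (x - y))"
  proof (rule Bochner_Integration.integrable_bound)
    show "integrable lborel (\<lambda>y. B *\<^sub>R ?f y)" using f by (intro integrable_scaleR_right) simp
    show "AE y in lborel. norm (?f y *\<^sub>R dbump \<rho> (x - y)) \<le> norm (B *\<^sub>R ?f y)"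
    proof (intro AE_I2)
      fix y have "norm (dbump \<rho> (x - y)) \<le> \<bar>B\<bar>" using B[of "x - y"] by simp
      then have "norm (c *\<^sub>R dbump \<rho> (x - y)) \<le> norm (B *\<^sub>R c)" for c :: real
        by (simp add: abs_mult mult.commute[of "\<bar>B\<bar>"] mult_left_mono)
      then show "norm (?f y *\<^sub>R dbump \<rho> (x - y)) \<le> norm (B *\<^sub>R ?f y)" .
    qed
  qed measurable
  have "?V = conv (bump \<rho>) ?D x"
  proof (rule euclidean_eqI)
    fix b :: 'a assume b: "b \<in> Basis"
    have out: "norm (x - y) < \<rho> \<Longrightarrow> y \<in> K" for y using sub(1) by (auto simp: subset_eq dist_norm)
    have "?V \<bullet> b = (\<integral>y. (?f y *\<^sub>R dbump \<rho> (x - y)) \<bullet> b \<partial>lborel)"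
      by (rule integral_inner_left[symmetric]) (rule int_dk)
    also have "\<dots> = (\<integral>y. - (f y * frechet_derivative (\<lambda>y. bump \<rho> (x - y)) (at y) b) \<partial>lborel)"
    proof (rule Bochner_Integration.integral_cong[OF refl])
      fix y
      have "frechet_derivative (\<lambda>y. bump \<rho> (x - y)) (at y) b = - (dbump \<rho> (x - y) \<bullet> b)"
        using frechet_derivative_at[OF bump_translate_has_derivative] by metis
      then show "(?f y *\<^sub>R dbump \<rho> (x - y)) \<bullet> b = - (f y * frechet_derivative (\<lambda>y. bump \<rho> (x - y)) (at y) b)"
        using out[of y] dbump_eq_0[OF r, of "x - y"] by (cases "norm (x - y) < \<rho>") auto
    qed
    also have "\<dots> = - (\<integral>y. f y * frechet_derivative (\<lambda>y. bump \<rho> (x - y)) (at y) b \<partial>lborel)"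
      by simp
    also have "\<dots> = (\<integral>y. (D y \<bullet> b) * bump \<rho> (x - y) \<partial>lborel)"
      using w[unfolded is_wgrad_def, rule_format, OF bump_test_function[OF r order_trans[OF sub]] b] by simp
    also have "\<dots> = (\<integral>y. (bump \<rho> (x - y) *\<^sub>R ?D y) \<bullet> b \<partial>lborel)"
    proof (rule Bochner_Integration.integral_cong[OF refl])
      fix y show "(D y \<bullet> b) * bump \<rho> (x - y) = (bump \<rho> (x - y) *\<^sub>R ?D y) \<bullet> b"
        using out[of y] bump_eq_0_iff[OF r, of "x - y"] by (cases "norm (x - y) < \<rho>") auto
    qed
    also have "\<dots> = conv (bump \<rho>) ?D x \<bullet> b"
      unfolding conv_def by (rule integral_inner_left) (rule conv_integrable[OF D bump_measurable bump_bounded[OF r]])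
    finally show "?V \<bullet> b = conv (bump \<rho>) ?D x \<bullet> b" .
  qed
  with deriv show ?thesis by simp
qed

lemma mollify_L1:
  fixes f :: "'a::euclidean_space \<Rightarrow> 'b::{banach, second_countable_topology}"
  assumes f: "integrable lborel f" and e: "0 < e"
  shows "eventually (\<lambda>\<rho>. (\<integral>\<^sup>+x. ennreal (norm (conv (bump \<rho>) f x - f x)) \<partial>lborel) \<le> ennreal e) (at_right 0)"
proof -
  obtain d where d: "0 < d" "\<And>z. norm z < d \<Longrightarrow> transl_dist f z \<le> ennreal e"
    using L1_translation_continuous[OF f e] unfolding eventually_nhds_metric by (auto simp: dist_norm)
  show ?thesis
  proof (rule eventually_at_rightI[OF _ d(1)])
    fix \<rho> assume r: "\<rho> \<in> {0<..<d}"
    then show "(\<integral>\<^sup>+x. ennreal (norm (conv (bump \<rho>) f x - f x)) \<partial>lborel) \<le> ennreal e"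
      by (intro conv_L1_bound[OF f bump_integrable bump_nonneg bump_integral bump_bounded d(2)])
        (auto simp: bump_eq_0_iff)
  qed
qed

text \<open>One and the same \<open>\<rho> < \<epsilon>\<close> mollifies \<open>f\<close> and
  \<open>D\<close>; this makes the approximation \<open>G\<close> of \<open>D\<close> the classical
  gradient of the approximation \<open>g\<close> of \<open>f\<close>.\<close>

lemma smooth_approximation:
  fixes f :: "'a::euclidean_space \<Rightarrow> real"
  assumes w: "is_wgrad \<Omega> f D" and K: "K \<subseteq> \<Omega>" and e: "0 < e" and \<epsilon>: "0 < \<epsilon>"
    and f: "integrable lborel (\<lambda>y. indicator K y *\<^sub>R f y)" and D: "integrable lborel (\<lambda>y. indicator K y *\<^sub>R D y)"
  obtains g G where "continuous_on UNIV g" "continuous_on UNIV G"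
    "\<And>x. cball x \<epsilon> \<subseteq> K \<Longrightarrow> (g has_derivative (\<lambda>h. G x \<bullet> h)) (at x)"
    "(\<integral>\<^sup>+x. ennreal (norm (g x - indicator K x *\<^sub>R f x)) \<partial>lborel) \<le> ennreal e"
    "(\<integral>\<^sup>+x. ennreal (norm (G x - indicator K x *\<^sub>R D x)) \<partial>lborel) \<le> ennreal e"
proof -
  have "eventually (\<lambda>\<rho>. \<rho> \<in> {0<..<\<epsilon>}) (at_right (0::real))"
    by (rule eventually_at_rightI[OF _ \<epsilon>])
  with mollify_L1[OF f e] mollify_L1[OF D e]
  have "eventually (\<lambda>\<rho>. \<rho> \<in> {0<..<\<epsilon>} \<and> (\<integral>\<^sup>+x. ennreal (norm (conv (bump \<rho>) (\<lambda>y. indicator K y *\<^sub>R f y) x - indicator K x *\<^sub>R f x)) \<partial>lborel) \<le> ennreal e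
     \<and> (\<integral>\<^sup>+x. ennreal (norm (conv (bump \<rho>) (\<lambda>y. indicator K y *\<^sub>R D y) x - indicator K x *\<^sub>R D x)) \<partial>lborel) \<le> ennreal e) (at_right 0)"
    by eventually_elim auto
  then obtain \<rho> where \<rho>: "0 < \<rho>" "\<rho> < \<epsilon>"
    and L: "(\<integral>\<^sup>+x. ennreal (norm (conv (bump \<rho>) (\<lambda>y. indicator K y *\<^sub>R f y) x - indicator K x *\<^sub>R f x)) \<partial>lborel) \<le> ennreal e"
     "(\<integral>\<^sup>+x. ennreal (norm (conv (bump \<rho>) (\<lambda>y. indicator K y *\<^sub>R D y) x - indicator K x *\<^sub>R D x)) \<partial>lborel) \<le> ennreal e"
    by (metis (no_types, lifting) eventually_happens' greaterThanLessThan_iff trivial_limit_at_right_real)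
  have uc: "uniformly_continuous_on UNIV (bump \<rho> :: 'a \<Rightarrow> real)"
    by (rule compact_support_uniformly_continuous(1)[OF bump_continuous]) (use bump_eq_0_iff[OF \<rho>(1)] in auto)
  show thesis
  proof (rule that[of "conv (bump \<rho>) (\<lambda>y. indicator K y *\<^sub>R f y)" "conv (bump \<rho>) (\<lambda>y. indicator K y *\<^sub>R D y)"])
    show "continuous_on UNIV (conv (bump \<rho>) (\<lambda>y. indicator K y *\<^sub>R f y))"
      by (rule conv_continuous[OF f bump_bounded[OF \<rho>(1)] uc])
    show "continuous_on UNIV (conv (bump \<rho>) (\<lambda>y. indicator K y *\<^sub>R D y))"
      by (rule conv_continuous[OF D bump_bounded[OF \<rho>(1)] uc])
    fix x assume "cball x \<epsilon> \<subseteq> K"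
    then have "cball x \<rho> \<subseteq> K" using \<rho>(2) by auto
    then show "(conv (bump \<rho>) (\<lambda>y. indicator K y *\<^sub>R f y) has_derivative
        (\<lambda>h. conv (bump \<rho>) (\<lambda>y. indicator K y *\<^sub>R D y) x \<bullet> h)) (at x)"
      by (rule mollified_has_derivative[OF w \<rho>(1) _ K f D])
  qed (use L in auto)
qed

lemma compact_neighbourhood:
  fixes K :: "'a::euclidean_space set"
  assumes "compact K" "open \<Omega>" "K \<subseteq> \<Omega>"
  obtains K' e where "compact K'" "K' \<subseteq> \<Omega>" "0 < e" "\<And>x. x \<in> K \<Longrightarrow> cball x e \<subseteq> K'"
proof -
  obtain e where e: "0 < e" "(\<Union>x\<in>K. cball x e) \<subseteq> \<Omega>"
    using compact_subset_open_imp_cball_epsilon_subset[OF assms] by blast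
  show thesis
    by (rule that[of "\<Union>x\<in>K. cball x e" e]) (use e compact_minkowski_sum_cball[OF assms(1)] in auto)
qed

text \<open>At a point of a compact \<open>K\<close> the mollification of \<open>u\<close> is an
  integral against a test function, hence 0, so the L^1 norm of \<open>u\<close> over
  \<open>K\<close> is at most the mollification error. Countably many compact sets exhaust
  \<open>\<Omega>\<close>.\<close>

lemma test_function_vanishing:
  fixes u :: "'a::euclidean_space \<Rightarrow> real"
  assumes \<Omega>: "open \<Omega>" and loc: "\<And>K. compact K \<Longrightarrow> K \<subseteq> \<Omega> \<Longrightarrow> integrable lborel (\<lambda>y. indicator K y *\<^sub>R u y)"
    and 0: "\<And>\<psi>. \<psi> \<in> test_functions \<Omega> \<Longrightarrow> (\<integral>x. u x * \<psi> x \<partial>lborel) = 0"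
  shows "AE x in lborel. x \<in> \<Omega> \<longrightarrow> u x = 0"
proof -
  have K0: "AE x in lborel. x \<in> K \<longrightarrow> u x = 0" if K: "compact K" "K \<subseteq> \<Omega>" for K
  proof -
    obtain K' e where K': "compact K'" "K' \<subseteq> \<Omega>" "0 < e" "\<And>x. x \<in> K \<Longrightarrow> cball x e \<subseteq> K'"
      using compact_neighbourhood[OF K(1) \<Omega> K(2)] by blast
    let ?u = "\<lambda>y. indicator K' y *\<^sub>R u y"
    have u: "integrable lborel ?u" using loc[OF K'(1,2)] .
    have "(\<lambda>y. indicator K y *\<^sub>R u y) \<in> borel_measurable borel" using loc[OF K] by auto
    then have [measurable]: "(\<lambda>y. indicator K y * u y) \<in> borel_measurable borel" by simp
    have Ksub: "K \<subseteq> K'" using K'(3,4) by force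
    have "(\<integral>\<^sup>+x. ennreal (norm (indicator K x *\<^sub>R u x)) \<partial>lborel) \<le> 0 + ennreal d" if d: "0 < d" for d
    proof -
      have "eventually (\<lambda>\<rho>. \<rho> \<in> {0<..<e}) (at_right (0::real))"
        by (rule eventually_at_rightI[OF _ K'(3)])
      with mollify_L1[OF u d] have "eventually (\<lambda>\<rho>. \<rho> \<in> {0<..<e} \<and> (\<integral>\<^sup>+x. ennreal (norm (conv (bump \<rho>) ?u x - ?u x)) \<partial>lborel) \<le> ennreal d) (at_right 0)"
        by eventually_elim auto
      then obtain \<rho> where \<rho>: "0 < \<rho>" "\<rho> < e" and L: "(\<integral>\<^sup>+x. ennreal (norm (conv (bump \<rho>) ?u x - ?u x)) \<partial>lborel) \<le> ennreal d"
        by (metis (no_types, lifting) eventually_happens' greaterThanLessThan_iff trivial_limit_at_right_real)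
      have "conv (bump \<rho>) ?u x = 0" if x: "x \<in> K" for x
      proof -
        have sub: "cball x \<rho> \<subseteq> K'" using K'(4)[OF x] \<rho>(2) by auto
        have "conv (bump \<rho>) ?u x = (\<integral>y. u y * bump \<rho> (x - y) \<partial>lborel)"
          unfolding conv_def
        proof (rule Bochner_Integration.integral_cong[OF refl])
          fix y show "bump \<rho> (x - y) *\<^sub>R ?u y = u y * bump \<rho> (x - y)"
            using sub bump_eq_0_iff[OF \<rho>(1), of "x - y"]
            by (cases "norm (x - y) < \<rho>") (auto simp: subset_eq dist_norm)
        qed
        also have "\<dots> = 0" using sub K'(2) by (intro 0 bump_test_function \<rho>(1)) auto
        finally show ?thesis .
      qed
      then have "norm (indicator K x *\<^sub>R u x) \<le> norm (conv (bump \<rho>) ?u x - ?u x)" for x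
        using Ksub by (auto split: split_indicator)
      then have "(\<integral>\<^sup>+x. ennreal (norm (indicator K x *\<^sub>R u x)) \<partial>lborel) \<le> (\<integral>\<^sup>+x. ennreal (norm (conv (bump \<rho>) ?u x - ?u x)) \<partial>lborel)"
        by (intro nn_integral_mono ennreal_leI)
      with L show ?thesis by simp
    qed
    then have "(\<integral>\<^sup>+x. ennreal (norm (indicator K x *\<^sub>R u x)) \<partial>lborel) = 0"
      using ennreal_le_epsilon[of 0] by (metis le_zero_eq)
    then have "AE x in lborel. ennreal (norm (indicator K x *\<^sub>R u x)) = 0"
      by (subst (asm) nn_integral_0_iff_AE) simp_all
    then show ?thesis by eventually_elim (auto split: split_indicator_asm)
  qed
  obtain C where C: "\<And>n::nat. compact (C n)" "\<And>n. C n \<subseteq> \<Omega>" "\<Union> (range C) = \<Omega>"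
    using open_Union_compact_subsets[OF \<Omega>] by metis
  have "AE x in lborel. \<forall>n. x \<in> C n \<longrightarrow> u x = 0"
    unfolding AE_all_countable using K0[OF C(1,2)] by blast
  then show ?thesis by eventually_elim (use C(3) in auto)
qed

section \<open>Averages over moving balls\<close>

text \<open>The fundamental theorem of calculus for \<open>W (r t) * v (z t)\<close>. The point
  \<open>z t\<close> has velocity \<open>h + s *\<^sub>R y\<close>, of norm at most
  \<open>2 * norm h\<close>: this is the factor 2 of the gradient term.\<close>

lemma path_increment:
  fixes v :: "'a::euclidean_space \<Rightarrow> real" and g :: "'a \<Rightarrow> 'a" and x h y :: 'a and r0 s a b :: real
  defines "r \<equiv> \<lambda>t. r0 + t * s" and "z \<equiv> \<lambda>t. x + t *\<^sub>R h + (r0 + t * s) *\<^sub>R y"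
  assumes ab: "a \<le> b" and contv: "continuous_on UNIV v" and contg: "continuous_on UNIV g"
    and dv: "\<And>t. a \<le> t \<Longrightarrow> t \<le> b \<Longrightarrow> (v has_derivative (\<lambda>k. g (z t) \<bullet> k)) (at (z t))"
    and r: "\<And>t. a \<le> t \<Longrightarrow> t \<le> b \<Longrightarrow> 0 < r t" and s: "\<bar>s\<bar> \<le> norm h" and y: "norm y \<le> 1"
    and W: "\<And>t. 0 < t \<Longrightarrow> (W has_real_derivative W' t) (at t)" "continuous_on {0<..} W'"
    and W_le: "\<And>t. 0 < t \<Longrightarrow> \<bar>W t\<bar> \<le> C * t powr \<beta>" "\<And>t. 0 < t \<Longrightarrow> \<bar>W' t\<bar> \<le> C * t powr (\<beta> - 1)"
  shows "ennreal \<bar>W (r b) * v (z b) - W (r a) * v (z a)\<bar>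
    \<le> (\<integral>\<^sup>+t. ennreal (norm h * (C * r t powr (\<beta> - 1) * \<bar>v (z t)\<bar> + 2 * C * r t powr \<beta> * norm (g (z t)))) * indicator {a..b} t \<partial>lborel)"
proof -
  define c where "c t = W (r t) * v (z t)" for t
  define c' where "c' t = W' (r t) * s * v (z t) + (g (z t) \<bullet> (h + s *\<^sub>R y)) * W (r t)" for t
  have dz: "(z has_derivative (\<lambda>k. k *\<^sub>R (h + s *\<^sub>R y))) (at t)" for t
    unfolding z_def by (auto intro!: derivative_eq_intros simp: algebra_simps)
  have dc: "(c has_real_derivative c' t) (at t)" if t: "a \<le> t" "t \<le> b" for t
  proof -
    have "(r has_real_derivative s) (at t)"
      unfolding r_def by (auto intro!: derivative_eq_intros)
    then have 1: "((\<lambda>t. W (r t)) has_real_derivative W' (r t) * s) (at t)"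
      by (rule DERIV_chain2[where g=r, OF W(1)[OF r[OF t]]])
    have "((\<lambda>t. v (z t)) has_derivative (\<lambda>k. g (z t) \<bullet> (k *\<^sub>R (h + s *\<^sub>R y)))) (at t)"
      by (rule has_derivative_compose[OF dz dv[OF t]])
    then have 2: "((\<lambda>t. v (z t)) has_real_derivative g (z t) \<bullet> (h + s *\<^sub>R y)) (at t)"
      unfolding has_field_derivative_def by (rule has_derivative_eq_rhs) (simp add: fun_eq_iff mult.commute)
    show ?thesis unfolding c_def[abs_def] c'_def by (rule DERIV_mult[OF 1 2])
  qed
  have rpos: "r ` {a..b} \<subseteq> {0<..}" using r by auto
  have cont: "continuous_on {a..b} c'"
  proof -
    have cr: "continuous_on {a..b} r" unfolding r_def by (intro continuous_intros)
    have cz: "continuous_on {a..b} z" unfolding z_def by (intro continuous_intros)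
    have 1: "continuous_on {a..b} (\<lambda>t. W' (r t))"
      by (rule continuous_on_compose2[OF W(2) cr rpos])
    have "continuous_on {0<..} W"
      by (rule DERIV_continuous_on[where D=W']) (use W(1) in \<open>auto intro: has_field_derivative_at_within\<close>)
    then have 2: "continuous_on {a..b} (\<lambda>t. W (r t))"
      by (rule continuous_on_compose2[OF _ cr rpos])
    have 3: "continuous_on {a..b} (\<lambda>t. v (z t))" "continuous_on {a..b} (\<lambda>t. g (z t))"
      by (rule continuous_on_compose2[OF contv cz], simp) (rule continuous_on_compose2[OF contg cz], simp)
    show ?thesis unfolding c'_def by (intro continuous_intros 1 2 3)
  qed
  have bound: "\<bar>c' t\<bar> \<le> norm h * (C * r t powr (\<beta> - 1) * \<bar>v (z t)\<bar> + 2 * C * r t powr \<beta> * norm (g (z t)))"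
    if t: "a \<le> t" "t \<le> b" for t
  proof -
    have hy: "norm (h + s *\<^sub>R y) \<le> 2 * norm h"
    proof -
      have "norm (s *\<^sub>R y) \<le> norm h * 1" using mult_mono[OF s y] by simp
      then show ?thesis using norm_triangle_ineq[of h "s *\<^sub>R y"] by simp
    qed
    have "\<bar>W' (r t) * s * v (z t)\<bar> = \<bar>W' (r t)\<bar> * \<bar>s\<bar> * \<bar>v (z t)\<bar>" by (simp add: abs_mult)
    also have "\<dots> \<le> (C * r t powr (\<beta> - 1)) * norm h * \<bar>v (z t)\<bar>"
      using W_le(2)[OF r[OF t]] s by (intro mult_right_mono mult_mono) (auto intro: order_trans[OF abs_ge_zero])
    finally have 1: "\<bar>W' (r t) * s * v (z t)\<bar> \<le> norm h * (C * r t powr (\<beta> - 1) * \<bar>v (z t)\<bar>)" by (simp add: mult_ac)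
    have "\<bar>(g (z t) \<bullet> (h + s *\<^sub>R y)) * W (r t)\<bar> = \<bar>g (z t) \<bullet> (h + s *\<^sub>R y)\<bar> * \<bar>W (r t)\<bar>" by (simp add: abs_mult)
    also have "\<dots> \<le> (norm (g (z t)) * (2 * norm h)) * (C * r t powr \<beta>)"
      using W_le(1)[OF r[OF t]] Cauchy_Schwarz_ineq2[of "g (z t)" "h + s *\<^sub>R y"] mult_left_mono[OF hy, of "norm (g (z t))"]
      by (intro mult_mono) auto
    finally have 2: "\<bar>(g (z t) \<bullet> (h + s *\<^sub>R y)) * W (r t)\<bar> \<le> norm h * (2 * C * r t powr \<beta> * norm (g (z t)))" by (simp add: mult_ac)
    show ?thesis unfolding c'_def using 1 2 abs_triangle_ineq[of "W' (r t) * s * v (z t)" "(g (z t) \<bullet> (h + s *\<^sub>R y)) * W (r t)"]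
      by (simp add: distrib_left)
  qed
  have "has_bochner_integral lborel (\<lambda>t. indicator {a..b} t *\<^sub>R c' t) (c b - c a)"
  proof (rule has_bochner_integral_FTC_Icc[OF ab _ cont])
    fix t assume "a \<le> t" "t \<le> b"
    from dc[OF this] show "(c has_vector_derivative c' t) (at t within {a..b})"
      by (simp add: has_real_derivative_iff_has_vector_derivative has_vector_derivative_at_within)
  qed
  then have "ennreal \<bar>c b - c a\<bar> \<le> (\<integral>\<^sup>+t. ennreal (norm (indicator {a..b} t *\<^sub>R c' t)) \<partial>lborel)"
    using integral_norm_bound_ennreal[of lborel "\<lambda>t. indicator {a..b} t *\<^sub>R c' t"]
    by (simp add: has_bochner_integral_iff)
  also have "\<dots> \<le> (\<integral>\<^sup>+t. ennreal (norm h * (C * r t powr (\<beta> - 1) * \<bar>v (z t)\<bar> + 2 * C * r t powr \<beta> * norm (g (z t)))) * indicator {a..b} t \<partial>lborel)"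
    by (intro nn_integral_mono) (auto split: split_indicator intro!: ennreal_leI bound)
  finally show ?thesis unfolding c_def .
qed

lemma ball_integral_scaled:
  fixes f :: "'a::euclidean_space \<Rightarrow> ennreal"
  assumes [measurable]: "f \<in> borel_measurable borel" and r: "0 < r"
  shows "(\<integral>\<^sup>+y. f y * indicator (ball x r) y \<partial>lborel) = ennreal (r ^ DIM('a)) * (\<integral>\<^sup>+y. f (x + r *\<^sub>R y) * indicator (ball 0 1) y \<partial>lborel)"
proof -
  have "(\<integral>\<^sup>+y. f y * indicator (ball x r) y \<partial>lborel)
      = (\<integral>\<^sup>+y. f y * indicator (ball x r) y \<partial>density (distr lborel borel (\<lambda>y. x + r *\<^sub>R y)) (\<lambda>_. ennreal (\<bar>r\<bar> ^ DIM('a))))"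
    using r lborel_affine[of r x] by simp
  also have "\<dots> = (\<integral>\<^sup>+y. ennreal (r ^ DIM('a)) * (f (x + r *\<^sub>R y) * indicator (ball x r) (x + r *\<^sub>R y)) \<partial>lborel)"
    using r by (simp add: nn_integral_density nn_integral_distr)
  also have "\<dots> = ennreal (r ^ DIM('a)) * (\<integral>\<^sup>+y. f (x + r *\<^sub>R y) * indicator (ball x r) (x + r *\<^sub>R y) \<partial>lborel)"
    by (rule nn_integral_cmult) measurable
  also have "(\<integral>\<^sup>+y. f (x + r *\<^sub>R y) * indicator (ball x r) (x + r *\<^sub>R y) \<partial>lborel) = (\<integral>\<^sup>+y. f (x + r *\<^sub>R y) * indicator (ball 0 1) y \<partial>lborel)"
    using r by (intro nn_integral_cong) (auto simp: dist_norm split: split_indicator)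
  finally show ?thesis .
qed

text \<open>Not divided by the volume of the unit ball; that factor is part of
  \<open>weight\<close>. The fixed domain of integration allows each \<open>y\<close> to be followed
  separately while centre and radius move.\<close>

abbreviation unit_avg :: "('a::euclidean_space \<Rightarrow> ennreal) \<Rightarrow> 'a \<Rightarrow> real \<Rightarrow> ennreal" where
  "unit_avg f x r \<equiv> (\<integral>\<^sup>+y. f (x + r *\<^sub>R y) * indicator (ball 0 1) y \<partial>lborel)"

lemma unit_avg_eq:
  fixes f :: "'a::euclidean_space \<Rightarrow> ennreal"
  assumes "f \<in> borel_measurable borel" and r: "0 < r"
  shows "unit_avg f x r = ennreal (r powr (- real DIM('a))) * (\<integral>\<^sup>+y. f y * indicator (ball x r) y \<partial>lborel)"
proof -
  have "r powr (- real DIM('a)) * r ^ DIM('a) = 1"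
    using r by (simp add: powr_minus powr_realpow)
  then show ?thesis
    using r by (simp add: ball_integral_scaled[OF assms] mult.assoc[symmetric] ennreal_mult[symmetric])
qed

lemma unit_avg_le_fmax:
  fixes f :: "'a::euclidean_space \<Rightarrow> ennreal"
  assumes [measurable]: "f \<in> borel_measurable borel" and r: "0 < r"
  shows "ennreal (r powr \<alpha>) * unit_avg f x r \<le> fmax \<alpha> f x"
proof -
  have "ennreal (r powr \<alpha>) * unit_avg f x r = ennreal (r powr (\<alpha> - real DIM('a))) * (\<integral>\<^sup>+y. f y * indicator (ball x r) y \<partial>lborel)"
    unfolding unit_avg_eq[OF assms] by (simp add: mult.assoc[symmetric] ennreal_mult[symmetric] powr_add[symmetric])
  then show ?thesis using fmax_upper[OF r] by metis
qed

lemma unit_avg_perturb: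
  fixes u w :: "'a::euclidean_space \<Rightarrow> 'b::{banach, second_countable_topology}"
  assumes [measurable]: "u \<in> borel_measurable borel" "w \<in> borel_measurable borel" and r: "0 < r"
    and e: "(\<integral>\<^sup>+y. ennreal (norm (u y - w y)) * indicator (ball x r) y \<partial>lborel) \<le> ennreal e"
  shows "unit_avg (\<lambda>y. ennreal (norm (u y))) x r \<le> unit_avg (\<lambda>y. ennreal (norm (w y))) x r + ennreal (r powr (- real DIM('a))) * ennreal e"
proof -
  have "(\<integral>\<^sup>+y. ennreal (norm (u y)) * indicator (ball x r) y \<partial>lborel)
    \<le> (\<integral>\<^sup>+y. ennreal (norm (w y)) * indicator (ball x r) y + ennreal (norm (u y - w y)) * indicator (ball x r) y \<partial>lborel)"
  proof (rule nn_integral_mono)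
    fix y
    have "norm (u y) \<le> norm (w y) + norm (u y - w y)" by norm
    then have "ennreal (norm (u y)) \<le> ennreal (norm (w y)) + ennreal (norm (u y - w y))"
      by (simp add: ennreal_plus[symmetric] ennreal_leI del: ennreal_plus)
    then show "ennreal (norm (u y)) * indicator (ball x r) y \<le> ennreal (norm (w y)) * indicator (ball x r) y + ennreal (norm (u y - w y)) * indicator (ball x r) y"
      by (auto split: split_indicator)
  qed
  also have "\<dots> = (\<integral>\<^sup>+y. ennreal (norm (w y)) * indicator (ball x r) y \<partial>lborel) + (\<integral>\<^sup>+y. ennreal (norm (u y - w y)) * indicator (ball x r) y \<partial>lborel)"
    by (rule nn_integral_add) measurable
  also have "\<dots> \<le> (\<integral>\<^sup>+y. ennreal (norm (w y)) * indicator (ball x r) y \<partial>lborel) + ennreal e"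
    by (intro add_left_mono e)
  finally have *: "(\<integral>\<^sup>+y. ennreal (norm (u y)) * indicator (ball x r) y \<partial>lborel) \<le> (\<integral>\<^sup>+y. ennreal (norm (w y)) * indicator (ball x r) y \<partial>lborel) + ennreal e" .
  have "unit_avg (\<lambda>y. ennreal (norm (u y))) x r = ennreal (r powr (- real DIM('a))) * (\<integral>\<^sup>+y. ennreal (norm (u y)) * indicator (ball x r) y \<partial>lborel)"
    by (rule unit_avg_eq[OF _ r]) measurable
  also have "\<dots> \<le> ennreal (r powr (- real DIM('a))) * ((\<integral>\<^sup>+y. ennreal (norm (w y)) * indicator (ball x r) y \<partial>lborel) + ennreal e)"
    by (intro mult_left_mono *) simp
  also have "\<dots> = ennreal (r powr (- real DIM('a))) * (\<integral>\<^sup>+y. ennreal (norm (w y)) * indicator (ball x r) y \<partial>lborel) + ennreal (r powr (- real DIM('a))) * ennreal e"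
    by (rule distrib_left)
  also have "ennreal (r powr (- real DIM('a))) * (\<integral>\<^sup>+y. ennreal (norm (w y)) * indicator (ball x r) y \<partial>lborel) = unit_avg (\<lambda>y. ennreal (norm (w y))) x r"
    by (rule unit_avg_eq[OF _ r, symmetric]) measurable
  finally show ?thesis .
qed

text \<open>In the coordinates of the unit ball, a ball whose centre and radius move linearly is a
  family of straight paths, one for each \<open>y\<close>. Integrating \<open>path_increment\<close>
  over \<open>y\<close> and exchanging the integrals gives averages over the intermediate
  balls.\<close>

lemma smooth_average_increment:
  fixes v :: "'a::euclidean_space \<Rightarrow> real" and g :: "'a \<Rightarrow> 'a" and x h :: 'a and r0 s a b :: real
  defines "r \<equiv> \<lambda>t. r0 + t * s" and "X \<equiv> \<lambda>t. x + t *\<^sub>R h"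
  assumes ab: "a \<le> b" and contv: "continuous_on UNIV v" and contg: "continuous_on UNIV g"
    and dv: "\<And>t w. a \<le> t \<Longrightarrow> t \<le> b \<Longrightarrow> dist (X t) w \<le> r t \<Longrightarrow> (v has_derivative (\<lambda>k. g w \<bullet> k)) (at w)"
    and r: "\<And>t. a \<le> t \<Longrightarrow> t \<le> b \<Longrightarrow> 0 < r t" and s: "\<bar>s\<bar> \<le> norm h"
    and W: "\<And>t. 0 < t \<Longrightarrow> (W has_real_derivative W' t) (at t)" "continuous_on {0<..} W'"
    and W_le: "\<And>t. 0 < t \<Longrightarrow> \<bar>W t\<bar> \<le> C * t powr \<beta>" "\<And>t. 0 < t \<Longrightarrow> \<bar>W' t\<bar> \<le> C * t powr (\<beta> - 1)"
    and W0: "\<And>t. 0 < t \<Longrightarrow> 0 \<le> W t" and C: "0 \<le> C"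
  shows "ennreal (W (r b)) * unit_avg (\<lambda>y. ennreal \<bar>v y\<bar>) (X b) (r b)
    \<le> ennreal (W (r a)) * unit_avg (\<lambda>y. ennreal \<bar>v y\<bar>) (X a) (r a)
      + ennreal (norm h) * (\<integral>\<^sup>+t. (ennreal C * (ennreal (r t powr (\<beta> - 1)) * unit_avg (\<lambda>y. ennreal \<bar>v y\<bar>) (X t) (r t))
          + ennreal (2 * C) * (ennreal (r t powr \<beta>) * unit_avg (\<lambda>y. ennreal (norm (g y))) (X t) (r t))) * indicator {a..b} t \<partial>lborel)"
proof -
  have [measurable]: "v \<in> borel_measurable borel" "g \<in> borel_measurable borel"
    using contv contg by (auto intro: borel_measurable_continuous_onI)
  have [measurable]: "r \<in> borel_measurable borel" "X \<in> borel_measurable borel"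
    unfolding r_def X_def by measurable
  let ?B = "\<lambda>y::'a. indicator (ball 0 1) y :: ennreal"
  define z where "z t y = X t + r t *\<^sub>R y" for t and y :: 'a
  have [measurable]: "(\<lambda>(t, y). z t y) \<in> borel_measurable (borel \<Otimes>\<^sub>M borel)" "\<And>t. z t \<in> borel_measurable borel"
    unfolding z_def by measurable
  have inc: "ennreal (W (r b)) * ennreal \<bar>v (z b y)\<bar> * ?B y \<le> ennreal (W (r a)) * ennreal \<bar>v (z a y)\<bar> * ?B y
    + (\<integral>\<^sup>+t. ennreal (norm h * (C * r t powr (\<beta> - 1) * \<bar>v (z t y)\<bar> + 2 * C * r t powr \<beta> * norm (g (z t y)))) * indicator {a..b} t * ?B y \<partial>lborel)" for y
  proof (cases "y \<in> ball 0 1")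
    case True
    then have y: "norm y \<le> 1" by simp
    have "ennreal \<bar>W (r b) * v (z b y) - W (r a) * v (z a y)\<bar>
      \<le> (\<integral>\<^sup>+t. ennreal (norm h * (C * r t powr (\<beta> - 1) * \<bar>v (z t y)\<bar> + 2 * C * r t powr \<beta> * norm (g (z t y)))) * indicator {a..b} t \<partial>lborel)"
      unfolding z_def X_def r_def
    proof (rule path_increment[OF ab contv contg _ _ s y W W_le])
      fix t assume t: "a \<le> t" "t \<le> b"
      show "0 < r0 + t * s" using r[OF t] by (simp add: r_def)
      show "(v has_derivative (\<lambda>k. g (x + t *\<^sub>R h + (r0 + t * s) *\<^sub>R y) \<bullet> k)) (at (x + t *\<^sub>R h + (r0 + t * s) *\<^sub>R y))"
      proof (rule dv[OF t])
        have "norm (r t *\<^sub>R y) \<le> r t * 1" using r[OF t] y by (simp add: mult_left_le)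
        then show "dist (X t) (x + t *\<^sub>R h + (r0 + t * s) *\<^sub>R y) \<le> r t" by (simp add: dist_norm X_def r_def)
      qed
    qed
    moreover have "ennreal (W (r b)) * ennreal \<bar>v (z b y)\<bar> \<le> ennreal (W (r a)) * ennreal \<bar>v (z a y)\<bar> + ennreal \<bar>W (r b) * v (z b y) - W (r a) * v (z a y)\<bar>"
    proof -
      have W0': "0 \<le> W (r b)" "0 \<le> W (r a)" using ab W0 r by auto
      have "\<bar>W (r b) * v (z b y)\<bar> \<le> \<bar>W (r a) * v (z a y)\<bar> + \<bar>W (r b) * v (z b y) - W (r a) * v (z a y)\<bar>" by linarith
      then have "W (r b) * \<bar>v (z b y)\<bar> \<le> W (r a) * \<bar>v (z a y)\<bar> + \<bar>W (r b) * v (z b y) - W (r a) * v (z a y)\<bar>"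
        using W0' by (simp add: abs_mult)
      then show ?thesis using W0' by (simp add: ennreal_mult[symmetric] ennreal_plus[symmetric] ennreal_leI del: ennreal_plus)
    qed
    ultimately have "ennreal (W (r b)) * ennreal \<bar>v (z b y)\<bar> \<le> ennreal (W (r a)) * ennreal \<bar>v (z a y)\<bar>
      + (\<integral>\<^sup>+t. ennreal (norm h * (C * r t powr (\<beta> - 1) * \<bar>v (z t y)\<bar> + 2 * C * r t powr \<beta> * norm (g (z t y)))) * indicator {a..b} t \<partial>lborel)"
      by (meson add_left_mono order_trans)
    then show ?thesis using True by simp
  qed simp
  have "ennreal (W (r b)) * unit_avg (\<lambda>y. ennreal \<bar>v y\<bar>) (X b) (r b) = (\<integral>\<^sup>+y. ennreal (W (r b)) * ennreal \<bar>v (z b y)\<bar> * ?B y \<partial>lborel)"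
    unfolding z_def by (subst nn_integral_cmult[symmetric]) (auto simp: mult.assoc)
  also have "\<dots> \<le> (\<integral>\<^sup>+y. ennreal (W (r a)) * ennreal \<bar>v (z a y)\<bar> * ?B y
    + (\<integral>\<^sup>+t. ennreal (norm h * (C * r t powr (\<beta> - 1) * \<bar>v (z t y)\<bar> + 2 * C * r t powr \<beta> * norm (g (z t y)))) * indicator {a..b} t * ?B y \<partial>lborel) \<partial>lborel)"
    by (intro nn_integral_mono inc)
  also have "\<dots> = (\<integral>\<^sup>+y. ennreal (W (r a)) * ennreal \<bar>v (z a y)\<bar> * ?B y \<partial>lborel)
    + (\<integral>\<^sup>+y. (\<integral>\<^sup>+t. ennreal (norm h * (C * r t powr (\<beta> - 1) * \<bar>v (z t y)\<bar> + 2 * C * r t powr \<beta> * norm (g (z t y)))) * indicator {a..b} t * ?B y \<partial>lborel) \<partial>lborel)"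
    by (rule nn_integral_add) measurable
  also have "(\<integral>\<^sup>+y. ennreal (W (r a)) * ennreal \<bar>v (z a y)\<bar> * ?B y \<partial>lborel) = ennreal (W (r a)) * unit_avg (\<lambda>y. ennreal \<bar>v y\<bar>) (X a) (r a)"
    unfolding z_def by (subst nn_integral_cmult[symmetric]) (auto simp: mult.assoc)
  also have "(\<integral>\<^sup>+y. (\<integral>\<^sup>+t. ennreal (norm h * (C * r t powr (\<beta> - 1) * \<bar>v (z t y)\<bar> + 2 * C * r t powr \<beta> * norm (g (z t y)))) * indicator {a..b} t * ?B y \<partial>lborel) \<partial>lborel)
    = (\<integral>\<^sup>+t. (\<integral>\<^sup>+y. ennreal (norm h * (C * r t powr (\<beta> - 1) * \<bar>v (z t y)\<bar> + 2 * C * r t powr \<beta> * norm (g (z t y)))) * indicator {a..b} t * ?B y \<partial>lborel) \<partial>lborel)"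
    by (rule lborel_pair.Fubini') measurable
  also have "\<dots> = (\<integral>\<^sup>+t. ennreal (norm h) * ((ennreal C * (ennreal (r t powr (\<beta> - 1)) * unit_avg (\<lambda>y. ennreal \<bar>v y\<bar>) (X t) (r t))
          + ennreal (2 * C) * (ennreal (r t powr \<beta>) * unit_avg (\<lambda>y. ennreal (norm (g y))) (X t) (r t))) * indicator {a..b} t) \<partial>lborel)"
  proof (rule nn_integral_cong)
    fix t
    have "(\<integral>\<^sup>+y. ennreal (norm h * (C * r t powr (\<beta> - 1) * \<bar>v (z t y)\<bar> + 2 * C * r t powr \<beta> * norm (g (z t y)))) * indicator {a..b} t * ?B y \<partial>lborel)
      = (\<integral>\<^sup>+y. ennreal (norm h) * indicator {a..b} t * (ennreal (C * r t powr (\<beta> - 1)) * (ennreal \<bar>v (z t y)\<bar> * ?B y) + ennreal (2 * C * r t powr \<beta>) * (ennreal (norm (g (z t y))) * ?B y)) \<partial>lborel)"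
    proof (rule nn_integral_cong)
      fix y
      have "ennreal (norm h * (C * r t powr (\<beta> - 1) * \<bar>v (z t y)\<bar> + 2 * C * r t powr \<beta> * norm (g (z t y))))
        = ennreal (norm h) * (ennreal (C * r t powr (\<beta> - 1)) * ennreal \<bar>v (z t y)\<bar> + ennreal (2 * C * r t powr \<beta>) * ennreal (norm (g (z t y))))"
        using C by (simp add: ennreal_mult[symmetric] ennreal_plus[symmetric] del: ennreal_plus)
      then show "ennreal (norm h * (C * r t powr (\<beta> - 1) * \<bar>v (z t y)\<bar> + 2 * C * r t powr \<beta> * norm (g (z t y)))) * indicator {a..b} t * ?B y
        = ennreal (norm h) * indicator {a..b} t * (ennreal (C * r t powr (\<beta> - 1)) * (ennreal \<bar>v (z t y)\<bar> * ?B y) + ennreal (2 * C * r t powr \<beta>) * (ennreal (norm (g (z t y))) * ?B y))"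
        by (auto split: split_indicator)
    qed
    also have "\<dots> = ennreal (norm h) * indicator {a..b} t * (ennreal (C * r t powr (\<beta> - 1)) * (\<integral>\<^sup>+y. ennreal \<bar>v (z t y)\<bar> * ?B y \<partial>lborel) + ennreal (2 * C * r t powr \<beta>) * (\<integral>\<^sup>+y. ennreal (norm (g (z t y))) * ?B y \<partial>lborel))"
      by (simp add: nn_integral_cmult nn_integral_add)
    also have "\<dots> = ennreal (norm h) * ((ennreal C * (ennreal (r t powr (\<beta> - 1)) * unit_avg (\<lambda>y. ennreal \<bar>v y\<bar>) (X t) (r t))
          + ennreal (2 * C) * (ennreal (r t powr \<beta>) * unit_avg (\<lambda>y. ennreal (norm (g y))) (X t) (r t))) * indicator {a..b} t)"
      using C unfolding z_def by (simp add: ennreal_mult mult.assoc split: split_indicator)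
    finally show "(\<integral>\<^sup>+y. ennreal (norm h * (C * r t powr (\<beta> - 1) * \<bar>v (z t y)\<bar> + 2 * C * r t powr \<beta> * norm (g (z t y)))) * indicator {a..b} t * ?B y \<partial>lborel) = \<dots>" .
  qed
  also have "\<dots> = ennreal (norm h) * (\<integral>\<^sup>+t. (ennreal C * (ennreal (r t powr (\<beta> - 1)) * unit_avg (\<lambda>y. ennreal \<bar>v y\<bar>) (X t) (r t))
          + ennreal (2 * C) * (ennreal (r t powr \<beta>) * unit_avg (\<lambda>y. ennreal (norm (g y))) (X t) (r t))) * indicator {a..b} t \<partial>lborel)"
    by (rule nn_integral_cmult) measurable
  finally show ?thesis .
qed

lemma powr_neg_bound:
  assumes "0 < e" "0 < \<rho>" "\<rho> \<le> r" "\<alpha> < n"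
  shows "ennreal (r powr \<alpha>) * (ennreal (r powr (- n)) * ennreal e) \<le> ennreal (\<rho> powr (\<alpha> - n) * e)"
proof -
  have "r powr (\<alpha> - n) \<le> \<rho> powr (\<alpha> - n)" using assms by (intro powr_mono2') auto
  then have "r powr (\<alpha> - n) * e \<le> \<rho> powr (\<alpha> - n) * e" using assms by (intro mult_right_mono) auto
  moreover have "r powr \<alpha> * (r powr (- n) * e) = r powr (\<alpha> - n) * e" by (simp add: powr_add[symmetric])
  ultimately show ?thesis using assms by (simp add: ennreal_mult[symmetric] ennreal_leI)
qed

text \<open>Mollifications are close to \<open>f\<close> and \<open>D\<close> only in L^1 over
  \<open>K\<close>; the lower bound \<open>\<rho>\<close> for the radii converts this into closeness
  of all averages along the segment, uniformly in \<open>t\<close>. The averages of \<open>f\<close>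
  and \<open>D\<close> are then enlarged to maximal functions at \<open>X t\<close>.\<close>

lemma sobolev_average_increment:
  fixes f :: "'a::euclidean_space \<Rightarrow> real" and D :: "'a \<Rightarrow> 'a" and x h :: 'a and r0 s a b :: real
  defines "r \<equiv> \<lambda>t. r0 + t * s" and "X \<equiv> \<lambda>t. x + t *\<^sub>R h" and "n \<equiv> real DIM('a)"
  assumes w: "is_wgrad \<Omega> f D" and K: "K \<subseteq> \<Omega>"
    and [measurable]: "f \<in> borel_measurable borel" "D \<in> borel_measurable borel" "K \<in> sets borel"
    and fi: "integrable lborel (\<lambda>y. indicator K y *\<^sub>R f y)" and Di: "integrable lborel (\<lambda>y. indicator K y *\<^sub>R D y)"
    and ab: "a \<le> b" and \<epsilon>: "0 < \<epsilon>" and sub: "\<And>t. a \<le> t \<Longrightarrow> t \<le> b \<Longrightarrow> cball (X t) (r t + \<epsilon>) \<subseteq> K"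
    and r: "0 < \<rho>" "\<And>t. a \<le> t \<Longrightarrow> t \<le> b \<Longrightarrow> \<rho> \<le> r t" and s: "\<bar>s\<bar> \<le> norm h"
    and W: "\<And>t. 0 < t \<Longrightarrow> (W has_real_derivative W' t) (at t)" "continuous_on {0<..} W'"
    and W_le: "\<And>t. 0 < t \<Longrightarrow> \<bar>W t\<bar> \<le> C * t powr \<beta>" "\<And>t. 0 < t \<Longrightarrow> \<bar>W' t\<bar> \<le> C * t powr (\<beta> - 1)"
    and W0: "\<And>t. 0 < t \<Longrightarrow> 0 \<le> W t" and C: "0 \<le> C" and \<beta>: "\<beta> < n"
  shows "ennreal (W (r b)) * unit_avg (\<lambda>y. ennreal \<bar>f y\<bar>) (X b) (r b)
    \<le> ennreal (W (r a)) * unit_avg (\<lambda>y. ennreal \<bar>f y\<bar>) (X a) (r a)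
      + ennreal (norm h) * (\<integral>\<^sup>+t. (ennreal C * fmax (\<beta> - 1) (\<lambda>y. ennreal \<bar>f y\<bar>) (X t)
          + ennreal (2 * C) * fmax \<beta> (\<lambda>y. ennreal (norm (D y))) (X t)) * indicator {a..b} t \<partial>lborel)"
proof (rule ennreal_le_epsilon)
  fix d :: real assume d: "0 < d"
  have [measurable]: "X \<in> borel_measurable borel" unfolding X_def by measurable
  define f' where "f' y = ennreal \<bar>f y\<bar>" for y
  define D' where "D' y = ennreal (norm (D y))" for y
  have [measurable]: "f' \<in> borel_measurable borel" "D' \<in> borel_measurable borel" unfolding f'_def D'_def by measurable
  define A where "A = C * \<rho> powr (\<beta> - n)"
  define B where "B = C * \<rho> powr (\<beta> - 1 - n)"
  have AB: "0 \<le> A" "0 \<le> B" unfolding A_def B_def using C by auto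
  \<comment> \<open>\<open>T * e\<close> collects all errors: \<open>A\<close> once for each end
    point, and \<open>B + 2 * A\<close> for the integrand over \<open>{a..b}\<close>.\<close>
  define T where "T = 2 * A + norm h * ((b - a) * (B + 2 * A))"
  have T: "0 \<le> T" unfolding T_def using AB ab by simp
  define e where "e = d / (T + 1)"
  have e: "0 < e" unfolding e_def using d T by simp
  have Te: "T * e \<le> d" using d T unfolding e_def by (simp add: field_simps)
  obtain v g where contv: "continuous_on UNIV v" and contg: "continuous_on UNIV g"
    and dv: "\<And>x. cball x \<epsilon> \<subseteq> K \<Longrightarrow> (v has_derivative (\<lambda>h. g x \<bullet> h)) (at x)"
    and v: "(\<integral>\<^sup>+x. ennreal (norm (v x - indicator K x *\<^sub>R f x)) \<partial>lborel) \<le> ennreal e"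
    and g: "(\<integral>\<^sup>+x. ennreal (norm (g x - indicator K x *\<^sub>R D x)) \<partial>lborel) \<le> ennreal e"
    using smooth_approximation[OF w K e \<epsilon> fi Di] by blast
  have [measurable]: "v \<in> borel_measurable borel" "g \<in> borel_measurable borel"
    using contv contg by (auto intro: borel_measurable_continuous_onI)
  have rpos: "0 < r t" if "a \<le> t" "t \<le> b" for t using r that by force
  have ball_K: "ball (X t) (r t) \<subseteq> K" if "a \<le> t" "t \<le> b" for t
    using sub[OF that] \<epsilon> by (auto simp: subset_eq)
  have vf: "(\<integral>\<^sup>+y. ennreal (norm (v y - f y)) * indicator (ball (X t) (r t)) y \<partial>lborel) \<le> ennreal e"
    and fv: "(\<integral>\<^sup>+y. ennreal (norm (f y - v y)) * indicator (ball (X t) (r t)) y \<partial>lborel) \<le> ennreal e"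
    and gD: "(\<integral>\<^sup>+y. ennreal (norm (g y - D y)) * indicator (ball (X t) (r t)) y \<partial>lborel) \<le> ennreal e"
    if t: "a \<le> t" "t \<le> b" for t
  proof -
    show vf: "(\<integral>\<^sup>+y. ennreal (norm (v y - f y)) * indicator (ball (X t) (r t)) y \<partial>lborel) \<le> ennreal e"
      using ball_K[OF t] by (intro order_trans[OF nn_integral_mono v]) (auto split: split_indicator)
    then show "(\<integral>\<^sup>+y. ennreal (norm (f y - v y)) * indicator (ball (X t) (r t)) y \<partial>lborel) \<le> ennreal e"
      by (simp add: norm_minus_commute abs_minus_commute)
    show "(\<integral>\<^sup>+y. ennreal (norm (g y - D y)) * indicator (ball (X t) (r t)) y \<partial>lborel) \<le> ennreal e"
      using ball_K[OF t] by (intro order_trans[OF nn_integral_mono g]) (auto split: split_indicator)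
  qed
  have avg_v: "unit_avg (\<lambda>y. ennreal \<bar>v y\<bar>) (X t) (r t) \<le> unit_avg f' (X t) (r t) + ennreal (r t powr (- n)) * ennreal e" if t: "a \<le> t" "t \<le> b" for t
    using unit_avg_perturb[OF _ _ rpos[OF t] vf[OF t]] unfolding f'_def n_def by simp
  have avg_f: "unit_avg f' (X t) (r t) \<le> unit_avg (\<lambda>y. ennreal \<bar>v y\<bar>) (X t) (r t) + ennreal (r t powr (- n)) * ennreal e" if t: "a \<le> t" "t \<le> b" for t
    using unit_avg_perturb[OF _ _ rpos[OF t] fv[OF t]] unfolding f'_def n_def by simp
  have avg_g: "unit_avg (\<lambda>y. ennreal (norm (g y))) (X t) (r t) \<le> unit_avg D' (X t) (r t) + ennreal (r t powr (- n)) * ennreal e" if t: "a \<le> t" "t \<le> b" for t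
    using unit_avg_perturb[OF _ _ rpos[OF t] gD[OF t]] unfolding D'_def n_def by simp
  have W_err: "ennreal (W (r t)) * (ennreal (r t powr (- n)) * ennreal e) \<le> ennreal (A * e)" if t: "a \<le> t" "t \<le> b" for t
  proof -
    have "ennreal (W (r t)) \<le> ennreal C * ennreal (r t powr \<beta>)"
      using W_le(1)[OF rpos[OF t]] C by (simp add: ennreal_mult[symmetric] ennreal_leI)
    then have "ennreal (W (r t)) * (ennreal (r t powr (- n)) * ennreal e) \<le> ennreal C * ennreal (r t powr \<beta>) * (ennreal (r t powr (- n)) * ennreal e)"
      by (rule mult_right_mono) simp
    also have "\<dots> \<le> ennreal C * ennreal (\<rho> powr (\<beta> - n) * e)"
      using powr_neg_bound[OF e r(1) r(2)[OF t] \<beta>] by (simp add: mult.assoc mult_left_mono)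
    also have "\<dots> = ennreal (A * e)" unfolding A_def using C e by (simp add: ennreal_mult[symmetric] mult.assoc)
    finally show ?thesis .
  qed
  let ?I = "\<integral>\<^sup>+t. (ennreal C * fmax (\<beta> - 1) f' (X t) + ennreal (2 * C) * fmax \<beta> D' (X t)) * indicator {a..b} t \<partial>lborel"
  have "ennreal (W (r b)) * unit_avg f' (X b) (r b)
    \<le> ennreal (W (r b)) * unit_avg (\<lambda>y. ennreal \<bar>v y\<bar>) (X b) (r b) + ennreal (W (r b)) * (ennreal (r b powr (- n)) * ennreal e)"
    using mult_left_mono[OF avg_f[OF ab order_refl], of "ennreal (W (r b))"] by (simp add: distrib_left)
  also have "\<dots> \<le> ennreal (W (r b)) * unit_avg (\<lambda>y. ennreal \<bar>v y\<bar>) (X b) (r b) + ennreal (A * e)"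
    by (intro add_left_mono W_err ab order_refl)
  also have "\<dots> \<le> (ennreal (W (r a)) * unit_avg (\<lambda>y. ennreal \<bar>v y\<bar>) (X a) (r a)
      + ennreal (norm h) * (\<integral>\<^sup>+t. (ennreal C * (ennreal (r t powr (\<beta> - 1)) * unit_avg (\<lambda>y. ennreal \<bar>v y\<bar>) (X t) (r t))
          + ennreal (2 * C) * (ennreal (r t powr \<beta>) * unit_avg (\<lambda>y. ennreal (norm (g y))) (X t) (r t))) * indicator {a..b} t \<partial>lborel)) + ennreal (A * e)"
  proof (rule add_right_mono, unfold r_def X_def, rule smooth_average_increment[OF ab contv contg _ _ s W W_le W0 C])
    fix t assume t: "a \<le> t" "t \<le> b"
    show "0 < r0 + t * s" using rpos[OF t] by (simp add: r_def)
    fix w assume "dist (x + t *\<^sub>R h) w \<le> r0 + t * s"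
    then have "dist (X t) w \<le> r t" by (simp add: X_def r_def)
    then have "cball w \<epsilon> \<subseteq> cball (X t) (r t + \<epsilon>)"
      by (intro subsetI, unfold mem_cball) (rule order_trans[OF dist_triangle[where y=w] add_mono])
    then show "(v has_derivative (\<lambda>k. g w \<bullet> k)) (at w)" using sub[OF t] by (intro dv) auto
  qed
  also have "\<dots> \<le> ((ennreal (W (r a)) * unit_avg f' (X a) (r a) + ennreal (A * e)) + ennreal (norm h) * (?I + ennreal ((B + 2 * A) * e) * ennreal (b - a))) + ennreal (A * e)"
  proof (intro add_right_mono add_mono mult_left_mono)
    have "ennreal (W (r a)) * unit_avg (\<lambda>y. ennreal \<bar>v y\<bar>) (X a) (r a)
      \<le> ennreal (W (r a)) * unit_avg f' (X a) (r a) + ennreal (W (r a)) * (ennreal (r a powr (- n)) * ennreal e)"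
      using mult_left_mono[OF avg_v[OF order_refl ab], of "ennreal (W (r a))"] by (simp add: distrib_left)
    also have "\<dots> \<le> ennreal (W (r a)) * unit_avg f' (X a) (r a) + ennreal (A * e)"
      by (intro add_left_mono W_err ab order_refl)
    finally show "ennreal (W (r a)) * unit_avg (\<lambda>y. ennreal \<bar>v y\<bar>) (X a) (r a) \<le> \<dots>" .
    have "(\<integral>\<^sup>+t. (ennreal C * (ennreal (r t powr (\<beta> - 1)) * unit_avg (\<lambda>y. ennreal \<bar>v y\<bar>) (X t) (r t))
          + ennreal (2 * C) * (ennreal (r t powr \<beta>) * unit_avg (\<lambda>y. ennreal (norm (g y))) (X t) (r t))) * indicator {a..b} t \<partial>lborel)
       \<le> (\<integral>\<^sup>+t. (ennreal C * fmax (\<beta> - 1) f' (X t) + ennreal (2 * C) * fmax \<beta> D' (X t)) * indicator {a..b} t + ennreal ((B + 2 * A) * e) * indicator {a..b} t \<partial>lborel)"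
    proof (rule nn_integral_mono)
      fix t
      show "(ennreal C * (ennreal (r t powr (\<beta> - 1)) * unit_avg (\<lambda>y. ennreal \<bar>v y\<bar>) (X t) (r t))
          + ennreal (2 * C) * (ennreal (r t powr \<beta>) * unit_avg (\<lambda>y. ennreal (norm (g y))) (X t) (r t))) * indicator {a..b} t
        \<le> (ennreal C * fmax (\<beta> - 1) f' (X t) + ennreal (2 * C) * fmax \<beta> D' (X t)) * indicator {a..b} t + ennreal ((B + 2 * A) * e) * indicator {a..b} t"
      proof (cases "t \<in> {a..b}")
        case True
        then have t: "a \<le> t" "t \<le> b" by auto
        have 1: "ennreal (r t powr (\<beta> - 1)) * unit_avg (\<lambda>y. ennreal \<bar>v y\<bar>) (X t) (r t) \<le> fmax (\<beta> - 1) f' (X t) + ennreal (\<rho> powr (\<beta> - 1 - n) * e)"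
        proof -
          have "ennreal (r t powr (\<beta> - 1)) * unit_avg (\<lambda>y. ennreal \<bar>v y\<bar>) (X t) (r t)
            \<le> ennreal (r t powr (\<beta> - 1)) * unit_avg f' (X t) (r t) + ennreal (r t powr (\<beta> - 1)) * (ennreal (r t powr (- n)) * ennreal e)"
            using mult_left_mono[OF avg_v[OF t], of "ennreal (r t powr (\<beta> - 1))"] by (simp add: distrib_left)
          also have "\<dots> \<le> fmax (\<beta> - 1) f' (X t) + ennreal (\<rho> powr (\<beta> - 1 - n) * e)"
            using \<beta> by (intro add_mono unit_avg_le_fmax powr_neg_bound e r(1) r(2)[OF t] rpos[OF t]) auto
          finally show ?thesis .
        qed
        have 2: "ennreal (r t powr \<beta>) * unit_avg (\<lambda>y. ennreal (norm (g y))) (X t) (r t) \<le> fmax \<beta> D' (X t) + ennreal (\<rho> powr (\<beta> - n) * e)"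
        proof -
          have "ennreal (r t powr \<beta>) * unit_avg (\<lambda>y. ennreal (norm (g y))) (X t) (r t)
            \<le> ennreal (r t powr \<beta>) * unit_avg D' (X t) (r t) + ennreal (r t powr \<beta>) * (ennreal (r t powr (- n)) * ennreal e)"
            using mult_left_mono[OF avg_g[OF t], of "ennreal (r t powr \<beta>)"] by (simp add: distrib_left)
          also have "\<dots> \<le> fmax \<beta> D' (X t) + ennreal (\<rho> powr (\<beta> - n) * e)"
            using \<beta> by (intro add_mono unit_avg_le_fmax powr_neg_bound e r(1) r(2)[OF t] rpos[OF t]) auto
          finally show ?thesis .
        qed
        have "ennreal C * (ennreal (r t powr (\<beta> - 1)) * unit_avg (\<lambda>y. ennreal \<bar>v y\<bar>) (X t) (r t))
          + ennreal (2 * C) * (ennreal (r t powr \<beta>) * unit_avg (\<lambda>y. ennreal (norm (g y))) (X t) (r t))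
          \<le> ennreal C * (fmax (\<beta> - 1) f' (X t) + ennreal (\<rho> powr (\<beta> - 1 - n) * e)) + ennreal (2 * C) * (fmax \<beta> D' (X t) + ennreal (\<rho> powr (\<beta> - n) * e))"
          by (intro add_mono mult_left_mono 1 2) auto
        also have "\<dots> = ennreal C * fmax (\<beta> - 1) f' (X t) + ennreal (2 * C) * fmax \<beta> D' (X t) + (ennreal C * ennreal (\<rho> powr (\<beta> - 1 - n) * e) + ennreal (2 * C) * ennreal (\<rho> powr (\<beta> - n) * e))"
          by (simp only: distrib_left add_ac)
        also have "ennreal C * ennreal (\<rho> powr (\<beta> - 1 - n) * e) + ennreal (2 * C) * ennreal (\<rho> powr (\<beta> - n) * e) = ennreal ((B + 2 * A) * e)"
          unfolding A_def B_def using C e by (simp add: ennreal_mult[symmetric] ennreal_plus[symmetric] algebra_simps del: ennreal_plus)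
        finally show ?thesis using True by simp
      qed simp
    qed
    also have "\<dots> = ?I + (\<integral>\<^sup>+t. ennreal ((B + 2 * A) * e) * indicator {a..b} t \<partial>lborel)"
      by (rule nn_integral_add) measurable
    also have "(\<integral>\<^sup>+t. ennreal ((B + 2 * A) * e) * indicator {a..b} t \<partial>lborel) = ennreal ((B + 2 * A) * e) * ennreal (b - a)"
      using ab by (subst nn_integral_cmult_indicator) auto
    finally show "(\<integral>\<^sup>+t. (ennreal C * (ennreal (r t powr (\<beta> - 1)) * unit_avg (\<lambda>y. ennreal \<bar>v y\<bar>) (X t) (r t))
          + ennreal (2 * C) * (ennreal (r t powr \<beta>) * unit_avg (\<lambda>y. ennreal (norm (g y))) (X t) (r t))) * indicator {a..b} t \<partial>lborel)
       \<le> ?I + ennreal ((B + 2 * A) * e) * ennreal (b - a)" .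
  qed simp
  also have "\<dots> = (ennreal (W (r a)) * unit_avg f' (X a) (r a) + ennreal (norm h) * ?I) + (ennreal (A * e) + ennreal (A * e) + ennreal (norm h) * (ennreal ((B + 2 * A) * e) * ennreal (b - a)))"
    by (simp only: distrib_left add_ac)
  also have "ennreal (A * e) + ennreal (A * e) + ennreal (norm h) * (ennreal ((B + 2 * A) * e) * ennreal (b - a)) = ennreal (T * e)"
  proof -
    have "ennreal p + ennreal p + ennreal H * (ennreal q * ennreal l) = ennreal (p + p + H * (q * l))"
      if "0 \<le> p" "0 \<le> q" "0 \<le> l" "0 \<le> H" for p q l H
      using that by (simp add: ennreal_mult[symmetric] ennreal_plus[symmetric] del: ennreal_plus)
    from this[of "A * e" "(B + 2 * A) * e" "b - a" "norm h"]
    show ?thesis using AB e ab by (simp add: T_def algebra_simps)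
  qed
  also have "(ennreal (W (r a)) * unit_avg f' (X a) (r a) + ennreal (norm h) * ?I) + ennreal (T * e)
    \<le> (ennreal (W (r a)) * unit_avg f' (X a) (r a) + ennreal (norm h) * ?I) + ennreal d"
    using Te by (intro add_left_mono ennreal_leI)
  finally show "ennreal (W (r b)) * unit_avg (\<lambda>y. ennreal \<bar>f y\<bar>) (X b) (r b)
    \<le> ennreal (W (r a)) * unit_avg (\<lambda>y. ennreal \<bar>f y\<bar>) (X a) (r a)
      + ennreal (norm h) * (\<integral>\<^sup>+t. (ennreal C * fmax (\<beta> - 1) (\<lambda>y. ennreal \<bar>f y\<bar>) (X t)
          + ennreal (2 * C) * fmax \<beta> (\<lambda>y. ennreal (norm (D y))) (X t)) * indicator {a..b} t \<partial>lborel) + ennreal d"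
    unfolding f'_def D'_def .
qed

text \<open>The radius is a fixed fraction, less than 1, of the distance to the complement, and that
  distance is 1-Lipschitz. On the whole space a constant radius will do.\<close>

lemma admissible_radius_function:
  fixes x :: "'a::euclidean_space"
  assumes "open \<Omega>" "x \<in> \<Omega>" "r \<in> admissible_radii \<Omega> x"
  obtains \<rho> where "\<rho> x = r" "\<And>z. z \<in> \<Omega> \<Longrightarrow> \<rho> z \<in> admissible_radii \<Omega> z" "\<And>z w. \<bar>\<rho> z - \<rho> w\<bar> \<le> dist z w"
proof (cases "\<Omega> = UNIV")
  case True
  then show thesis using assms by (intro that[of "\<lambda>_. r"]) (auto simp: admissible_radii_def)
next
  case False
  define \<delta> where "\<delta> z = infdist z (- \<Omega>)" for z
  have pos: "0 < \<delta> z" if "z \<in> \<Omega>" for z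
    unfolding \<delta>_def using False assms(1) that by (intro infdist_pos_not_in_closed) auto
  have r: "0 < r" "r < \<delta> x" using assms False by (auto simp: admissible_radii_def \<delta>_def)
  have q: "0 < r / \<delta> x" "r / \<delta> x < 1" using r pos[OF assms(2)] by auto
  show thesis
  proof (rule that[of "\<lambda>z. r / \<delta> x * \<delta> z"])
    show "r / \<delta> x * \<delta> x = r" using pos[OF assms(2)] by simp
    show "r / \<delta> x * \<delta> z \<in> admissible_radii \<Omega> z" if "z \<in> \<Omega>" for z
    proof -
      have "r / \<delta> x * \<delta> z < 1 * \<delta> z" using q pos[OF that] by (intro mult_strict_right_mono)
      moreover have "0 < r / \<delta> x * \<delta> z" using q pos[OF that] by (intro mult_pos_pos)
      ultimately show ?thesis by (simp add: admissible_radii_def \<delta>_def)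
    qed
    fix z w
    have "\<bar>r / \<delta> x * \<delta> z - r / \<delta> x * \<delta> w\<bar> = r / \<delta> x * \<bar>\<delta> z - \<delta> w\<bar>"
      using q(1) by (simp only: right_diff_distrib[symmetric] abs_mult)
    also have "\<dots> \<le> 1 * dist z w"
      unfolding \<delta>_def using q unfolding \<delta>_def by (intro mult_mono infdist_triangle_abs) auto
    finally show "\<bar>r / \<delta> x * \<delta> z - r / \<delta> x * \<delta> w\<bar> \<le> dist z w" by simp
  qed
qed

text \<open>Three portions of \<open>e\<close> are provided: for moving the centre, for changing the
  radius, and for the margin around the ball that mollification requires.\<close>

lemma admissible_radii_margin:
  fixes x :: "'a::euclidean_space"
  assumes "r \<in> admissible_radii \<Omega> x"
  obtains e where "0 < e" "cball x (r + 3 * e) \<subseteq> \<Omega>"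
proof (cases "\<Omega> = UNIV")
  case True
  then show thesis using that[of 1] by simp
next
  case False
  define e where "e = (infdist x (- \<Omega>) - r) / 4"
  have r: "0 < r" "r < infdist x (- \<Omega>)" using assms False by (auto simp: admissible_radii_def)
  then have e: "0 < e" by (simp add: e_def)
  show thesis
  proof (rule that[OF e] , rule subsetI)
    fix y assume y: "y \<in> cball x (r + 3 * e)"
    show "y \<in> \<Omega>"
    proof (rule ccontr)
      assume "y \<notin> \<Omega>"
      then have "infdist x (- \<Omega>) \<le> dist x y" by (intro infdist_le) auto
      moreover have "4 * e = infdist x (- \<Omega>) - r" by (simp add: e_def)
      moreover have "dist x y \<le> r + 3 * e" using y by simp
      ultimately show False using e by linarith
    qed
  qed
qed

definition wmax :: "(real \<Rightarrow> real) \<Rightarrow> 'a::euclidean_space set \<Rightarrow> ('a \<Rightarrow> ennreal) \<Rightarrow> 'a \<Rightarrow> ennreal" where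
  "wmax W \<Omega> f x = (SUP r\<in>admissible_radii \<Omega> x. ennreal (W r) * unit_avg f x r)"

text \<open>The first term comes from differentiating the weight, the second from moving the ball.
  Both maximal functions are global, although the averages they dominate stay inside
  \<open>\<Omega>\<close>.\<close>

definition grad_bound :: "real \<Rightarrow> real \<Rightarrow> ('a::euclidean_space \<Rightarrow> real) \<Rightarrow> ('a \<Rightarrow> 'a) \<Rightarrow> 'a \<Rightarrow> ennreal" where
  "grad_bound C \<beta> f D x = ennreal C * fmax (\<beta> - 1) (\<lambda>y. ennreal \<bar>f y\<bar>) x + ennreal (2 * C) * fmax \<beta> (\<lambda>y. ennreal (norm (D y))) x"

lemma grad_bound_measurable [measurable]:
  assumes [measurable]: "f \<in> borel_measurable borel" "D \<in> borel_measurable borel"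
  shows "grad_bound C \<beta> f D \<in> borel_measurable borel"
proof -
  have [measurable]: "fmax (\<beta> - 1) (\<lambda>y. ennreal \<bar>f y\<bar>) \<in> borel_measurable borel"
      "fmax \<beta> (\<lambda>y. ennreal (norm (D y))) \<in> borel_measurable borel"
    by (rule fmax_measurable, measurable)+
  show ?thesis unfolding grad_bound_def[abs_def] by measurable
qed

text \<open>The radius moves along a 1-Lipschitz function \<open>\<rho>\<close>; on short subsegments it is replaced by its linear
  interpolation, which stays admissible.\<close>

lemma wmax_segment:
  fixes f :: "'a::euclidean_space \<Rightarrow> real" and D :: "'a \<Rightarrow> 'a" and x h :: 'a
  assumes \<Omega>: "open \<Omega>" and w: "is_wgrad \<Omega> f D"
    and [measurable]: "f \<in> borel_measurable borel" "D \<in> borel_measurable borel"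
    and fi: "\<And>K. compact K \<Longrightarrow> K \<subseteq> \<Omega> \<Longrightarrow> integrable lborel (\<lambda>y. indicator K y *\<^sub>R f y)"
    and Di: "\<And>K. compact K \<Longrightarrow> K \<subseteq> \<Omega> \<Longrightarrow> integrable lborel (\<lambda>y. indicator K y *\<^sub>R D y)"
    and seg: "\<And>t. 0 \<le> t \<Longrightarrow> t \<le> 1 \<Longrightarrow> x + t *\<^sub>R h \<in> \<Omega>"
    and W: "\<And>t. 0 < t \<Longrightarrow> (W has_real_derivative W' t) (at t)" "continuous_on {0<..} W'"
    and W_le: "\<And>t. 0 < t \<Longrightarrow> \<bar>W t\<bar> \<le> C * t powr \<beta>" "\<And>t. 0 < t \<Longrightarrow> \<bar>W' t\<bar> \<le> C * t powr (\<beta> - 1)"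
    and W0: "\<And>t. 0 < t \<Longrightarrow> 0 \<le> W t" and C: "0 \<le> C" and \<beta>: "\<beta> < real DIM('a)"
  shows "wmax W \<Omega> (\<lambda>y. ennreal \<bar>f y\<bar>) (x + h)
    \<le> wmax W \<Omega> (\<lambda>y. ennreal \<bar>f y\<bar>) x + ennreal (norm h) * (\<integral>\<^sup>+t. grad_bound C \<beta> f D (x + t *\<^sub>R h) * indicator {0..1} t \<partial>lborel)"
  unfolding wmax_def[of _ _ _ "x + h"]
proof (rule SUP_least)
  fix r' assume r': "r' \<in> admissible_radii \<Omega> (x + h)"
  have xh: "x + h \<in> \<Omega>" using seg[of 1] by simp
  obtain \<rho> where \<rho>: "\<rho> (x + h) = r'" "\<And>z. z \<in> \<Omega> \<Longrightarrow> \<rho> z \<in> admissible_radii \<Omega> z" "\<And>z w. \<bar>\<rho> z - \<rho> w\<bar> \<le> dist z w"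
    using admissible_radius_function[OF \<Omega> xh r'] by blast
  define X where "X t = x + t *\<^sub>R h" for t
  have [measurable]: "X \<in> borel_measurable borel" unfolding X_def by measurable
  define \<Phi> where "\<Phi> t = ennreal (W (\<rho> (X t))) * unit_avg (\<lambda>y. ennreal \<bar>f y\<bar>) (X t) (\<rho> (X t))" for t
  define J where "J a b = (\<integral>\<^sup>+t. grad_bound C \<beta> f D (X t) * indicator {a..b} t \<partial>lborel)" for a b
  have distX: "dist (X s) (X t) = \<bar>s - t\<bar> * norm h" for s t
    by (simp add: X_def dist_norm scaleR_left_diff_distrib[symmetric])
  define P where "P a b \<longleftrightarrow> (0 \<le> a \<and> b \<le> 1 \<longrightarrow> \<Phi> b \<le> \<Phi> a + ennreal (norm h) * J a b)" for a b
  \<comment> \<open>Compactness of the unit interval in the form of a bisection argument: the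
    inequality is additive over adjacent intervals, so short intervals around each point
    suffice.\<close>
  have "P 0 1"
  proof (rule Bolzano)
    show "(0::real) \<le> 1" by simp
  next
    fix a b c assume P: "P a b" "P b c" and abc: "a \<le> b" "b \<le> c"
    have J: "J a b + J b c = J a c"
    proof -
      have "J a b + J b c = (\<integral>\<^sup>+t. grad_bound C \<beta> f D (X t) * indicator {a..b} t + grad_bound C \<beta> f D (X t) * indicator {b..c} t \<partial>lborel)"
        unfolding J_def by (rule nn_integral_add[symmetric]) measurable
      also have "\<dots> = J a c"
        unfolding J_def
      proof (rule nn_integral_cong_AE)
        show "AE t in lborel. grad_bound C \<beta> f D (X t) * indicator {a..b} t + grad_bound C \<beta> f D (X t) * indicator {b..c} t = grad_bound C \<beta> f D (X t) * indicator {a..c} t"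
          using AE_lborel_singleton[of b] by eventually_elim (use abc in \<open>auto split: split_indicator\<close>)
      qed
      finally show ?thesis .
    qed
    show "P a c"
      unfolding P_def
    proof
      assume ac: "0 \<le> a \<and> c \<le> 1"
      then have "\<Phi> b \<le> \<Phi> a + ennreal (norm h) * J a b" "\<Phi> c \<le> \<Phi> b + ennreal (norm h) * J b c"
        using P abc by (auto simp: P_def)
      then have "\<Phi> c \<le> \<Phi> a + ennreal (norm h) * J a b + ennreal (norm h) * J b c"
        by (meson add_right_mono order_trans)
      then show "\<Phi> c \<le> \<Phi> a + ennreal (norm h) * J a c"
        unfolding J[symmetric] by (simp add: distrib_left add.assoc)
    qed
  next
    fix t0 :: real assume t0: "0 \<le> t0" "t0 \<le> 1"
    have X0: "X t0 \<in> \<Omega>" using seg[OF t0] by (simp add: X_def)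
    define r0 where "r0 = \<rho> (X t0)"
    have adm: "r0 \<in> admissible_radii \<Omega> (X t0)" unfolding r0_def by (rule \<rho>(2)[OF X0])
    then have r0: "0 < r0" by (simp add: admissible_radii_def)
    obtain e where e: "0 < e" "cball (X t0) (r0 + 3 * e) \<subseteq> \<Omega>"
      using admissible_radii_margin[OF adm] by blast
    \<comment> \<open>The bound \<open>m \<le> e\<close> keeps the balls and their margins within
      \<open>K\<close>, and \<open>m \<le> r0 / 2\<close> keeps the radii above
      \<open>r0 / 2\<close>; on an interval of length less than \<open>d\<close> the centre and the
      radius each change by at most \<open>m\<close>.\<close>
    define m where "m = min e (r0 / 2)"
    have m: "0 < m" "m \<le> e" "m \<le> r0 / 2" unfolding m_def using e r0 by auto
    define d where "d = m / (norm h + 1)"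
    have nh: "0 < norm h + 1" by (simp add: add_nonneg_pos)
    have d: "0 < d" unfolding d_def using m nh by simp
    show "\<exists>d>0. \<forall>a b. a \<le> t0 \<and> t0 \<le> b \<and> b - a < d \<longrightarrow> P a b"
    proof (intro exI[of _ d] conjI allI impI d)
      fix a b :: real assume ab: "a \<le> t0 \<and> t0 \<le> b \<and> b - a < d"
      show "P a b"
      proof (cases "a = b")
        case True
        then show ?thesis by (simp add: P_def)
      next
        case False
        then have ab': "a < b" using ab by auto
        \<comment> \<open>\<open>c + t * s\<close> interpolates \<open>\<rho> (X t)\<close> linearly
          between \<open>a\<close> and \<open>b\<close>, with the same values at both ends; its
          slope inherits the Lipschitz bound \<open>norm h\<close>.\<close>
        define s where "s = (\<rho> (X b) - \<rho> (X a)) / (b - a)"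
        define c where "c = \<rho> (X a) - a * s"
        have ra: "c + a * s = \<rho> (X a)" by (simp add: c_def)
        have rb: "c + b * s = \<rho> (X b)"
        proof -
          have "c + b * s = \<rho> (X a) + (b - a) * s" by (simp add: c_def algebra_simps)
          then show ?thesis using ab' by (simp add: s_def)
        qed
        have s: "\<bar>s\<bar> \<le> norm h"
        proof -
          have "\<bar>\<rho> (X b) - \<rho> (X a)\<bar> \<le> (b - a) * norm h" using \<rho>(3)[of "X b" "X a"] distX[of b a] ab' by simp
          then show ?thesis unfolding s_def using ab' by (simp add: abs_divide field_simps)
        qed
        have small: "\<bar>t - t0\<bar> * norm h \<le> m" if "a \<le> t" "t \<le> b" for t
        proof -
          have "\<bar>t - t0\<bar> * norm h \<le> d * (norm h + 1)" using that ab d by (intro mult_mono) auto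
          also have "\<dots> = m" using nh by (simp add: d_def)
          finally show ?thesis .
        qed
        have \<rho>near: "\<bar>\<rho> (X t) - r0\<bar> \<le> m" if "a \<le> t" "t \<le> b" for t
          using \<rho>(3)[of "X t" "X t0"] small[OF that] distX[of t t0] unfolding r0_def by simp
        have between: "r0 - m \<le> c + t * s \<and> c + t * s \<le> r0 + m" if t: "a \<le> t" "t \<le> b" for t
        proof -
          have e1: "c + a * s \<le> r0 + m" "r0 - m \<le> c + a * s" "c + b * s \<le> r0 + m" "r0 - m \<le> c + b * s"
            unfolding ra rb using \<rho>near[of a] \<rho>near[of b] ab' by auto
          show ?thesis
          proof (cases "0 \<le> s")
            case True
            then have "a * s \<le> t * s" "t * s \<le> b * s" using t by (auto intro: mult_right_mono)
            then show ?thesis using e1 by linarith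
          next
            case False
            then have "b * s \<le> t * s" "t * s \<le> a * s" using t by (auto intro: mult_right_mono_neg)
            then show ?thesis using e1 by linarith
          qed
        qed
        define K where "K = cball (X t0) (r0 + 3 * e)"
        have K: "compact K" "K \<subseteq> \<Omega>" unfolding K_def using e by auto
        have "ennreal (W (c + b * s)) * unit_avg (\<lambda>y. ennreal \<bar>f y\<bar>) (x + b *\<^sub>R h) (c + b * s)
          \<le> ennreal (W (c + a * s)) * unit_avg (\<lambda>y. ennreal \<bar>f y\<bar>) (x + a *\<^sub>R h) (c + a * s)
            + ennreal (norm h) * (\<integral>\<^sup>+t. (ennreal C * fmax (\<beta> - 1) (\<lambda>y. ennreal \<bar>f y\<bar>) (x + t *\<^sub>R h)
             + ennreal (2 * C) * fmax \<beta> (\<lambda>y. ennreal (norm (D y))) (x + t *\<^sub>R h)) * indicator {a..b} t \<partial>lborel)"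
        proof (rule sobolev_average_increment[OF w K(2) _ _ _ fi[OF K] Di[OF K] less_imp_le[OF ab'] e(1) _ _ _ s W W_le W0 C \<beta>])
          show "0 < r0 / 2" using r0 by simp
          fix t assume t: "a \<le> t" "t \<le> b"
          show "r0 / 2 \<le> c + t * s" using between[OF t] m by linarith
          show "cball (x + t *\<^sub>R h) (c + t * s + e) \<subseteq> K"
          proof
            fix y assume y: "y \<in> cball (x + t *\<^sub>R h) (c + t * s + e)"
            have "dist (X t0) y \<le> dist (X t0) (X t) + dist (X t) y" by (rule dist_triangle)
            also have "\<dots> \<le> m + (r0 + m + e)"
              using y between[OF t] small[OF t] distX[of t0 t] by (auto simp: X_def abs_minus_commute)
            also have "\<dots> \<le> r0 + 3 * e" using m by linarith
            finally show "y \<in> K" by (simp add: K_def)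
          qed
        qed (use K in \<open>auto simp: K_def\<close>)
        then have "\<Phi> b \<le> \<Phi> a + ennreal (norm h) * J a b"
          unfolding ra rb \<Phi>_def J_def grad_bound_def X_def[symmetric] .
        then show ?thesis by (simp add: P_def)
      qed
    qed
  qed
  then have "\<Phi> 1 \<le> \<Phi> 0 + ennreal (norm h) * J 0 1" by (simp add: P_def)
  moreover have "\<Phi> 1 = ennreal (W r') * unit_avg (\<lambda>y. ennreal \<bar>f y\<bar>) (x + h) r'"
    unfolding \<Phi>_def X_def using \<rho>(1) by simp
  moreover have "\<Phi> 0 \<le> wmax W \<Omega> (\<lambda>y. ennreal \<bar>f y\<bar>) x"
  proof -
    have "\<Phi> 0 = ennreal (W (\<rho> x)) * unit_avg (\<lambda>y. ennreal \<bar>f y\<bar>) x (\<rho> x)" by (simp add: \<Phi>_def X_def)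
    moreover have "\<rho> x \<in> admissible_radii \<Omega> x" using \<rho>(2)[of x] seg[of 0] by simp
    ultimately show ?thesis unfolding wmax_def 
      using SUP_upper[of "\<rho> x" "admissible_radii \<Omega> x" "\<lambda>r. ennreal (W r) * unit_avg (\<lambda>y. ennreal \<bar>f y\<bar>) x r"] by simp
  qed
  ultimately show "ennreal (W r') * unit_avg (\<lambda>y. ennreal \<bar>f y\<bar>) (x + h) r'
    \<le> wmax W \<Omega> (\<lambda>y. ennreal \<bar>f y\<bar>) x + ennreal (norm h) * (\<integral>\<^sup>+t. grad_bound C \<beta> f D (x + t *\<^sub>R h) * indicator {0..1} t \<partial>lborel)"
    unfolding J_def X_def by (metis add_right_mono order_trans)
qed

section \<open>Weak limits by convex combinations\<close>

inductive mid_comb :: "(nat \<Rightarrow> 'a \<Rightarrow> real) \<Rightarrow> nat \<Rightarrow> ('a \<Rightarrow> real) \<Rightarrow> bool" for h k where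
  base: "k \<le> j \<Longrightarrow> mid_comb h k (h j)"
| mid: "mid_comb h k v \<Longrightarrow> mid_comb h k w \<Longrightarrow> mid_comb h k (\<lambda>x. (v x + w x) / 2)"

lemma mid_comb_antimono: "mid_comb h l v \<Longrightarrow> k \<le> l \<Longrightarrow> mid_comb h k v"
  by (induction rule: mid_comb.induct) (auto intro: mid_comb.intros)

lemma mid_comb_measurable: "mid_comb h k v \<Longrightarrow> (\<And>j. h j \<in> borel_measurable M) \<Longrightarrow> v \<in> borel_measurable M"
proof (induction rule: mid_comb.induct)
  case (mid v w)
  then have [measurable]: "v \<in> borel_measurable M" "w \<in> borel_measurable M" by auto
  show ?case by measurable
qed simp

lemma abs_midpoint_le: "\<bar>a\<bar> \<le> c \<Longrightarrow> \<bar>b\<bar> \<le> c \<Longrightarrow> \<bar>(a + b) / 2\<bar> \<le> (c::real)"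
  using abs_triangle_ineq[of a b] by simp

lemma mid_comb_bound: "mid_comb h k v \<Longrightarrow> (\<And>j x. \<bar>h j x\<bar> \<le> H x) \<Longrightarrow> \<bar>v x\<bar> \<le> H x"
proof (induction rule: mid_comb.induct)
  case (mid v w)
  then have "\<bar>v x\<bar> \<le> H x" "\<bar>w x\<bar> \<le> H x" by auto
  then show ?case by (intro abs_midpoint_le)
qed simp

text \<open>Integration against \<open>\<psi>\<close> is linear and the distance to \<open>L\<close>
  is convex, so a bound valid for the tail passes to midpoints.\<close>

lemma mid_comb_integral:
  assumes "mid_comb h k v" "\<And>j. h j \<in> borel_measurable M" "\<And>j x. \<bar>h j x\<bar> \<le> H x"
    and [measurable]: "\<psi> \<in> borel_measurable M" and i: "integrable M (\<lambda>x. H x * \<psi> x)"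
    and L: "\<And>j. k \<le> j \<Longrightarrow> \<bar>(\<integral>x. h j x * \<psi> x \<partial>M) - L\<bar> \<le> e"
  shows "\<bar>(\<integral>x. v x * \<psi> x \<partial>M) - L\<bar> \<le> e"
  using assms(1)
proof (induction rule: mid_comb.induct)
  case (mid v w)
  have int: "integrable M (\<lambda>x. u x * \<psi> x)" if "mid_comb h k u" for u
  proof (rule Bochner_Integration.integrable_bound[OF i])
    have [measurable]: "u \<in> borel_measurable M" using mid_comb_measurable[OF that assms(2)] .
    show "(\<lambda>x. u x * \<psi> x) \<in> borel_measurable M" by measurable
    show "AE x in M. norm (u x * \<psi> x) \<le> norm (H x * \<psi> x)"
      using mid_comb_bound[OF that assms(3)] by (intro AE_I2) (auto simp: abs_mult intro!: mult_right_mono intro: order_trans[OF _ abs_ge_self])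
  qed
  have "(\<integral>x. (v x + w x) / 2 * \<psi> x \<partial>M) = (\<integral>x. (v x * \<psi> x + w x * \<psi> x) / 2 \<partial>M)"
    by (intro Bochner_Integration.integral_cong) (auto simp: field_simps)
  also have "\<dots> = ((\<integral>x. v x * \<psi> x \<partial>M) + (\<integral>x. w x * \<psi> x \<partial>M)) / 2"
    using int[OF mid(1)] int[OF mid(2)] by simp
  finally have "(\<integral>x. (v x + w x) / 2 * \<psi> x \<partial>M) - L = (((\<integral>x. v x * \<psi> x \<partial>M) - L) + ((\<integral>x. w x * \<psi> x \<partial>M) - L)) / 2"
    by (simp only: diff_divide_distrib add_divide_distrib)
  then show ?case using abs_midpoint_le[OF mid.IH] by metis
qed (rule L)

text \<open>Weak compactness without duality: near-minimisers of a weighted \<open>L\<^sup>2\<close> norm over convex combinations of the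
  tails form a Cauchy sequence, by the parallelogram law; midpoints are the only combinations needed.\<close>

lemma mid_comb_AE_convergent:
  fixes h :: "nat \<Rightarrow> 'a \<Rightarrow> real" and H w :: "'a \<Rightarrow> real"
  assumes hm: "\<And>j. h j \<in> borel_measurable M" and hH: "\<And>j x. \<bar>h j x\<bar> \<le> H x"
    and [measurable]: "H \<in> borel_measurable M" "w \<in> borel_measurable M"
    and wpos: "\<And>x. 0 < w x" and wi: "integrable M w" and Hw: "integrable M (\<lambda>x. (H x)\<^sup>2 * w x)"
  obtains v where "\<And>m. mid_comb h m (v m)" "AE x in M. convergent (\<lambda>m. v m x)"
proof -
  define Q where "Q v = (\<integral>x. (v x)\<^sup>2 * w x \<partial>M)" for v
  have int: "integrable M (\<lambda>x. u x * v x * w x)" if "mid_comb h 0 u" "mid_comb h 0 v" for u v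
  proof (rule Bochner_Integration.integrable_bound[OF Hw])
    have [measurable]: "u \<in> borel_measurable M" "v \<in> borel_measurable M" using mid_comb_measurable that hm by blast+
    show "(\<lambda>x. u x * v x * w x) \<in> borel_measurable M" by measurable
    show "AE x in M. norm (u x * v x * w x) \<le> norm ((H x)\<^sup>2 * w x)"
    proof (rule AE_I2)
      fix x
      have "\<bar>u x\<bar> * \<bar>v x\<bar> \<le> H x * H x"
        using mid_comb_bound[OF that(1) hH] mid_comb_bound[OF that(2) hH] by (intro mult_mono) (auto intro: order_trans[OF abs_ge_zero])
      then show "norm (u x * v x * w x) \<le> norm ((H x)\<^sup>2 * w x)"
        using wpos[of x] by (simp add: abs_mult power2_eq_square mult_right_mono)
    qed
  qed
  have Q0: "0 \<le> Q v" for v unfolding Q_def using wpos by (intro integral_nonneg_AE AE_I2) (simp add: less_imp_le)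
  have to0: "mid_comb h 0 v" if "mid_comb h k v" for k v using mid_comb_antimono[OF that] by simp
  have QH: "Q v \<le> (\<integral>x. (H x)\<^sup>2 * w x \<partial>M)" if "mid_comb h 0 v" for v
    unfolding Q_def
  proof (rule integral_mono[OF _ Hw])
    show "integrable M (\<lambda>x. (v x)\<^sup>2 * w x)" using int[OF that that] by (simp add: power2_eq_square)
    fix x
    have "(v x)\<^sup>2 \<le> (H x)\<^sup>2" using mid_comb_bound[OF that hH] by (metis abs_le_square_iff abs_ge_self order_trans)
    then show "(v x)\<^sup>2 * w x \<le> (H x)\<^sup>2 * w x" using wpos[of x] by (intro mult_right_mono) auto
  qed
  have par: "Q (\<lambda>x. u x - v x) = 2 * Q u + 2 * Q v - 4 * Q (\<lambda>x. (u x + v x) / 2)" if "mid_comb h 0 u" "mid_comb h 0 v" for u v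
  proof -
    note i = int[OF that(1) that(1)] int[OF that(1) that(2)] int[OF that(2) that(2)]
    have 1: "Q (\<lambda>x. u x - v x) = (\<integral>x. u x * u x * w x - 2 * (u x * v x * w x) + v x * v x * w x \<partial>M)"
      unfolding Q_def by (intro Bochner_Integration.integral_cong) (auto simp: power2_eq_square algebra_simps)
    have 2: "4 * Q (\<lambda>x. (u x + v x) / 2) = (\<integral>x. u x * u x * w x + 2 * (u x * v x * w x) + v x * v x * w x \<partial>M)"
      unfolding Q_def by (subst integral_mult_right_zero[symmetric], intro Bochner_Integration.integral_cong) (auto simp: power2_eq_square field_simps)
    show ?thesis unfolding 1 2 using i by (simp add: Q_def power2_eq_square)
  qed
  \<comment> \<open>The sets of combinations shrink as \<open>k\<close> grows, so their infima
    increase; the weighted square integral of \<open>H\<close> bounds them.\<close>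
  define d where "d k = (INF v\<in>{v. mid_comb h k v}. Q v)" for k
  have bdd: "bdd_below (Q ` A)" for A using Q0 by (intro bdd_belowI2[of _ 0]) auto
  have ne: "{v. mid_comb h k v} \<noteq> {}" for k using mid_comb.base[of k k h] by auto
  have d_le: "d k \<le> Q v" if "mid_comb h k v" for k v
    unfolding d_def using that by (intro cINF_lower bdd) auto
  have d_mono: "d k \<le> d l" if "k \<le> l" for k l
    unfolding d_def[of l] using that by (intro cINF_greatest[OF ne] d_le) (auto intro: mid_comb_antimono)
  have d_bound: "d k \<le> (\<integral>x. (H x)\<^sup>2 * w x \<partial>M)" for k
    using d_le[OF mid_comb.base[of k k h]] QH[OF to0[OF mid_comb.base[of k k h]]] by simp
  obtain D where D: "d \<longlonglongrightarrow> D" "\<And>k. d k \<le> D"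
    using incseq_convergent[of d "\<integral>x. (H x)\<^sup>2 * w x \<partial>M"] d_mono d_bound by (auto simp: incseq_def)
  have "\<exists>k\<ge>m. D - (1/4) ^ m < d k" for m
  proof -
    have "eventually (\<lambda>k. D - (1/4) ^ m < d k) sequentially" using D(1) by (rule order_tendstoD) simp
    then obtain N where "\<forall>k\<ge>N. D - (1/4) ^ m < d k" by (auto simp: eventually_sequentially)
    then show ?thesis by (intro exI[of _ "max m N"]) auto
  qed
  then obtain k where k: "\<And>m. m \<le> k m" "\<And>m. D - (1/4) ^ m < d (k m)" by metis
  have "\<exists>v. mid_comb h (k m) v \<and> Q v < d (k m) + (1/4) ^ m" for m
  proof -
    have "d (k m) < d (k m) + (1/4) ^ m" by simp
    then show ?thesis unfolding d_def[of "k m"] using cINF_less_iff[OF ne bdd] by blast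
  qed
  then obtain v where v: "\<And>m. mid_comb h (k m) (v m)" "\<And>m. Q (v m) < d (k m) + (1/4) ^ m" by metis
  have [measurable]: "v m \<in> borel_measurable M" for m using mid_comb_measurable[OF v(1) hm] .
  \<comment> \<open>Put \<open>q = (1/4) ^ m\<close>. Both functions have
    \<open>Q \<le> D + q\<close>, and their midpoint belongs to the tail from \<open>K\<close> on,
    so its \<open>Q\<close> exceeds \<open>D - q\<close>. The parallelogram law leaves
    \<open>2 * (D + q) + 2 * (D + q) - 4 * (D - q) = 8 * q\<close>.\<close>
  have close: "Q (\<lambda>x. v m x - v (Suc m) x) \<le> 8 * (1/4) ^ m" for m
  proof -
    define K where "K = min (k m) (k (Suc m))"
    have q: "(1/4::real) ^ Suc m \<le> (1/4) ^ m" by simp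
    have "D - (1/4) ^ m < d (k m)" "D - (1/4) ^ m < d (k (Suc m))"
      using k(2)[of m] k(2)[of "Suc m"] q by linarith+
    then have dK: "D - (1/4) ^ m < d K" unfolding K_def min_def by simp
    have "mid_comb h K (v m)" "mid_comb h K (v (Suc m))"
      unfolding K_def by (auto intro: mid_comb_antimono[OF v(1)])
    then have "d K \<le> Q (\<lambda>x. (v m x + v (Suc m) x) / 2)" by (intro d_le mid_comb.mid)
    moreover have "Q (v m) \<le> D + (1/4) ^ m" "Q (v (Suc m)) \<le> D + (1/4) ^ m"
      using v(2)[of m] v(2)[of "Suc m"] D(2)[of "k m"] D(2)[of "k (Suc m)"] q by linarith+
    ultimately show ?thesis using par[OF to0[OF v(1)[of m]] to0[OF v(1)[of "Suc m"]]] dK by linarith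
  qed
  define c where "c = 8 + (\<integral>x. w x \<partial>M)"
  have c0: "0 \<le> (\<integral>x. w x \<partial>M)" using wpos by (intro integral_nonneg_AE AE_I2) (simp add: less_imp_le)
  have L1: "(\<integral>\<^sup>+x. ennreal (\<bar>v m x - v (Suc m) x\<bar> * w x) \<partial>M) \<le> ennreal (c * (1/2) ^ m)" for m
  proof -
    note a = to0[OF v(1)[of m]] and b = to0[OF v(1)[of "Suc m"]]
    have i2: "integrable M (\<lambda>x. (v m x - v (Suc m) x)\<^sup>2 * w x)"
    proof -
      have "integrable M (\<lambda>x. v m x * v m x * w x - 2 * (v m x * v (Suc m) x * w x) + v (Suc m) x * v (Suc m) x * w x)"
        using int[OF a a] int[OF a b] int[OF b b] by simp
      then show ?thesis by (rule Bochner_Integration.integrable_cong[THEN iffD1, rotated 2]) (auto simp: power2_eq_square algebra_simps)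
    qed
    have i3: "integrable M (\<lambda>x. 2 ^ m * ((v m x - v (Suc m) x)\<^sup>2 * w x) + (1/2) ^ m * w x)" using i2 wi by simp
    have "(\<integral>\<^sup>+x. ennreal (\<bar>v m x - v (Suc m) x\<bar> * w x) \<partial>M)
      \<le> (\<integral>\<^sup>+x. ennreal (2 ^ m * ((v m x - v (Suc m) x)\<^sup>2 * w x) + (1/2) ^ m * w x) \<partial>M)"
    proof (intro nn_integral_mono ennreal_leI)
      fix x
      \<comment> \<open>This plays the part of the Cauchy-Schwarz inequality: the decay
        \<open>(1/4) ^ m\<close> of the weighted square integrals becomes the summable decay
        \<open>(1/2) ^ m\<close> of the weighted L^1 norms.\<close>
      have "\<bar>t\<bar> \<le> 2 ^ m * t\<^sup>2 + (1/2) ^ m" for t :: real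
      proof (cases "\<bar>t\<bar> \<le> (1/2) ^ m")
        case False
        have "\<bar>t\<bar> = 2 ^ m * ((1/2) ^ m * \<bar>t\<bar>)" by (simp add: mult.assoc[symmetric] power_mult_distrib[symmetric])
        also have "\<dots> \<le> 2 ^ m * (\<bar>t\<bar> * \<bar>t\<bar>)" using False by (intro mult_left_mono mult_right_mono) auto
        also have "\<dots> = 2 ^ m * t\<^sup>2" by (simp add: power2_eq_square)
        finally show ?thesis by (simp add: add_increasing2)
      qed (simp add: add_increasing)
      from mult_right_mono[OF this[of "v m x - v (Suc m) x"], of "w x"] wpos[of x]
      show "\<bar>v m x - v (Suc m) x\<bar> * w x \<le> 2 ^ m * ((v m x - v (Suc m) x)\<^sup>2 * w x) + (1/2) ^ m * w x"
        by (simp add: algebra_simps)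
    qed
    also have "\<dots> = ennreal (\<integral>x. 2 ^ m * ((v m x - v (Suc m) x)\<^sup>2 * w x) + (1/2) ^ m * w x \<partial>M)"
      using wpos by (intro nn_integral_eq_integral i3 AE_I2) (simp add: less_imp_le)
    also have "(\<integral>x. 2 ^ m * ((v m x - v (Suc m) x)\<^sup>2 * w x) + (1/2) ^ m * w x \<partial>M)
      = 2 ^ m * Q (\<lambda>x. v m x - v (Suc m) x) + (1/2) ^ m * (\<integral>x. w x \<partial>M)"
      using i2 wi by (simp add: Q_def)
    also have "\<dots> \<le> c * (1/2) ^ m"
    proof -
      have "2 ^ m * Q (\<lambda>x. v m x - v (Suc m) x) \<le> 2 ^ m * (8 * (1/4) ^ m)" by (intro mult_left_mono close) simp
      also have "\<dots> = 8 * (1/2) ^ m" by (simp add: power_mult_distrib[symmetric])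
      finally show ?thesis unfolding c_def by (simp add: algebra_simps)
    qed
    finally show ?thesis by (simp add: ennreal_leI)
  qed
  have "(\<integral>\<^sup>+x. (\<Sum>m. ennreal (\<bar>v m x - v (Suc m) x\<bar> * w x)) \<partial>M) = (\<Sum>m. \<integral>\<^sup>+x. ennreal (\<bar>v m x - v (Suc m) x\<bar> * w x) \<partial>M)"
    by (rule nn_integral_suminf) measurable
  also have "\<dots> \<le> (\<Sum>m. ennreal (c * (1/2) ^ m))" by (intro suminf_le L1) auto
  also have "\<dots> < \<infinity>"
  proof -
    have "summable (\<lambda>m. c * (1/2::real) ^ m)" by (intro summable_mult summable_geometric) simp
    then have "(\<Sum>m. ennreal (c * (1/2) ^ m)) = ennreal (\<Sum>m. c * (1/2) ^ m)"
      using c0 by (intro suminf_ennreal2) (auto simp: c_def)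
    then show ?thesis by simp
  qed
  finally have "(\<integral>\<^sup>+x. (\<Sum>m. ennreal (\<bar>v m x - v (Suc m) x\<bar> * w x)) \<partial>M) \<noteq> \<infinity>" by simp
  then have "AE x in M. (\<Sum>m. ennreal (\<bar>v m x - v (Suc m) x\<bar> * w x)) \<noteq> \<infinity>"
    by (intro nn_integral_PInf_AE) measurable
  then have conv: "AE x in M. convergent (\<lambda>m. v m x)"
  proof eventually_elim
    case (elim x)
    then have "summable (\<lambda>m. \<bar>v m x - v (Suc m) x\<bar> * w x)"
      using wpos[of x] by (intro summable_suminf_not_top) (auto simp: less_imp_le)
    then have "summable (\<lambda>m. \<bar>v m x - v (Suc m) x\<bar> * w x / w x)" by (rule summable_divide)
    then have "summable (\<lambda>m. \<bar>v m x - v (Suc m) x\<bar>)" using wpos[of x] by simp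
    then have "summable (\<lambda>m. \<bar>v (Suc m) x - v m x\<bar>)" by (simp add: abs_minus_commute)
    then have "summable (\<lambda>m. v (Suc m) x - v m x)" by (rule summable_rabs_cancel)
    then have "convergent (\<lambda>n. \<Sum>m<n. v (Suc m) x - v m x)" by (simp add: summable_iff_convergent)
    then have "convergent (\<lambda>n. v n x - v 0 x)" by (simp only: sum_lessThan_telescope[of "\<lambda>m. v m x"])
    then show ?case by (metis convergent_diff_const_right_iff)
  qed
  show thesis
    by (rule that[of v]) (use conv mid_comb_antimono[OF v(1) k(1)] in auto)
qed

text \<open>\<open>H\<close> may fail to be integrable; dividing a positive integrable function by
  \<open>1 + H^2\<close> yields a weight for which both the weight and its product with
  \<open>H^2\<close> are integrable. As the combinations are taken from ever later tails, their
  integrals against \<open>\<psi>\<close> have the same limit \<open>L\<close> as those of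
  \<open>h k\<close>.\<close>

lemma weak_limit_dominated:
  fixes h :: "nat \<Rightarrow> 'a::euclidean_space \<Rightarrow> real" and H :: "'a \<Rightarrow> real"
  assumes hm: "\<And>j. h j \<in> borel_measurable borel" and hH: "\<And>j x. \<bar>h j x\<bar> \<le> H x"
    and Hm [measurable]: "H \<in> borel_measurable borel"
  obtains g where "g \<in> borel_measurable borel" "\<And>x. \<bar>g x\<bar> \<le> H x"
    "\<And>\<psi> L. \<psi> \<in> borel_measurable borel \<Longrightarrow> integrable lborel (\<lambda>x. H x * \<psi> x) \<Longrightarrow>
      (\<lambda>k. \<integral>x. h k x * \<psi> x \<partial>lborel) \<longlonglongrightarrow> L \<Longrightarrow> (\<integral>x. g x * \<psi> x \<partial>lborel) = L"
proof -
  obtain \<omega> :: "'a \<Rightarrow> real" where \<omega>: "\<omega> \<in> borel_measurable lborel" "\<And>x. 0 < \<omega> x" "integrable lborel \<omega>"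
    using sigma_finite_measure.obtain_positive_integrable_function[OF sigma_finite_lborel] by metis
  have [measurable]: "\<omega> \<in> borel_measurable borel" using \<omega>(1) by simp
  define w where "w x = \<omega> x / (1 + (H x)\<^sup>2)" for x
  note \<omega>pos = \<omega>(2) and \<omega>i = \<omega>(3)
  have one: "0 < 1 + (H x)\<^sup>2" for x by (simp add: add_pos_nonneg)
  have [measurable]: "w \<in> borel_measurable borel" unfolding w_def by measurable
  have wpos: "0 < w x" for x unfolding w_def using \<omega>pos one by simp
  have le: "w x \<le> \<omega> x" "(H x)\<^sup>2 * w x \<le> \<omega> x" for x
  proof -
    have "\<omega> x * 1 \<le> \<omega> x * (1 + (H x)\<^sup>2)"
      using \<omega>pos[of x] by (intro mult_left_mono) auto
    moreover have "\<omega> x * (H x)\<^sup>2 \<le> \<omega> x * (1 + (H x)\<^sup>2)"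
      using \<omega>pos[of x] by (intro mult_left_mono) auto
    ultimately show "w x \<le> \<omega> x" "(H x)\<^sup>2 * w x \<le> \<omega> x"
      unfolding w_def using one[of x] by (simp_all add: divide_le_eq mult.commute)
  qed
  have wi: "integrable lborel w"
  proof (rule Bochner_Integration.integrable_bound[OF \<omega>i])
    show "AE x in lborel. norm (w x) \<le> norm (\<omega> x)"
      using le(1) wpos \<omega>pos by (intro AE_I2) (simp add: abs_of_pos)
  qed measurable
  have Hw: "integrable lborel (\<lambda>x. (H x)\<^sup>2 * w x)"
  proof (rule Bochner_Integration.integrable_bound[OF \<omega>i])
    show "AE x in lborel. norm ((H x)\<^sup>2 * w x) \<le> norm (\<omega> x)"
      using le(2) wpos \<omega>pos by (intro AE_I2) (simp add: abs_of_pos abs_mult)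
  qed measurable
  have Hl: "H \<in> borel_measurable lborel" and wl: "w \<in> borel_measurable lborel" by measurable
  have hm': "h j \<in> borel_measurable lborel" for j using hm by simp
  obtain v where v: "\<And>m. mid_comb h m (v m)" "AE x in lborel. convergent (\<lambda>m. v m x)"
    by (rule mid_comb_AE_convergent[of h lborel H w, OF hm' hH Hl wl wpos wi Hw]) (rule that)
  have [measurable]: "v m \<in> borel_measurable borel" for m using mid_comb_measurable[OF v(1) hm] .
  have vH: "\<bar>v m x\<bar> \<le> H x" for m x by (rule mid_comb_bound[OF v(1) hH])
  \<comment> \<open>Where the sequence diverges, \<open>lim\<close> is an unspecified value;
    clipping restores the bound by \<open>H\<close> at every point and changes nothing where the
    sequence converges.\<close>
  define g where "g x = max (- H x) (min (H x) (lim (\<lambda>m. v m x)))" for x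
  have [measurable]: "g \<in> borel_measurable borel" unfolding g_def by measurable
  have lim: "AE x in lborel. (\<lambda>m. v m x) \<longlonglongrightarrow> g x"
    using v(2)
  proof eventually_elim
    case (elim x)
    then have l: "(\<lambda>m. v m x) \<longlonglongrightarrow> lim (\<lambda>m. v m x)" by (simp add: convergent_LIMSEQ_iff)
    have "v m x \<le> H x" "- H x \<le> v m x" for m using vH[of m x] by linarith+
    then have "lim (\<lambda>m. v m x) \<le> H x" "- H x \<le> lim (\<lambda>m. v m x)"
      using LIMSEQ_le_const2[OF l] LIMSEQ_le_const[OF l] by blast+
    then show ?case using l by (simp add: g_def)
  qed
  show thesis
  proof (rule that[of g])
    show "g \<in> borel_measurable borel" by measurable
    show "\<bar>g x\<bar> \<le> H x" for x
    proof -
      have "0 \<le> H x" using vH[of 0 x] by linarith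
      then show ?thesis unfolding g_def by linarith
    qed
    fix \<psi> L assume [measurable]: "\<psi> \<in> borel_measurable borel" and i: "integrable lborel (\<lambda>x. H x * \<psi> x)"
      and L: "(\<lambda>k. \<integral>x. h k x * \<psi> x \<partial>lborel) \<longlonglongrightarrow> L"
    have "(\<lambda>m. \<integral>x. v m x * \<psi> x \<partial>lborel) \<longlonglongrightarrow> (\<integral>x. g x * \<psi> x \<partial>lborel)"
    proof (rule integral_dominated_convergence[where w="\<lambda>x. norm (H x * \<psi> x)"])
      show "AE x in lborel. (\<lambda>m. v m x * \<psi> x) \<longlonglongrightarrow> g x * \<psi> x"
        using lim by eventually_elim (intro tendsto_mult tendsto_const)
      show "AE x in lborel. norm (v m x * \<psi> x) \<le> norm (H x * \<psi> x)" for m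
        using vH by (intro AE_I2) (auto simp: abs_mult intro!: mult_right_mono intro: order_trans[OF _ abs_ge_self])
      show "integrable lborel (\<lambda>x. norm (H x * \<psi> x))" using i by (rule integrable_norm)
    qed measurable
    moreover have "(\<lambda>m. \<integral>x. v m x * \<psi> x \<partial>lborel) \<longlonglongrightarrow> L"
    proof (rule LIMSEQ_I)
      fix e :: real assume "0 < e"
      then obtain N where N: "\<And>j. N \<le> j \<Longrightarrow> norm ((\<integral>x. h j x * \<psi> x \<partial>lborel) - L) < e / 2"
        using LIMSEQ_D[OF L, of "e / 2"] by auto
      have *: "\<bar>(\<integral>x. v m x * \<psi> x \<partial>lborel) - L\<bar> \<le> e / 2" if m: "N \<le> m" for m
      proof (rule mid_comb_integral[OF v(1)[of m] hm' hH _ i])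
        fix j assume "m \<le> j"
        with m have "N \<le> j" by simp
        from N[OF this] show "\<bar>(\<integral>x. h j x * \<psi> x \<partial>lborel) - L\<bar> \<le> e / 2" by (simp add: less_imp_le)
      qed simp
      show "\<exists>no. \<forall>n\<ge>no. norm ((\<integral>x. v n x * \<psi> x \<partial>lborel) - L) < e"
      proof (intro exI allI impI)
        fix n assume "N \<le> n"
        from *[OF this] \<open>0 < e\<close> show "norm ((\<integral>x. v n x * \<psi> x \<partial>lborel) - L) < e" unfolding real_norm_def by linarith
      qed
    qed
    ultimately show "(\<integral>x. g x * \<psi> x \<partial>lborel) = L" by (rule LIMSEQ_unique)
  qed
qed

section \<open>Weak gradients from difference quotients\<close>

text \<open>For a function that is not integrable the left side is 0 by convention.\<close>

lemma norm_integral_le_nn_integral: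
  fixes f :: "'a \<Rightarrow> 'b::{banach, second_countable_topology}"
  shows "ennreal (norm (\<integral>x. f x \<partial>M)) \<le> (\<integral>\<^sup>+x. ennreal (norm (f x)) \<partial>M)"
  by (cases "integrable M f") (simp_all add: integral_norm_bound_ennreal not_integrable_integral_eq)

text \<open>For fixed \<open>t\<close> the integral of \<open>G (x + t *\<^sub>R (y - x))\<close>
  over the ball is \<open>r ^ DIM('a)\<close> times a unit average at radius \<open>t * r\<close>,
  and all of these averages are bounded by the single value \<open>fmax 0 G x\<close>. The
  additional factor \<open>r\<close> bounds the length of the segments.\<close>

lemma segment_to_ball:
  fixes F :: "'a::euclidean_space \<Rightarrow> real" and G :: "'a \<Rightarrow> ennreal"
  assumes [measurable]: "F \<in> borel_measurable borel" "G \<in> borel_measurable borel" and r: "0 < r"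
    and seg: "AE y in lborel. y \<in> ball x r \<longrightarrow> ennreal \<bar>F y - F x\<bar> \<le> ennreal (norm (y - x)) * (\<integral>\<^sup>+t. G (x + t *\<^sub>R (y - x)) * indicator {0..1} t \<partial>lborel)"
  shows "(\<integral>\<^sup>+y. ennreal \<bar>F y - F x\<bar> * indicator (ball x r) y \<partial>lborel) \<le> ennreal (r ^ (DIM('a) + 1)) * fmax 0 G x"
proof -
  let ?L = "lborel :: real measure"
  have "(\<integral>\<^sup>+y. ennreal \<bar>F y - F x\<bar> * indicator (ball x r) y \<partial>lborel)
    \<le> (\<integral>\<^sup>+y. (\<integral>\<^sup>+t. ennreal r * (G (x + t *\<^sub>R (y - x)) * indicator (ball x r) y * indicator {0..1} t) \<partial>?L) \<partial>lborel)"
  proof (rule nn_integral_mono_AE)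
    show "AE y in lborel. ennreal \<bar>F y - F x\<bar> * indicator (ball x r) y
      \<le> (\<integral>\<^sup>+t. ennreal r * (G (x + t *\<^sub>R (y - x)) * indicator (ball x r) y * indicator {0..1} t) \<partial>?L)"
      using seg
    proof eventually_elim
      case (elim y)
      show ?case
      proof (cases "y \<in> ball x r")
        case True
        then have "norm (y - x) \<le> r" by (simp add: dist_norm norm_minus_commute)
        then have "ennreal \<bar>F y - F x\<bar> \<le> ennreal r * (\<integral>\<^sup>+t. G (x + t *\<^sub>R (y - x)) * indicator {0..1} t \<partial>lborel)"
          using elim True by (meson ennreal_leI mult_right_mono order_trans zero_le)
        also have "\<dots> = (\<integral>\<^sup>+t. ennreal r * (G (x + t *\<^sub>R (y - x)) * indicator {0..1} t) \<partial>lborel)"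
          by (rule nn_integral_cmult[symmetric]) measurable
        finally show ?thesis using True by simp
      qed simp
    qed
  qed
  also have "\<dots> = (\<integral>\<^sup>+t. (\<integral>\<^sup>+y. ennreal r * (G (x + t *\<^sub>R (y - x)) * indicator (ball x r) y * indicator {0..1} t) \<partial>lborel) \<partial>?L)"
    by (rule lborel_pair.Fubini') measurable
  also have "\<dots> \<le> (\<integral>\<^sup>+t. ennreal (r ^ (DIM('a) + 1)) * fmax 0 G x * indicator {0..1} t \<partial>?L)"
  proof (rule nn_integral_mono_AE)
    \<comment> \<open>At \<open>t = 0\<close> the rescaled ball degenerates, so this one parameter
      is left out.\<close>
    show "AE t in ?L. (\<integral>\<^sup>+y. ennreal r * (G (x + t *\<^sub>R (y - x)) * indicator (ball x r) y * indicator {0..1} t) \<partial>lborel)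
       \<le> ennreal (r ^ (DIM('a) + 1)) * fmax 0 G x * indicator {0..1} t"
      using AE_lborel_singleton[of 0]
    proof eventually_elim
      case (elim t)
      show ?case
      proof (cases "t \<in> {0..1}")
        case True
        then have t: "0 < t" using elim by simp
        have "(\<integral>\<^sup>+y. G (x + t *\<^sub>R (y - x)) * indicator (ball x r) y \<partial>lborel) = ennreal (r ^ DIM('a)) * unit_avg G x (t * r)"
          by (subst ball_integral_scaled[OF _ r]) simp_all
        also have "\<dots> \<le> ennreal (r ^ DIM('a)) * fmax 0 G x"
          using unit_avg_le_fmax[of G "t * r" 0 x] t r by (intro mult_left_mono) auto
        finally have le: "(\<integral>\<^sup>+y. G (x + t *\<^sub>R (y - x)) * indicator (ball x r) y \<partial>lborel) \<le> ennreal (r ^ DIM('a)) * fmax 0 G x" .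
        have "(\<integral>\<^sup>+y. ennreal r * (G (x + t *\<^sub>R (y - x)) * indicator (ball x r) y) \<partial>lborel) = ennreal r * (\<integral>\<^sup>+y. G (x + t *\<^sub>R (y - x)) * indicator (ball x r) y \<partial>lborel)"
          by (rule nn_integral_cmult) measurable
        also have "\<dots> \<le> ennreal r * (ennreal (r ^ DIM('a)) * fmax 0 G x)" by (rule mult_left_mono[OF le]) simp
        also have "\<dots> = ennreal (r ^ (DIM('a) + 1)) * fmax 0 G x" using r by (simp add: mult.assoc[symmetric] ennreal_mult[symmetric])
        finally show ?thesis using True by simp
      qed simp
    qed
  qed
  also have "\<dots> = ennreal (r ^ (DIM('a) + 1)) * fmax 0 G x"
    by (subst nn_integral_cmult_indicator) auto
  finally show ?thesis .
qed

text \<open>Used here instead of \<open>bump\<close> because its supremum is explicit and scales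
  like \<open>s ^ DIM('a)\<close> in the denominator, as the bound on difference quotients demands.
  The derivatives fall on the test function, so a discontinuous kernel is admissible.\<close>

definition ball_kernel :: "real \<Rightarrow> 'a::euclidean_space \<Rightarrow> real" where
  "ball_kernel s z = indicator (ball 0 s) z / (unit_ball_vol (real DIM('a)) * s ^ DIM('a))"

lemma ball_kernel_measurable [measurable]: "ball_kernel s \<in> borel_measurable borel"
  unfolding ball_kernel_def by measurable

lemma ball_kernel_properties:
  assumes s: "0 < s"
  shows "integrable lborel (ball_kernel s :: 'a::euclidean_space \<Rightarrow> real)"
    and "0 \<le> ball_kernel s (z::'a)"
    and "(\<integral>z. ball_kernel s z \<partial>(lborel :: 'a measure)) = 1"
    and "\<bar>ball_kernel s (z::'a)\<bar> \<le> 1 / (unit_ball_vol (real DIM('a)) * s ^ DIM('a))"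
    and "ball_kernel s (z::'a) \<noteq> 0 \<Longrightarrow> norm z < s"
proof -
  have m: "measure lborel (ball (0::'a) s) = unit_ball_vol (real DIM('a)) * s ^ DIM('a)"
    using content_ball[of s "0::'a"] s by simp
  have V: "0 < unit_ball_vol (real DIM('a)) * s ^ DIM('a)" using s by simp
  have i: "integrable lborel (indicator (ball (0::'a) s) :: 'a \<Rightarrow> real)"
    using emeasure_lborel_ball_finite[of "0::'a" s] by (intro integrable_real_indicator) auto
  show "integrable lborel (ball_kernel s :: 'a \<Rightarrow> real)"
    unfolding ball_kernel_def[abs_def] using i by (intro integrable_divide_zero) simp
  show "0 \<le> ball_kernel s z" unfolding ball_kernel_def using V by (simp add: less_imp_le)
  show "(\<integral>z. ball_kernel s z \<partial>(lborel :: 'a measure)) = 1"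
    unfolding ball_kernel_def using m s unit_ball_vol_pos[of "real DIM('a)"] by (simp del: unit_ball_vol_pos)
  show "\<bar>ball_kernel s z\<bar> \<le> 1 / (unit_ball_vol (real DIM('a)) * s ^ DIM('a))"
    unfolding ball_kernel_def using V by (auto simp: indicator_def less_imp_le)
  show "ball_kernel s z \<noteq> 0 \<Longrightarrow> norm z < s"
    unfolding ball_kernel_def by (auto simp: indicator_def split: if_splits)
qed

lemma conv_cong_on:
  assumes "\<And>y. k (x - y) \<noteq> 0 \<Longrightarrow> f y = g y"
  shows "conv k f x = conv k g x"
  unfolding conv_def by (rule Bochner_Integration.integral_cong[OF refl]) (use assms in force)

text \<open>The ball of radius \<open>s\<close> around \<open>x'\<close> lies in
  \<open>ball x (2 * s)\<close>, so the deviation is at most the supremum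
  \<open>1 / (V * s ^ n)\<close> of the kernel times the integral bounded in
  \<open>segment_to_ball\<close>; the powers of \<open>s\<close> leave a single factor
  \<open>s\<close>.\<close>

lemma conv_ball_deviation:
  fixes F :: "'a::euclidean_space \<Rightarrow> real" and G :: "'a \<Rightarrow> ennreal"
  assumes [measurable]: "F \<in> borel_measurable borel" "G \<in> borel_measurable borel" and s: "0 < s"
    and Fi: "integrable lborel (\<lambda>y. indicator (ball x (2 * s)) y *\<^sub>R F y)" and x': "dist x x' \<le> s"
    and seg: "AE y in lborel. y \<in> ball x (2 * s) \<longrightarrow> ennreal \<bar>F y - F x\<bar> \<le> ennreal (norm (y - x)) * (\<integral>\<^sup>+t. G (x + t *\<^sub>R (y - x)) * indicator {0..1} t \<partial>lborel)"
  shows "ennreal \<bar>conv (ball_kernel s) F x' - F x\<bar> \<le> ennreal (2 ^ (DIM('a) + 1) * s / unit_ball_vol (real DIM('a))) * fmax 0 G x"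
proof -
  let ?k = "ball_kernel s :: 'a \<Rightarrow> real"
  define V where "V = unit_ball_vol (real DIM('a))"
  have V: "0 < V" unfolding V_def by simp
  note P = ball_kernel_properties[OF s, where 'a='a, folded V_def]
  have near: "y \<in> ball x (2 * s)" if "?k (x' - y) \<noteq> 0" for y
    using P(5)[OF that] x' dist_triangle[of x y x'] by (simp add: dist_norm)
  let ?F1 = "\<lambda>y. indicator (ball x (2 * s)) y *\<^sub>R F y"
  have i1: "integrable lborel (\<lambda>y. ?k (x' - y) *\<^sub>R ?F1 y)"
    by (rule conv_integrable[OF Fi ball_kernel_measurable P(4)])
  have i2: "integrable lborel (\<lambda>y. ?k (x' - y))"
    using integrable_distr_eq[of "\<lambda>y. x' - y" lborel borel ?k] P(1) by (simp add: lborel_reflect)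
  have one: "(\<integral>y. ?k (x' - y) \<partial>lborel) = 1"
    using lborel_integral_reflect[of ?k x'] P(3) by simp
  have "conv ?k F x' = (\<integral>y. ?k (x' - y) *\<^sub>R ?F1 y \<partial>lborel)"
    unfolding conv_def by (rule Bochner_Integration.integral_cong[OF refl]) (use near in force)
  also have "\<dots> - F x = (\<integral>y. ?k (x' - y) *\<^sub>R ?F1 y - ?k (x' - y) * F x \<partial>lborel)"
    using i1 i2 one by simp
  also have "\<dots> = (\<integral>y. ?k (x' - y) * (F y - F x) \<partial>lborel)"
  proof (rule Bochner_Integration.integral_cong[OF refl])
    fix y show "?k (x' - y) *\<^sub>R ?F1 y - ?k (x' - y) * F x = ?k (x' - y) * (F y - F x)"
      using near[of y] by (cases "?k (x' - y) = 0") (auto simp: algebra_simps)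
  qed
  finally have "ennreal \<bar>conv ?k F x' - F x\<bar> \<le> (\<integral>\<^sup>+y. ennreal \<bar>?k (x' - y) * (F y - F x)\<bar> \<partial>lborel)"
    using norm_integral_le_nn_integral[of lborel "\<lambda>y. ?k (x' - y) * (F y - F x)"] by simp
  also have "\<dots> \<le> (\<integral>\<^sup>+y. ennreal (1 / (V * s ^ DIM('a))) * (ennreal \<bar>F y - F x\<bar> * indicator (ball x (2 * s)) y) \<partial>lborel)"
  proof (rule nn_integral_mono)
    fix y
    show "ennreal \<bar>?k (x' - y) * (F y - F x)\<bar> \<le> ennreal (1 / (V * s ^ DIM('a))) * (ennreal \<bar>F y - F x\<bar> * indicator (ball x (2 * s)) y)"
    proof (cases "?k (x' - y) = 0")
      case False
      have "\<bar>?k (x' - y) * (F y - F x)\<bar> \<le> 1 / (V * s ^ DIM('a)) * \<bar>F y - F x\<bar>"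
        unfolding abs_mult by (intro mult_right_mono P(4)) simp
      then show ?thesis using near[OF False] V s by (simp add: ennreal_mult[symmetric] ennreal_leI)
    qed simp
  qed
  also have "\<dots> = ennreal (1 / (V * s ^ DIM('a))) * (\<integral>\<^sup>+y. ennreal \<bar>F y - F x\<bar> * indicator (ball x (2 * s)) y \<partial>lborel)"
    by (rule nn_integral_cmult) measurable
  also have "\<dots> \<le> ennreal (1 / (V * s ^ DIM('a))) * (ennreal ((2 * s) ^ (DIM('a) + 1)) * fmax 0 G x)"
    by (intro mult_left_mono segment_to_ball seg) (use s in auto)
  also have "\<dots> = ennreal (2 ^ (DIM('a) + 1) * s / V) * fmax 0 G x"
  proof -
    have "1 / (V * s ^ DIM('a)) * (2 * s) ^ (DIM('a) + 1) = 2 ^ (DIM('a) + 1) * s / V"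
      using V s by (simp add: power_mult_distrib)
    then show ?thesis using V s
      by (simp only: mult.assoc[symmetric]) (simp add: ennreal_mult[symmetric] del: times_divide_eq_left)
  qed
  finally show ?thesis unfolding V_def .
qed

text \<open>Step length and averaging radius coincide, so that the deviation of each average from
  \<open>F x\<close>, which is of order \<open>s\<close>, is compensated by the division. Averaging
  comes first because a single increment of \<open>F\<close> is controlled only by an integral over
  one segment.\<close>

definition avg_quot :: "('a::euclidean_space \<Rightarrow> real) \<Rightarrow> 'a \<Rightarrow> real \<Rightarrow> 'a \<Rightarrow> real" where
  "avg_quot F b s x = (conv (ball_kernel s) F (x + s *\<^sub>R b) - conv (ball_kernel s) F x) / s"

text \<open>Both averages are compared with \<open>F x\<close>, which doubles the constant of
  \<open>conv_ball_deviation\<close>.\<close>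

lemma avg_quot_bound:
  fixes F :: "'a::euclidean_space \<Rightarrow> real" and G :: "'a \<Rightarrow> ennreal"
  assumes m: "F \<in> borel_measurable borel" "G \<in> borel_measurable borel" and s: "0 < s" and b: "norm b = 1"
    and Fi: "integrable lborel (\<lambda>y. indicator (ball x (2 * s)) y *\<^sub>R F y)"
    and seg: "AE y in lborel. y \<in> ball x (2 * s) \<longrightarrow> ennreal \<bar>F y - F x\<bar> \<le> ennreal (norm (y - x)) * (\<integral>\<^sup>+t. G (x + t *\<^sub>R (y - x)) * indicator {0..1} t \<partial>lborel)"
  shows "ennreal \<bar>avg_quot F b s x\<bar> \<le> ennreal (2 ^ (DIM('a) + 2) / unit_ball_vol (real DIM('a))) * fmax 0 G x"
proof -
  define c where "c = 2 ^ (DIM('a) + 1) / unit_ball_vol (real DIM('a))"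
  have c: "0 < c" unfolding c_def by simp
  have e: "2 ^ (DIM('a) + 1) * s / unit_ball_vol (real DIM('a)) = c * s" by (simp add: c_def)
  have 1: "ennreal \<bar>conv (ball_kernel s) F (x + s *\<^sub>R b) - F x\<bar> \<le> ennreal (c * s) * fmax 0 G x"
    using conv_ball_deviation[OF m s Fi _ seg, of "x + s *\<^sub>R b"] s b unfolding e by (simp add: dist_norm)
  have 2: "ennreal \<bar>conv (ball_kernel s) F x - F x\<bar> \<le> ennreal (c * s) * fmax 0 G x"
    using conv_ball_deviation[OF m s Fi _ seg, of x] s unfolding e by simp
  have "\<bar>avg_quot F b s x\<bar> = 1 / s * \<bar>conv (ball_kernel s) F (x + s *\<^sub>R b) - conv (ball_kernel s) F x\<bar>"
    unfolding avg_quot_def using s by (simp add: abs_divide)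
  also have "\<dots> \<le> 1 / s * (\<bar>conv (ball_kernel s) F (x + s *\<^sub>R b) - F x\<bar> + \<bar>conv (ball_kernel s) F x - F x\<bar>)"
    using s by (intro mult_left_mono) auto
  finally have "ennreal \<bar>avg_quot F b s x\<bar> \<le> ennreal (1 / s) * (ennreal \<bar>conv (ball_kernel s) F (x + s *\<^sub>R b) - F x\<bar> + ennreal \<bar>conv (ball_kernel s) F x - F x\<bar>)"
    using s by (simp add: ennreal_mult[symmetric] ennreal_plus[symmetric] ennreal_leI del: ennreal_plus times_divide_eq_left)
  also have "\<dots> \<le> ennreal (1 / s) * (ennreal (c * s) * fmax 0 G x + ennreal (c * s) * fmax 0 G x)"
    by (intro mult_left_mono add_mono 1 2) simp
  also have "\<dots> = ennreal (1 / s) * (ennreal (2 * (c * s)) * fmax 0 G x)"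
    by (subst distrib_right[symmetric]) (use c s in \<open>simp add: ennreal_plus[symmetric] del: ennreal_plus\<close>)
  also have "\<dots> = ennreal (2 * c) * fmax 0 G x"
    using c s by (simp add: mult.assoc[symmetric] ennreal_mult[symmetric])
  finally show ?thesis by (simp add: c_def)
qed

section \<open>Test functions and discrete integration by parts\<close>

lemma test_functionD:
  assumes \<psi>: "\<psi> \<in> test_functions \<Omega>"
  shows "(\<psi> has_derivative frechet_derivative \<psi> (at x)) (at x)"
    and "b \<in> Basis \<Longrightarrow> continuous_on UNIV (\<lambda>x. frechet_derivative \<psi> (at x) b)"
    and "\<psi> \<in> borel_measurable borel"
    and "b \<in> Basis \<Longrightarrow> (\<lambda>x. frechet_derivative \<psi> (at x) b) \<in> borel_measurable borel"
    and "\<exists>K B. compact K \<and> K \<subseteq> \<Omega> \<and> (\<forall>x. x \<notin> K \<longrightarrow> \<psi> x = 0 \<and> frechet_derivative \<psi> (at x) = (\<lambda>_. 0)) \<and>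
      (\<forall>x. \<bar>\<psi> x\<bar> \<le> B) \<and> (\<forall>x. \<forall>b\<in>Basis. \<bar>frechet_derivative \<psi> (at x) b\<bar> \<le> B)"
proof -
  have c1: "Ck (Suc 0) \<psi>" using \<psi> unfolding test_functions_def by blast
  show d: "(\<psi> has_derivative frechet_derivative \<psi> (at x)) (at x)" for x by (rule Ck_SucD_deriv[OF c1])
  have cont: "continuous_on UNIV \<psi>"
    by (rule has_derivative_continuous_on) (rule has_derivative_at_withinI[OF d])
  show dcont: "continuous_on UNIV (\<lambda>x. frechet_derivative \<psi> (at x) b)" if "b \<in> Basis" for b
    using c1 that by simp
  show "\<psi> \<in> borel_measurable borel" by (rule borel_measurable_continuous_onI[OF cont])
  show "(\<lambda>x. frechet_derivative \<psi> (at x) b) \<in> borel_measurable borel" if "b \<in> Basis" for b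
    by (rule borel_measurable_continuous_onI[OF dcont[OF that]])
  define K where "K = closure {x. \<psi> x \<noteq> 0}"
  have K: "compact K" "K \<subseteq> \<Omega>" using \<psi> unfolding test_functions_def K_def by auto
  have out: "\<psi> x = 0" if "x \<notin> K" for x using that closure_subset[of "{x. \<psi> x \<noteq> 0}"] unfolding K_def by auto
  have dout: "frechet_derivative \<psi> (at x) = (\<lambda>_. 0)" if "x \<notin> K" for x
  proof -
    have "(\<psi> has_derivative (\<lambda>_. 0)) (at x)"
      by (rule has_derivative_transform_within_open[where s="- K" and f="\<lambda>_. 0"])
        (use K that out in \<open>auto simp: compact_imp_closed open_Compl\<close>)
    then show ?thesis using frechet_derivative_at by metis
  qed
  obtain \<rho> where \<rho>: "\<And>x. x \<in> K \<Longrightarrow> norm x < \<rho>"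
    using compact_imp_bounded[OF K(1)] by (metis bounded_pos_less)
  have "\<exists>B. \<forall>z. norm (\<psi> z) \<le> B"
    by (rule compact_support_uniformly_continuous(2)[OF cont, of \<rho>]) (use out \<rho> in force)
  then obtain B0 where B0: "\<And>z. \<bar>\<psi> z\<bar> \<le> B0" by auto
  have "\<exists>B. \<forall>z. norm (frechet_derivative \<psi> (at z) b) \<le> B" if "b \<in> Basis" for b
    by (rule compact_support_uniformly_continuous(2)[OF dcont[OF that], of \<rho>]) (metis dout \<rho> not_less)
  then obtain B1 where B1: "\<And>b z. b \<in> Basis \<Longrightarrow> \<bar>frechet_derivative \<psi> (at z) b\<bar> \<le> B1 b"
    by (metis real_norm_def)
  define B where "B = Max (insert B0 (B1 ` Basis))"
  have "B0 \<le> B" "\<And>b. b \<in> Basis \<Longrightarrow> B1 b \<le> B" unfolding B_def by (auto intro!: Max_ge simp del: Max_insert)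
  then show "\<exists>K B. compact K \<and> K \<subseteq> \<Omega> \<and> (\<forall>x. x \<notin> K \<longrightarrow> \<psi> x = 0 \<and> frechet_derivative \<psi> (at x) = (\<lambda>_. 0)) \<and>
      (\<forall>x. \<bar>\<psi> x\<bar> \<le> B) \<and> (\<forall>x. \<forall>b\<in>Basis. \<bar>frechet_derivative \<psi> (at x) b\<bar> \<le> B)"
    using K out dout B0 B1 by (intro exI[of _ K] exI[of _ B]) (meson order_trans)
qed

text \<open>Translation turns a forward quotient of \<open>F\<close> into a backward quotient of
  \<open>\<psi>\<close>, whence the sign of the limit. The mean value theorem makes the bound
  uniform in the step.\<close>

lemma test_function_quotient:
  assumes \<psi>: "\<psi> \<in> test_functions \<Omega>" and b: "b \<in> Basis"
  shows "0 < s \<Longrightarrow> (\<And>x. \<bar>frechet_derivative \<psi> (at x) b\<bar> \<le> B) \<Longrightarrow> \<bar>(\<psi> (x - s *\<^sub>R b) - \<psi> x) / s\<bar> \<le> B"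
    and "s' \<longlonglongrightarrow> 0 \<Longrightarrow> (\<And>k::nat. 0 < s' k) \<Longrightarrow> (\<lambda>k. (\<psi> (x - s' k *\<^sub>R b) - \<psi> x) / s' k) \<longlonglongrightarrow> - frechet_derivative \<psi> (at x) b"
proof -
  have D: "((\<lambda>t. \<psi> (x - t *\<^sub>R b)) has_real_derivative - frechet_derivative \<psi> (at (x - t *\<^sub>R b)) b) (at t)" for t
  proof -
    have "((\<lambda>t. x - t *\<^sub>R b) has_derivative (\<lambda>h. - (h *\<^sub>R b))) (at t)"
      by (auto intro!: derivative_eq_intros)
    from has_derivative_compose[OF this test_functionD(1)[OF \<psi>]]
    have "((\<lambda>t. \<psi> (x - t *\<^sub>R b)) has_derivative (\<lambda>h. frechet_derivative \<psi> (at (x - t *\<^sub>R b)) (- (h *\<^sub>R b)))) (at t)" .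
    moreover have "frechet_derivative \<psi> (at y) (- (h *\<^sub>R b)) = - frechet_derivative \<psi> (at y) b * h" for y h
    proof -
      have l: "linear (frechet_derivative \<psi> (at y))" by (rule has_derivative_linear[OF test_functionD(1)[OF \<psi>]])
      show ?thesis by (simp add: linear_neg[OF l] linear_cmul[OF l])
    qed
    ultimately show ?thesis unfolding has_field_derivative_def
      by (elim has_derivative_eq_rhs) (simp add: fun_eq_iff)
  qed
  show "\<bar>(\<psi> (x - s *\<^sub>R b) - \<psi> x) / s\<bar> \<le> B" if s: "0 < s" and B: "\<And>x. \<bar>frechet_derivative \<psi> (at x) b\<bar> \<le> B"
  proof -
    obtain z where "0 < z" "z < s" "\<psi> (x - s *\<^sub>R b) - \<psi> (x - 0 *\<^sub>R b) = (s - 0) * - frechet_derivative \<psi> (at (x - z *\<^sub>R b)) b"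
      using MVT2[OF s D] by blast
    then have "(\<psi> (x - s *\<^sub>R b) - \<psi> x) / s = - frechet_derivative \<psi> (at (x - z *\<^sub>R b)) b"
      using s by simp
    then show ?thesis using B[of "x - z *\<^sub>R b"] by (simp only: abs_minus_cancel)
  qed
  show "(\<lambda>k. (\<psi> (x - s' k *\<^sub>R b) - \<psi> x) / s' k) \<longlonglongrightarrow> - frechet_derivative \<psi> (at x) b" if s': "s' \<longlonglongrightarrow> 0" "\<And>k::nat. 0 < s' k"
  proof -
    have "((\<lambda>h. (\<psi> (x - (0 + h) *\<^sub>R b) - \<psi> (x - 0 *\<^sub>R b)) / h) \<longlongrightarrow> - frechet_derivative \<psi> (at (x - 0 *\<^sub>R b)) b) (at 0)"
      using D[of 0] unfolding DERIV_def .
    moreover have "filterlim s' (at 0) sequentially"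
      using s' by (auto simp: filterlim_at intro!: always_eventually less_imp_neq[symmetric])
    ultimately have "(\<lambda>k. (\<psi> (x - (0 + s' k) *\<^sub>R b) - \<psi> (x - 0 *\<^sub>R b)) / s' k) \<longlonglongrightarrow> - frechet_derivative \<psi> (at (x - 0 *\<^sub>R b)) b"
      by (rule filterlim_compose)
    then show ?thesis by simp
  qed
qed

lemma lborel_integral_translate:
  fixes f :: "'a::euclidean_space \<Rightarrow> 'b::{banach, second_countable_topology}"
  assumes [measurable]: "f \<in> borel_measurable borel"
  shows "(\<integral>x. f (a + x) \<partial>lborel) = (\<integral>x. f x \<partial>lborel)"
  using integral_distr[of "(+) a" lborel borel f] by (simp add: lborel_distr_plus)

lemma conv_measurable:
  fixes f :: "'a::euclidean_space \<Rightarrow> real"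
  assumes [measurable]: "k \<in> borel_measurable borel" "f \<in> borel_measurable borel"
  shows "conv k f \<in> borel_measurable borel"
proof -
  have "(\<lambda>x. \<integral>y. k (x - y) *\<^sub>R f y \<partial>lborel) \<in> borel_measurable borel"
    by (rule lborel.borel_measurable_lebesgue_integral) measurable
  then show ?thesis unfolding conv_def[abs_def] .
qed

lemma avg_quot_measurable [measurable]:
  fixes F :: "'a::euclidean_space \<Rightarrow> real"
  assumes [measurable]: "F \<in> borel_measurable borel"
  shows "avg_quot F b s \<in> borel_measurable borel"
proof -
  have [measurable]: "conv (ball_kernel s) F \<in> borel_measurable borel" by (rule conv_measurable) measurable
  show ?thesis unfolding avg_quot_def[abs_def] by measurable
qed

lemma conv_ball_kernel_L1:
  fixes f :: "'a::euclidean_space \<Rightarrow> real"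
  assumes f: "integrable lborel f" and s: "s \<longlonglongrightarrow> 0" "\<And>k::nat. 0 < s k"
  shows "(\<lambda>k. \<integral>\<^sup>+x. ennreal (norm (conv (ball_kernel (s k)) f x - f x)) \<partial>lborel) \<longlonglongrightarrow> 0"
proof (rule order_tendstoI)
    fix a :: ennreal assume a: "0 < a"
    obtain e :: real where e: "0 < e" "ennreal e < a"
    proof (cases a)
      case (real c)
      then show thesis using that[of "c / 2"] a by (simp add: ennreal_less_iff)
    qed (use that[of 1] in simp)
    obtain d where d: "0 < d" "\<And>z. norm z < d \<Longrightarrow> transl_dist f z \<le> ennreal e"
      using L1_translation_continuous[OF f e(1)] unfolding eventually_nhds_metric by (auto simp: dist_norm)
    have "eventually (\<lambda>k. s k < d) sequentially" using s(1) d(1) by (rule order_tendstoD)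
    then show "eventually (\<lambda>k. (\<integral>\<^sup>+x. ennreal (norm (conv (ball_kernel (s k)) f x - f x)) \<partial>lborel) < a) sequentially"
    proof eventually_elim
      case (elim k)
      have "(\<integral>\<^sup>+x. ennreal (norm (conv (ball_kernel (s k)) f x - f x)) \<partial>lborel) \<le> ennreal e"
      proof (rule conv_L1_bound[OF f ball_kernel_properties(1-4)[OF s(2)]])
        fix z :: 'a assume "ball_kernel (s k) z \<noteq> 0"
        then have "norm (- z) < d" using ball_kernel_properties(5)[OF s(2)] elim by fastforce
        then show "transl_dist f (- z) \<le> ennreal e" by (rule d(2))
      qed
      then show ?case using e(2) by simp
    qed
qed simp

text \<open>Translation invariance moves the quotient to \<open>\<psi>\<close>, where it converges
  boundedly, while the averages of the cut-off \<open>F\<close> converge in L^1.\<close>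

lemma avg_quot_weak_limit:
  fixes F :: "'a::euclidean_space \<Rightarrow> real"
  assumes \<Omega>: "open \<Omega>" and [measurable]: "F \<in> borel_measurable borel"
    and Fi: "\<And>K. compact K \<Longrightarrow> K \<subseteq> \<Omega> \<Longrightarrow> integrable lborel (\<lambda>y. indicator K y *\<^sub>R F y)"
    and \<psi>: "\<psi> \<in> test_functions \<Omega>" and b: "b \<in> Basis" and s: "s \<longlonglongrightarrow> 0" "\<And>k::nat. 0 < s k"
  shows "(\<lambda>k. \<integral>x. avg_quot F b (s k) x * \<psi> x \<partial>lborel) \<longlonglongrightarrow> - (\<integral>x. F x * frechet_derivative \<psi> (at x) b \<partial>lborel)"
proof -
  obtain K B where K: "compact K" "K \<subseteq> \<Omega>" and out: "\<And>x. x \<notin> K \<Longrightarrow> \<psi> x = 0" "\<And>x. x \<notin> K \<Longrightarrow> frechet_derivative \<psi> (at x) = (\<lambda>_. 0)"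
    and B: "\<And>x. \<bar>\<psi> x\<bar> \<le> B" "\<And>x. \<bar>frechet_derivative \<psi> (at x) b\<bar> \<le> B"
    using test_functionD(5)[OF \<psi>] b by blast
  have [measurable]: "\<psi> \<in> borel_measurable borel" "(\<lambda>x. frechet_derivative \<psi> (at x) b) \<in> borel_measurable borel"
    using test_functionD(3,4)[OF \<psi>] b by auto
  have B0: "0 \<le> B" using B(1) abs_ge_zero order_trans by blast
  obtain K' e where K': "compact K'" "K' \<subseteq> \<Omega>" "0 < e" "\<And>x. x \<in> K \<Longrightarrow> cball x e \<subseteq> K'"
    using compact_neighbourhood[OF K(1) \<Omega> K(2)] by blast
  have [measurable]: "K' \<in> sets borel" using K'(1) by (intro borel_closed compact_imp_closed)
  let ?F = "\<lambda>y. indicator K' y *\<^sub>R F y"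
  have F1: "integrable lborel ?F" by (rule Fi[OF K'(1,2)])
  define A where "A k = conv (ball_kernel (s k)) ?F" for k
  have [measurable]: "A k \<in> borel_measurable borel" for k unfolding A_def by (rule conv_measurable) measurable
  define d where "d k x = (\<psi> (x - s k *\<^sub>R b) - \<psi> x) / s k" for k x
  have [measurable]: "d k \<in> borel_measurable borel" for k unfolding d_def by measurable
  have dB: "\<bar>d k x\<bar> \<le> B" for k x unfolding d_def by (rule test_function_quotient(1)[OF \<psi> b s(2) B(2)])
  have dlim: "(\<lambda>k. d k x) \<longlonglongrightarrow> - frechet_derivative \<psi> (at x) b" for x
    unfolding d_def by (rule test_function_quotient(2)[OF \<psi> b s])
  have L1: "(\<lambda>k. \<integral>\<^sup>+x. ennreal (norm (A k x - ?F x)) \<partial>lborel) \<longlonglongrightarrow> 0"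
    unfolding A_def by (rule conv_ball_kernel_L1[OF F1 s])
  have fin: "eventually (\<lambda>k. (\<integral>\<^sup>+x. ennreal (norm (A k x - ?F x)) \<partial>lborel) < 1) sequentially"
    using L1 by (rule order_tendstoD) simp
  have small: "eventually (\<lambda>k. s k < e / 2) sequentially"
    using s(1) by (rule order_tendstoD) (use K'(3) in simp)
  have mult_int: "integrable lborel (\<lambda>x. u x * w x)" if "integrable lborel u" "w \<in> borel_measurable borel" "\<And>x. \<bar>w x\<bar> \<le> B" for u w :: "'a \<Rightarrow> real"
  proof (rule Bochner_Integration.integrable_bound)
    show "integrable lborel (\<lambda>x. B * u x)" using that(1) by simp
    have [measurable]: "u \<in> borel_measurable borel" "w \<in> borel_measurable borel" using that(1,2) by auto
    show "(\<lambda>x. u x * w x) \<in> borel_measurable lborel" by measurable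
    show "AE x in lborel. norm (u x * w x) \<le> norm (B * u x)"
      using that(3) B0 by (intro AE_I2) (simp add: abs_mult mult.commute[of B] mult_left_mono)
  qed
  \<comment> \<open>Replacing the averages by the cut-off \<open>F\<close> itself costs at most
    \<open>B\<close> times their L^1 distance, which is known to be finite only from some index
    on.\<close>
  have main: "eventually (\<lambda>k. \<bar>(\<integral>x. avg_quot F b (s k) x * \<psi> x \<partial>lborel) - (\<integral>x. ?F x * d k x \<partial>lborel)\<bar> \<le> B * enn2real (\<integral>\<^sup>+x. ennreal (norm (A k x - ?F x)) \<partial>lborel)) sequentially"
    using fin small
  proof eventually_elim
    case (elim k)
    have iAF: "integrable lborel (\<lambda>x. A k x - ?F x)"
    proof (rule integrableI_bounded)
      show "(\<integral>\<^sup>+x. ennreal (norm (A k x - ?F x)) \<partial>lborel) < \<infinity>" using elim(1) by (simp add: less_trans[OF _ ennreal_one_less_top])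
    qed measurable
    have iA: "integrable lborel (A k)"
      using Bochner_Integration.integrable_add[OF iAF F1] by simp
    have iAs: "integrable lborel (\<lambda>x. A k (x + s k *\<^sub>R b))"
      using integrable_distr_eq[of "(+) (s k *\<^sub>R b)" lborel borel "A k"] iA by (simp add: lborel_distr_plus add.commute)
    \<comment> \<open>From a point of the support of \<open>\<psi>\<close> the averages reach only
      points within \<open>2 * s k < e\<close>, where the cut-off by \<open>K'\<close> is not
      felt.\<close>
    have local: "avg_quot F b (s k) x * \<psi> x = (A k (x + s k *\<^sub>R b) * \<psi> x - A k x * \<psi> x) / s k" for x
    proof (cases "x \<in> K")
      case True
      have "conv (ball_kernel (s k)) F x' = A k x'" if "dist x x' \<le> s k" for x'
        unfolding A_def
      proof (rule conv_cong_on)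
        fix y assume "ball_kernel (s k) (x' - y) \<noteq> 0"
        then have "norm (x' - y) < s k" by (rule ball_kernel_properties(5)[OF s(2)])
        then have "y \<in> cball x e" using that elim(2) dist_triangle[of x y x'] by (simp add: dist_norm)
        then show "F y = ?F y" using K'(4)[OF True] by auto
      qed
      from this[of x] this[of "x + s k *\<^sub>R b"] have "conv (ball_kernel (s k)) F x = A k x" "conv (ball_kernel (s k)) F (x + s k *\<^sub>R b) = A k (x + s k *\<^sub>R b)"
        using s(2)[of k] b by (auto simp: dist_norm)
      then show ?thesis unfolding avg_quot_def by (simp add: algebra_simps diff_divide_distrib)
    qed (simp add: out)
    have "(\<integral>x. avg_quot F b (s k) x * \<psi> x \<partial>lborel) = ((\<integral>x. A k (x + s k *\<^sub>R b) * \<psi> x \<partial>lborel) - (\<integral>x. A k x * \<psi> x \<partial>lborel)) / s k"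
      unfolding local using mult_int[OF iA _ B(1)] mult_int[OF iAs _ B(1)] by simp
    also have "(\<integral>x. A k (x + s k *\<^sub>R b) * \<psi> x \<partial>lborel) = (\<integral>x. A k x * \<psi> (x - s k *\<^sub>R b) \<partial>lborel)"
      using lborel_integral_translate[of "\<lambda>x. A k x * \<psi> (x - s k *\<^sub>R b)" "s k *\<^sub>R b"] by (simp add: add.commute)
    also have "((\<integral>x. A k x * \<psi> (x - s k *\<^sub>R b) \<partial>lborel) - (\<integral>x. A k x * \<psi> x \<partial>lborel)) / s k = (\<integral>x. A k x * d k x \<partial>lborel)"
    proof -
      have i: "integrable lborel (\<lambda>x. A k x * \<psi> (x - s k *\<^sub>R b))" "integrable lborel (\<lambda>x. A k x * \<psi> x)"
        by (rule mult_int[OF iA]; use B(1) in simp)+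
      have "(\<integral>x. A k x * d k x \<partial>lborel) = (\<integral>x. (A k x * \<psi> (x - s k *\<^sub>R b) - A k x * \<psi> x) / s k \<partial>lborel)"
        unfolding d_def by (intro Bochner_Integration.integral_cong) (auto simp: algebra_simps diff_divide_distrib)
      then show ?thesis using i by simp
    qed
    finally have "(\<integral>x. avg_quot F b (s k) x * \<psi> x \<partial>lborel) - (\<integral>x. ?F x * d k x \<partial>lborel) = (\<integral>x. (A k x - ?F x) * d k x \<partial>lborel)"
      using mult_int[OF iA _ dB] mult_int[OF F1 _ dB] by (simp add: left_diff_distrib)
    then have "ennreal \<bar>(\<integral>x. avg_quot F b (s k) x * \<psi> x \<partial>lborel) - (\<integral>x. ?F x * d k x \<partial>lborel)\<bar> \<le> (\<integral>\<^sup>+x. ennreal (norm ((A k x - ?F x) * d k x)) \<partial>lborel)"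
      using norm_integral_le_nn_integral[of lborel "\<lambda>x. (A k x - ?F x) * d k x"] by (simp only: real_norm_def)
    also have "\<dots> \<le> (\<integral>\<^sup>+x. ennreal B * ennreal (norm (A k x - ?F x)) \<partial>lborel)"
    proof (rule nn_integral_mono)
      fix x
      have "norm ((A k x - ?F x) * d k x) \<le> B * norm (A k x - ?F x)"
        unfolding norm_mult using dB[of k x] by (subst mult.commute) (intro mult_right_mono, auto)
      then show "ennreal (norm ((A k x - ?F x) * d k x)) \<le> ennreal B * ennreal (norm (A k x - ?F x))"
        using B0 by (simp add: ennreal_mult[symmetric] ennreal_leI)
    qed
    also have "\<dots> = ennreal B * (\<integral>\<^sup>+x. ennreal (norm (A k x - ?F x)) \<partial>lborel)"
      by (rule nn_integral_cmult) measurable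
    also have "\<dots> = ennreal (B * enn2real (\<integral>\<^sup>+x. ennreal (norm (A k x - ?F x)) \<partial>lborel))"
      using elim(1) B0 by (subst ennreal_mult) (auto simp: less_trans[OF _ ennreal_one_less_top])
    finally show ?case using B0 by (subst (asm) ennreal_le_iff) auto
  qed
  have "(\<lambda>k. enn2real (\<integral>\<^sup>+x. ennreal (norm (A k x - ?F x)) \<partial>lborel)) \<longlonglongrightarrow> 0"
    by (rule tendsto_enn2real) (use L1 in simp_all)
  from tendsto_mult[OF tendsto_const[of B] this]
  have t0: "(\<lambda>k. B * enn2real (\<integral>\<^sup>+x. ennreal (norm (A k x - ?F x)) \<partial>lborel)) \<longlonglongrightarrow> 0" by simp
  have diff: "(\<lambda>k. (\<integral>x. avg_quot F b (s k) x * \<psi> x \<partial>lborel) - (\<integral>x. ?F x * d k x \<partial>lborel)) \<longlonglongrightarrow> 0"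
    by (rule Lim_null_comparison[OF _ t0]) (use main in simp)
  have "(\<lambda>k. \<integral>x. ?F x * d k x \<partial>lborel) \<longlonglongrightarrow> (\<integral>x. ?F x * - frechet_derivative \<psi> (at x) b \<partial>lborel)"
  proof (rule integral_dominated_convergence[where w="\<lambda>x. B * norm (?F x)"])
    show "integrable lborel (\<lambda>x. B * norm (?F x))" using F1 by (intro integrable_mult_right integrable_norm)
    show "AE x in lborel. (\<lambda>k. ?F x * d k x) \<longlonglongrightarrow> ?F x * - frechet_derivative \<psi> (at x) b"
      by (intro AE_I2 tendsto_mult tendsto_const dlim)
    show "AE x in lborel. norm (?F x * d k x) \<le> B * norm (?F x)" for k
      unfolding norm_mult using dB by (intro AE_I2) (subst mult.commute, intro mult_right_mono, auto)
  qed measurable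
  also have "(\<integral>x. ?F x * - frechet_derivative \<psi> (at x) b \<partial>lborel) = (\<integral>x. - (F x * frechet_derivative \<psi> (at x) b) \<partial>lborel)"
  proof (rule Bochner_Integration.integral_cong[OF refl])
    fix x show "?F x * - frechet_derivative \<psi> (at x) b = - (F x * frechet_derivative \<psi> (at x) b)"
    proof (cases "x \<in> K")
      case True
      then have "x \<in> K'" using K'(3) K'(4)[of x] centre_in_cball[of x e] by auto
      then show ?thesis by simp
    qed (simp add: out(2))
  qed
  also have "\<dots> = - (\<integral>x. F x * frechet_derivative \<psi> (at x) b \<partial>lborel)" by simp
  finally have "(\<lambda>k. \<integral>x. ?F x * d k x \<partial>lborel) \<longlonglongrightarrow> - (\<integral>x. F x * frechet_derivative \<psi> (at x) b \<partial>lborel)" .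
  from tendsto_add[OF diff this] show ?thesis by simp
qed

text \<open>The quotients are bounded by \<open>H\<close> only almost everywhere, and at a point
  only once the step is small compared with the distance to the complement. Clipping produces a
  sequence dominated everywhere, which for small steps agrees with the quotients almost everywhere
  on the support of a given test function.\<close>

lemma weak_partial_derivative_exists:
  fixes F H :: "'a::euclidean_space \<Rightarrow> real" and G :: "'a \<Rightarrow> ennreal"
  assumes \<Omega>: "open \<Omega>" and m [measurable]: "F \<in> borel_measurable borel" "G \<in> borel_measurable borel" "H \<in> borel_measurable borel"
    and Fi: "\<And>K. compact K \<Longrightarrow> K \<subseteq> \<Omega> \<Longrightarrow> integrable lborel (\<lambda>y. indicator K y *\<^sub>R F y)"
    and Hi: "\<And>K. compact K \<Longrightarrow> K \<subseteq> \<Omega> \<Longrightarrow> integrable lborel (\<lambda>y. indicator K y *\<^sub>R H y)"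
    and H0: "\<And>x. 0 \<le> H x"
    and H: "AE x in lborel. ennreal (2 ^ (DIM('a) + 2) / unit_ball_vol (real DIM('a))) * fmax 0 G x \<le> ennreal (H x)"
    and seg: "AE x in lborel. x \<in> \<Omega> \<longrightarrow> (\<forall>r>0. ball x r \<subseteq> \<Omega> \<longrightarrow> (AE y in lborel. y \<in> ball x r \<longrightarrow>
       ennreal \<bar>F y - F x\<bar> \<le> ennreal (norm (y - x)) * (\<integral>\<^sup>+t. G (x + t *\<^sub>R (y - x)) * indicator {0..1} t \<partial>lborel)))"
    and b: "b \<in> Basis"
  obtains g where "g \<in> borel_measurable borel" "\<And>x. \<bar>g x\<bar> \<le> H x"
    "\<And>\<psi>. \<psi> \<in> test_functions \<Omega> \<Longrightarrow> (\<integral>x. F x * frechet_derivative \<psi> (at x) b \<partial>lborel) = - (\<integral>x. g x * \<psi> x \<partial>lborel)"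
proof -
  define s where "s k = 1 / real (Suc k)" for k
  have s: "s \<longlonglongrightarrow> 0" "\<And>k. 0 < s k"
    unfolding s_def using LIMSEQ_inverse_real_of_nat by (auto simp: inverse_eq_divide)
  define h where "h k x = max (- H x) (min (H x) (avg_quot F b (s k) x))" for k x
  have hm: "h k \<in> borel_measurable borel" for k unfolding h_def by measurable
  have hH: "\<bar>h k x\<bar> \<le> H x" for k x unfolding h_def using H0[of x] by linarith
  obtain g where g: "g \<in> borel_measurable borel" "\<And>x. \<bar>g x\<bar> \<le> H x"
    "\<And>\<psi> L. \<psi> \<in> borel_measurable borel \<Longrightarrow> integrable lborel (\<lambda>x. H x * \<psi> x) \<Longrightarrow>
      (\<lambda>k. \<integral>x. h k x * \<psi> x \<partial>lborel) \<longlonglongrightarrow> L \<Longrightarrow> (\<integral>x. g x * \<psi> x \<partial>lborel) = L"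
    by (rule weak_limit_dominated[of h H, OF hm hH m(3)]) (rule that)
  show thesis
  proof (rule that[OF g(1,2)])
    fix \<psi> assume \<psi>: "\<psi> \<in> test_functions \<Omega>"
    obtain K B where K: "compact K" "K \<subseteq> \<Omega>" and out: "\<And>x. x \<notin> K \<Longrightarrow> \<psi> x = 0" and B: "\<And>x. \<bar>\<psi> x\<bar> \<le> B"
      using test_functionD(5)[OF \<psi>] by blast
    have \<psi>m [measurable]: "\<psi> \<in> borel_measurable borel" by (rule test_functionD(3)[OF \<psi>])
    have i: "integrable lborel (\<lambda>x. H x * \<psi> x)"
    proof (rule Bochner_Integration.integrable_bound)
      show "integrable lborel (\<lambda>x. B * (indicator K x *\<^sub>R H x))" using Hi[OF K] by (rule integrable_mult_right)
      show "AE x in lborel. norm (H x * \<psi> x) \<le> norm (B * (indicator K x *\<^sub>R H x))"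
      proof (rule AE_I2)
        fix x show "norm (H x * \<psi> x) \<le> norm (B * (indicator K x *\<^sub>R H x))"
        proof (cases "x \<in> K")
          case True
          have "\<bar>H x * \<psi> x\<bar> \<le> \<bar>H x\<bar> * \<bar>B\<bar>" unfolding abs_mult using B[of x] by (intro mult_left_mono) auto
          then show ?thesis using True by (simp add: abs_mult mult.commute)
        qed (simp add: out)
      qed
    qed measurable
    obtain K' e where K': "compact K'" "K' \<subseteq> \<Omega>" "0 < e" "\<And>x. x \<in> K \<Longrightarrow> cball x e \<subseteq> K'"
      using compact_neighbourhood[OF K(1) \<Omega> K(2)] by blast
    have "eventually (\<lambda>k. s k < e / 2) sequentially"
      using s(1) by (rule order_tendstoD) (use K'(3) in simp)
    then have "eventually (\<lambda>k. (\<integral>x. avg_quot F b (s k) x * \<psi> x \<partial>lborel) = (\<integral>x. h k x * \<psi> x \<partial>lborel)) sequentially"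
    proof eventually_elim
      case (elim k)
      have [measurable]: "h k \<in> borel_measurable borel" by (rule hm)
      show ?case
      proof (rule integral_cong_AE)
        show "AE x in lborel. avg_quot F b (s k) x * \<psi> x = h k x * \<psi> x"
          using seg H
        proof eventually_elim
          case (elim x)
          show ?case
          proof (cases "x \<in> K")
            case True
            have "ball x (2 * s k) \<subseteq> cball x e" using \<open>s k < e / 2\<close> by auto
            then have sub: "ball x (2 * s k) \<subseteq> K'" using K'(4)[OF True] by blast
            have "integrable lborel (\<lambda>y. indicator (cball x e) y *\<^sub>R F y)" using K'(2,4) True by (intro Fi) auto
            then have Fb: "integrable lborel (\<lambda>y. indicator (ball x (2 * s k)) y *\<^sub>R F y)"
            proof (rule Bochner_Integration.integrable_bound)
              show "AE y in lborel. norm (indicator (ball x (2 * s k)) y *\<^sub>R F y) \<le> norm (indicator (cball x e) y *\<^sub>R F y)"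
                using \<open>ball x (2 * s k) \<subseteq> cball x e\<close> by (intro AE_I2) (auto split: split_indicator)
            qed measurable
            have sg: "AE y in lborel. y \<in> ball x (2 * s k) \<longrightarrow> ennreal \<bar>F y - F x\<bar> \<le> ennreal (norm (y - x)) * (\<integral>\<^sup>+t. G (x + t *\<^sub>R (y - x)) * indicator {0..1} t \<partial>lborel)"
            proof -
              have "x \<in> \<Omega>" "0 < 2 * s k" "ball x (2 * s k) \<subseteq> \<Omega>" using True K(2) sub K'(2) s(2)[of k] by auto
              with elim(1) show ?thesis by blast
            qed
            have "ennreal \<bar>avg_quot F b (s k) x\<bar> \<le> ennreal (2 ^ (DIM('a) + 2) / unit_ball_vol (real DIM('a))) * fmax 0 G x"
              using b by (intro avg_quot_bound[OF m(1,2) s(2) _ Fb sg]) simp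
            also note elim(2)
            finally have "\<bar>avg_quot F b (s k) x\<bar> \<le> H x" using H0[of x] by (simp add: ennreal_le_iff)
            then have "h k x = avg_quot F b (s k) x" unfolding h_def by linarith
            then show ?thesis by simp
          qed (simp add: out)
        qed
      qed measurable
    qed
    with avg_quot_weak_limit[OF \<Omega> m(1) Fi \<psi> b s]
    have "(\<lambda>k. \<integral>x. h k x * \<psi> x \<partial>lborel) \<longlonglongrightarrow> - (\<integral>x. F x * frechet_derivative \<psi> (at x) b \<partial>lborel)"
      by (rule Lim_transform_eventually)
    from g(3)[OF \<psi>m i this]
    show "(\<integral>x. F x * frechet_derivative \<psi> (at x) b \<partial>lborel) = - (\<integral>x. g x * \<psi> x \<partial>lborel)" by simp
  qed
qed

text \<open>One coordinate at a time; adding up the bounds of the coordinates gives the factor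
  \<open>DIM('a)\<close>.\<close>

lemma weak_gradient_exists:
  fixes F H :: "'a::euclidean_space \<Rightarrow> real" and G :: "'a \<Rightarrow> ennreal"
  assumes \<Omega>: "open \<Omega>" and m: "F \<in> borel_measurable borel" "G \<in> borel_measurable borel" "H \<in> borel_measurable borel"
    and Fi: "\<And>K. compact K \<Longrightarrow> K \<subseteq> \<Omega> \<Longrightarrow> integrable lborel (\<lambda>y. indicator K y *\<^sub>R F y)"
    and Hi: "\<And>K. compact K \<Longrightarrow> K \<subseteq> \<Omega> \<Longrightarrow> integrable lborel (\<lambda>y. indicator K y *\<^sub>R H y)"
    and H0: "\<And>x. 0 \<le> H x"
    and H: "AE x in lborel. ennreal (2 ^ (DIM('a) + 2) / unit_ball_vol (real DIM('a))) * fmax 0 G x \<le> ennreal (H x)"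
    and seg: "AE x in lborel. x \<in> \<Omega> \<longrightarrow> (\<forall>r>0. ball x r \<subseteq> \<Omega> \<longrightarrow> (AE y in lborel. y \<in> ball x r \<longrightarrow>
       ennreal \<bar>F y - F x\<bar> \<le> ennreal (norm (y - x)) * (\<integral>\<^sup>+t. G (x + t *\<^sub>R (y - x)) * indicator {0..1} t \<partial>lborel)))"
  obtains g where "g \<in> borel_measurable borel" "\<And>x. norm (g x) \<le> real DIM('a) * H x" "is_wgrad \<Omega> F g"
proof -
  have "\<exists>g. g \<in> borel_measurable borel \<and> (\<forall>x. \<bar>g x\<bar> \<le> H x) \<and>
    (\<forall>\<psi>\<in>test_functions \<Omega>. (\<integral>x. F x * frechet_derivative \<psi> (at x) b \<partial>lborel) = - (\<integral>x. g x * \<psi> x \<partial>lborel))" if b: "b \<in> Basis" for b :: 'a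
  proof -
    obtain g where "g \<in> borel_measurable borel" "\<And>x. \<bar>g x\<bar> \<le> H x"
      "\<And>\<psi>. \<psi> \<in> test_functions \<Omega> \<Longrightarrow> (\<integral>x. F x * frechet_derivative \<psi> (at x) b \<partial>lborel) = - (\<integral>x. g x * \<psi> x \<partial>lborel)"
      by (rule weak_partial_derivative_exists[OF \<Omega> m Fi Hi H0 H seg b], assumption, assumption, assumption, assumption, rule that)
    then show ?thesis by blast
  qed
  then have "\<forall>b\<in>Basis. \<exists>g. g \<in> borel_measurable borel \<and> (\<forall>x. \<bar>g x\<bar> \<le> H x) \<and>
    (\<forall>\<psi>\<in>test_functions \<Omega>. (\<integral>x. F x * frechet_derivative \<psi> (at x) b \<partial>lborel) = - (\<integral>x. g x * \<psi> x \<partial>lborel))" by blast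
  from bchoice[OF this] obtain g where g: "\<And>b. b \<in> Basis \<Longrightarrow> g b \<in> borel_measurable borel" "\<And>b x. b \<in> Basis \<Longrightarrow> \<bar>g b x\<bar> \<le> H x"
    "\<And>b \<psi>. b \<in> Basis \<Longrightarrow> \<psi> \<in> test_functions \<Omega> \<Longrightarrow> (\<integral>x. F x * frechet_derivative \<psi> (at x) b \<partial>lborel) = - (\<integral>x. g b x * \<psi> x \<partial>lborel)"
    by auto
  define gg where "gg x = (\<Sum>b\<in>Basis. g b x *\<^sub>R b)" for x
  have inner: "gg x \<bullet> b = g b x" if "b \<in> Basis" for b x
    unfolding gg_def using that by (simp add: inner_sum_left_Basis)
  show thesis
  proof (rule that[of gg])
    show "gg \<in> borel_measurable borel"
      unfolding gg_def[abs_def] using g(1) by (intro borel_measurable_sum borel_measurable_scaleR) auto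
    show "norm (gg x) \<le> real DIM('a) * H x" for x
    proof -
      have "norm (gg x) \<le> (\<Sum>b\<in>Basis. \<bar>gg x \<bullet> b\<bar>)" by (rule norm_le_l1)
      also have "\<dots> \<le> (\<Sum>b\<in>(Basis::'a set). H x)" by (rule sum_mono) (simp add: inner g(2))
      finally show ?thesis by simp
    qed
    show "is_wgrad \<Omega> F gg"
      unfolding is_wgrad_def
    proof (intro ballI)
      fix \<psi> and b :: 'a assume \<psi>: "\<psi> \<in> test_functions \<Omega>" and b: "b \<in> Basis"
      show "(\<integral>x. F x * frechet_derivative \<psi> (at x) b \<partial>lborel) = - (\<integral>x. (gg x \<bullet> b) * \<psi> x \<partial>lborel)"
        unfolding inner[OF b] by (rule g(3)[OF b \<psi>])
    qed
  qed
qed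

section \<open>Passing between Lebesgue and Borel measurable functions\<close>

text \<open>Borel representatives, extended by zero, replace Lebesgue measurable functions on \<open>\<Omega>\<close>; Tonelli's theorem needs
  the product \<open>\<sigma>\<close>-algebra.\<close>

definition borel_rep :: "'a::euclidean_space set \<Rightarrow> ('a \<Rightarrow> 'b::euclidean_space) \<Rightarrow> ('a \<Rightarrow> 'b) \<Rightarrow> bool" where
  "borel_rep \<Omega> u u0 \<longleftrightarrow> u0 \<in> borel_measurable borel \<and> (\<forall>x. x \<notin> \<Omega> \<longrightarrow> u0 x = 0) \<and> (AE x in lborel. x \<in> \<Omega> \<longrightarrow> u x = u0 x)"

lemma borel_rep_AE:
  assumes "borel_rep \<Omega> u u0" shows "AE x in lebesgue. u0 x = indicator \<Omega> x *\<^sub>R u x"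
proof -
  have "AE x in lborel. u0 x = indicator \<Omega> x *\<^sub>R u x"
    using assms unfolding borel_rep_def
    by (elim conjE eventually_mono) (auto simp: indicator_def)
  then show ?thesis by (simp add: AE_completion_iff)
qed

lemma borel_rep_measurable:
  assumes "\<Omega> \<in> sets borel" "borel_rep \<Omega> u u0" shows "u \<in> borel_measurable (lebesgue_on \<Omega>)"
proof -
  have "u0 \<in> borel_measurable lebesgue" using assms(2) by (auto simp: borel_rep_def intro: measurable_completion)
  then have "(\<lambda>x. indicator \<Omega> x *\<^sub>R u x) \<in> borel_measurable lebesgue"
    by (rule borel_measurable_AE) (rule borel_rep_AE[OF assms(2)])
  then show ?thesis using assms(1) by (subst borel_measurable_restrict_space_iff) auto
qed

text \<open>Each coordinate of the extension by zero agrees almost everywhere with a Borel function.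
  Multiplying by the indicator once more makes the result vanish at every point outside
  \<open>\<Omega>\<close>, not just at almost every one.\<close>

lemma borel_rep_exists:
  fixes u :: "'a::euclidean_space \<Rightarrow> 'b::euclidean_space"
  assumes \<Omega> [measurable]: "\<Omega> \<in> sets borel" and u: "u \<in> borel_measurable (lebesgue_on \<Omega>)"
  obtains u0 where "borel_rep \<Omega> u u0"
proof -
  have "(\<lambda>x. indicator \<Omega> x *\<^sub>R u x) \<in> borel_measurable lebesgue"
    using u \<Omega> by (subst (asm) borel_measurable_restrict_space_iff) auto
  then have "(\<lambda>x. (indicator \<Omega> x *\<^sub>R u x) \<bullet> b) \<in> borel_measurable (completion lborel)" for b
    by (intro borel_measurable_inner) auto
  then have "\<forall>b. \<exists>g. g \<in> borel_measurable lborel \<and> (AE x in lborel. (indicator \<Omega> x *\<^sub>R u x) \<bullet> b = g x)"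
    using completion_ex_borel_measurable_real by blast
  then obtain g where g: "\<And>b. g b \<in> borel_measurable lborel" "\<And>b. AE x in lborel. (indicator \<Omega> x *\<^sub>R u x) \<bullet> b = g b x"
    by metis
  have [measurable]: "g b \<in> borel_measurable borel" for b using g(1) by simp
  define u0 where "u0 x = indicator \<Omega> x *\<^sub>R (\<Sum>b\<in>Basis. g b x *\<^sub>R b)" for x
  have "AE x in lborel. \<forall>b\<in>Basis. (indicator \<Omega> x *\<^sub>R u x) \<bullet> b = g b x"
    using g(2) by (intro AE_finite_allI) auto
  then have "AE x in lborel. x \<in> \<Omega> \<longrightarrow> u x = u0 x"
  proof eventually_elim
    case (elim x)
    show ?case
    proof
      assume x: "x \<in> \<Omega>"
      then have "u x = (\<Sum>b\<in>Basis. (u x \<bullet> b) *\<^sub>R b)" by (simp add: euclidean_representation)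
      also have "\<dots> = (\<Sum>b\<in>Basis. g b x *\<^sub>R b)" using elim x by (intro sum.cong) auto
      finally show "u x = u0 x" using x by (simp add: u0_def)
    qed
  qed
  moreover have "u0 \<in> borel_measurable borel" unfolding u0_def[abs_def] by measurable
  ultimately have "borel_rep \<Omega> u u0" by (simp add: borel_rep_def u0_def)
  then show thesis by (rule that)
qed

lemma borel_rep_integral:
  assumes \<Omega>: "\<Omega> \<in> sets borel" and r: "borel_rep \<Omega> u u0"
  shows "(\<integral>x. u x \<partial>lebesgue_on \<Omega>) = (\<integral>x. u0 x \<partial>lborel)" "integrable (lebesgue_on \<Omega>) u \<longleftrightarrow> integrable lborel u0"
    "(\<integral>\<^sup>+x. ennreal (norm (u x) powr p) \<partial>lebesgue_on \<Omega>) = (\<integral>\<^sup>+x. epow (ennreal (norm (u0 x))) p \<partial>lborel)"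
    "(\<integral>\<^sup>+x. ennreal (norm (u x)) \<partial>lebesgue_on \<Omega>) = (\<integral>\<^sup>+x. ennreal (norm (u0 x)) \<partial>lborel)"
proof -
  have m0: "u0 \<in> borel_measurable lborel" using r by (simp add: borel_rep_def)
  have m1: "u0 \<in> borel_measurable lebesgue" using m0 by (rule measurable_completion)
  have m2: "(\<lambda>x. indicator \<Omega> x *\<^sub>R u x) \<in> borel_measurable lebesgue"
    using borel_rep_measurable[OF \<Omega> r] \<Omega> by (subst (asm) borel_measurable_restrict_space_iff) auto
  note ae = borel_rep_AE[OF r]
  have \<Omega>l: "\<Omega> \<inter> space lebesgue \<in> sets lebesgue" using \<Omega> by simp
  have "(\<integral>x. u x \<partial>lebesgue_on \<Omega>) = (\<integral>x. indicator \<Omega> x *\<^sub>R u x \<partial>lebesgue)"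
    by (rule integral_restrict_space[OF \<Omega>l])
  also have "\<dots> = (\<integral>x. u0 x \<partial>lebesgue)" by (rule integral_cong_AE[OF m2 m1]) (use ae in eventually_elim, simp)
  also have "\<dots> = (\<integral>x. u0 x \<partial>lborel)" by (rule integral_completion[OF m0])
  finally show "(\<integral>x. u x \<partial>lebesgue_on \<Omega>) = (\<integral>x. u0 x \<partial>lborel)" .
  have "integrable (lebesgue_on \<Omega>) u \<longleftrightarrow> integrable lebesgue (\<lambda>x. indicator \<Omega> x *\<^sub>R u x)"
    by (rule integrable_restrict_space[OF \<Omega>l])
  also have "\<dots> \<longleftrightarrow> integrable lebesgue u0" by (rule integrable_cong_AE[OF m2 m1]) (use ae in eventually_elim, simp)
  also have "\<dots> \<longleftrightarrow> integrable lborel u0" by (rule integrable_completion[OF m0])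
  finally show "integrable (lebesgue_on \<Omega>) u \<longleftrightarrow> integrable lborel u0" .
  have nn: "(\<integral>\<^sup>+x. \<phi> (u x) \<partial>lebesgue_on \<Omega>) = (\<integral>\<^sup>+x. \<phi> (u0 x) \<partial>lborel)" if 0: "\<phi> 0 = 0" for \<phi> :: "'b \<Rightarrow> ennreal"
  proof -
    have "(\<integral>\<^sup>+x. \<phi> (u x) \<partial>lebesgue_on \<Omega>) = (\<integral>\<^sup>+x. \<phi> (u x) * indicator \<Omega> x \<partial>lebesgue)"
      by (rule nn_integral_restrict_space[OF \<Omega>l])
    also have "\<dots> = (\<integral>\<^sup>+x. \<phi> (u0 x) \<partial>lebesgue)"
      by (rule nn_integral_cong_AE) (use ae in eventually_elim, simp add: 0 split: split_indicator)
    also have "\<dots> = (\<integral>\<^sup>+x. \<phi> (u0 x) \<partial>lborel)" by (rule nn_integral_completion)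
    finally show ?thesis .
  qed
  show "(\<integral>\<^sup>+x. ennreal (norm (u x)) \<partial>lebesgue_on \<Omega>) = (\<integral>\<^sup>+x. ennreal (norm (u0 x)) \<partial>lborel)"
    by (rule nn) simp
  show "(\<integral>\<^sup>+x. ennreal (norm (u x) powr p) \<partial>lebesgue_on \<Omega>) = (\<integral>\<^sup>+x. epow (ennreal (norm (u0 x))) p \<partial>lborel)"
    using nn[of "\<lambda>y. ennreal (norm y powr p)"] by (simp add: epow_ennreal)
qed

lemma borel_rep_Lp:
  assumes \<Omega>: "\<Omega> \<in> sets borel" and r: "borel_rep \<Omega> u u0" and p: "0 < p"
  shows "u \<in> Lp_space p \<Omega> \<longleftrightarrow> eLp p (\<lambda>x. ennreal (norm (u0 x))) < top"
    "u \<in> Lp_space p \<Omega> \<Longrightarrow> ennreal (Lp_norm p \<Omega> u) = eLp p (\<lambda>x. ennreal (norm (u0 x)))"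
proof -
  have m: "u \<in> borel_measurable (lebesgue_on \<Omega>)" by (rule borel_rep_measurable[OF \<Omega> r])
  then have mp: "(\<lambda>x. norm (u x) powr p) \<in> borel_measurable (lebesgue_on \<Omega>)" by measurable
  have eq: "(\<integral>\<^sup>+x. ennreal (norm (norm (u x) powr p)) \<partial>lebesgue_on \<Omega>) = (\<integral>\<^sup>+x. epow (ennreal (norm (u0 x))) p \<partial>lborel)"
    using borel_rep_integral(3)[OF \<Omega> r, of p] by simp
  have "u \<in> Lp_space p \<Omega> \<longleftrightarrow> (\<integral>\<^sup>+x. ennreal (norm (norm (u x) powr p)) \<partial>lebesgue_on \<Omega>) < \<infinity>"
    using m mp by (simp add: Lp_space_def integrable_iff_bounded)
  also have "\<dots> \<longleftrightarrow> (\<integral>\<^sup>+x. epow (ennreal (norm (u0 x))) p \<partial>lborel) \<noteq> top" unfolding eq by (simp add: less_top)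
  also have "\<dots> \<longleftrightarrow> eLp p (\<lambda>x. ennreal (norm (u0 x))) < top" by (simp add: eLp_def top.not_eq_extremum[symmetric])
  finally show "u \<in> Lp_space p \<Omega> \<longleftrightarrow> eLp p (\<lambda>x. ennreal (norm (u0 x))) < top" .
  assume "u \<in> Lp_space p \<Omega>"
  then have "integrable (lebesgue_on \<Omega>) (\<lambda>x. norm (u x) powr p)" by (simp add: Lp_space_def)
  then have "(\<integral>\<^sup>+x. ennreal (norm (u x) powr p) \<partial>lebesgue_on \<Omega>) = ennreal (\<integral>x. norm (u x) powr p \<partial>lebesgue_on \<Omega>)"
    by (intro nn_integral_eq_integral) auto
  then show "ennreal (Lp_norm p \<Omega> u) = eLp p (\<lambda>x. ennreal (norm (u0 x)))"
    unfolding eLp_def borel_rep_integral(3)[OF \<Omega> r, symmetric] Lp_norm_def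
    by (simp add: epow_ennreal)
qed

text \<open>By \<open>t \<le> 1 + t powr p\<close> the integral over \<open>K\<close> is at most the
  measure of \<open>K\<close> plus the integral of the \<open>p\<close>-th power.\<close>

lemma eLp_locally_integrable:
  fixes u :: "'a::euclidean_space \<Rightarrow> 'b::euclidean_space"
  assumes [measurable]: "u \<in> borel_measurable borel" and p: "1 \<le> p" and fin: "eLp p (\<lambda>x. ennreal (norm (u x))) < top" and K: "compact K"
  shows "integrable lborel (\<lambda>x. indicator K x *\<^sub>R u x)"
proof (rule integrableI_bounded)
  have [measurable]: "K \<in> sets borel" using K by (intro borel_closed compact_imp_closed)
  show "(\<lambda>x. indicator K x *\<^sub>R u x) \<in> borel_measurable lborel" by measurable
  have le: "t \<le> 1 + t powr p" if "0 \<le> t" for t :: real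
  proof (cases "t \<le> 1")
    case False
    then have "t powr 1 \<le> t powr p" using p by (intro powr_mono) auto
    then show ?thesis using that by simp
  qed (simp add: add_increasing2)
  have "(\<integral>\<^sup>+x. ennreal (norm (indicator K x *\<^sub>R u x)) \<partial>lborel) \<le> (\<integral>\<^sup>+x. indicator K x + epow (ennreal (norm (u x))) p \<partial>lborel)"
  proof (rule nn_integral_mono)
    fix x
    have "ennreal (norm (u x)) \<le> 1 + epow (ennreal (norm (u x))) p"
      using le[of "norm (u x)"] by (simp add: epow_ennreal ennreal_plus[symmetric] ennreal_leI ennreal_1[symmetric] del: ennreal_plus ennreal_1)
    then show "ennreal (norm (indicator K x *\<^sub>R u x)) \<le> indicator K x + epow (ennreal (norm (u x))) p"
      by (auto split: split_indicator)
  qed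
  also have "\<dots> = emeasure lborel K + (\<integral>\<^sup>+x. epow (ennreal (norm (u x))) p \<partial>lborel)"
    by (simp add: nn_integral_add)
  also have "\<dots> < \<infinity>"
    using fin emeasure_compact_finite[OF K] by (simp add: eLp_def top.not_eq_extremum[symmetric] less_top[symmetric])
  finally show "(\<integral>\<^sup>+x. ennreal (norm (indicator K x *\<^sub>R u x)) \<partial>lborel) < \<infinity>" .
qed

lemma borel_rep_subset: "borel_rep \<Omega> u u0 \<Longrightarrow> K \<subseteq> \<Omega> \<Longrightarrow> K \<in> sets borel \<Longrightarrow> borel_rep K u (\<lambda>x. indicator K x *\<^sub>R u0 x)"
  unfolding borel_rep_def by (auto elim!: eventually_mono)

lemma locally_integrable_borel_rep:
  assumes "borel_rep \<Omega> u u0"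
  shows "locally_integrable \<Omega> u \<longleftrightarrow> (\<forall>K. compact K \<longrightarrow> K \<subseteq> \<Omega> \<longrightarrow> integrable lborel (\<lambda>x. indicator K x *\<^sub>R u0 x))"
proof -
  have "integrable (lebesgue_on K) u \<longleftrightarrow> integrable lborel (\<lambda>x. indicator K x *\<^sub>R u0 x)" if "compact K" "K \<subseteq> \<Omega>" for K
  proof -
    have K: "K \<in> sets borel" using that(1) by (intro borel_closed compact_imp_closed)
    show ?thesis by (rule borel_rep_integral(2)[OF K borel_rep_subset[OF assms that(2) K]])
  qed
  then show ?thesis unfolding locally_integrable_def by blast
qed

text \<open>Local integrability provides measurability on each compact subset; an exhaustion carries
  it over to \<open>\<Omega>\<close>. A weak gradient obtained by choice is known to be measurable
  only in this way.\<close>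

lemma locally_integrable_measurable:
  fixes u :: "'a::euclidean_space \<Rightarrow> 'b::euclidean_space"
  assumes \<Omega>: "open \<Omega>" and u: "locally_integrable \<Omega> u"
  shows "u \<in> borel_measurable (lebesgue_on \<Omega>)"
proof -
  obtain C where C: "\<And>n::nat. compact (C n)" "\<And>n. C n \<subseteq> \<Omega>" "\<And>n. C n \<subseteq> interior (C (Suc n))" "\<Union> (range C) = \<Omega>"
    using open_Union_compact_subsets[OF \<Omega>] by metis
  have Cb: "C n \<in> sets borel" for n using C(1) by (intro borel_closed compact_imp_closed)
  have mono: "C m \<subseteq> C n" if "m \<le> n" for m n
  proof (rule lift_Suc_mono_le[of C, OF _ that])
    show "C n \<subseteq> C (Suc n)" for n by (rule order_trans[OF C(3) interior_subset])
  qed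
  have "(\<lambda>x. indicator \<Omega> x *\<^sub>R u x) \<in> borel_measurable lebesgue"
  proof (rule borel_measurable_LIMSEQ_metric)
    show "(\<lambda>x. indicator (C n) x *\<^sub>R u x) \<in> borel_measurable lebesgue" for n
    proof -
      have "integrable (lebesgue_on (C n)) u" using u C(1,2)[of n] by (simp add: locally_integrable_def)
      then have "u \<in> borel_measurable (lebesgue_on (C n))" by auto
      then show ?thesis using Cb[of n] by (subst (asm) borel_measurable_restrict_space_iff) auto
    qed
    fix x
    show "(\<lambda>n. indicator (C n) x *\<^sub>R u x) \<longlonglongrightarrow> indicator \<Omega> x *\<^sub>R u x"
    proof (cases "x \<in> \<Omega>")
      case True
      then obtain m where "x \<in> C m" using C(4) by auto
      then have "eventually (\<lambda>n. indicator (C n) x *\<^sub>R u x = indicator \<Omega> x *\<^sub>R u x) sequentially"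
        using mono True by (intro eventually_sequentiallyI[of m]) (auto simp: indicator_def)
      then show ?thesis by (rule tendsto_eventually)
    next
      case False
      then have "x \<notin> C n" for n using C(2) by auto
      then show ?thesis using False by simp
    qed
  qed
  then show ?thesis using \<Omega> by (subst borel_measurable_restrict_space_iff) auto
qed

lemma borel_rep_mult:
  fixes u \<phi> :: "'a::euclidean_space \<Rightarrow> real"
  assumes "borel_rep \<Omega> u u0" and [measurable]: "\<phi> \<in> borel_measurable borel"
  shows "borel_rep \<Omega> (\<lambda>x. u x * \<phi> x) (\<lambda>x. u0 x * \<phi> x)"
proof -
  have [measurable]: "u0 \<in> borel_measurable borel" using assms(1) by (simp add: borel_rep_def)
  have "(\<lambda>x. u0 x * \<phi> x) \<in> borel_measurable borel" by measurable
  then show ?thesis using assms(1) unfolding borel_rep_def by (auto elim!: eventually_mono)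
qed

lemma borel_rep_inner:
  assumes "borel_rep \<Omega> u u0"
  shows "borel_rep \<Omega> (\<lambda>x. u x \<bullet> b) (\<lambda>x. u0 x \<bullet> b)"
proof -
  have [measurable]: "u0 \<in> borel_measurable borel" using assms(1) by (simp add: borel_rep_def)
  have "(\<lambda>x. u0 x \<bullet> b) \<in> borel_measurable borel" by measurable
  then show ?thesis using assms(1) unfolding borel_rep_def by (auto elim!: eventually_mono)
qed

lemma weak_gradient_borel_rep:
  assumes \<Omega>: "open \<Omega>" and f: "borel_rep \<Omega> f f0" and g: "borel_rep \<Omega> g g0"
  shows "is_weak_gradient \<Omega> f g \<longleftrightarrow> locally_integrable \<Omega> f \<and> locally_integrable \<Omega> g \<and> is_wgrad \<Omega> f0 g0"
proof -
  have \<Omega>b: "\<Omega> \<in> sets borel" using \<Omega> by simp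
  have 1: "(\<integral>x. f x * frechet_derivative \<psi> (at x) b \<partial>lebesgue_on \<Omega>) = (\<integral>x. f0 x * frechet_derivative \<psi> (at x) b \<partial>lborel)"
    if "\<psi> \<in> test_functions \<Omega>" "b \<in> Basis" for \<psi> b
    by (rule borel_rep_integral(1)[OF \<Omega>b borel_rep_mult[OF f test_functionD(4)[OF that]]])
  have 2: "(\<integral>x. (g x \<bullet> b) * \<psi> x \<partial>lebesgue_on \<Omega>) = (\<integral>x. (g0 x \<bullet> b) * \<psi> x \<partial>lborel)"
    if "\<psi> \<in> test_functions \<Omega>" for \<psi> b
    by (rule borel_rep_integral(1)[OF \<Omega>b borel_rep_mult[OF borel_rep_inner[OF g] test_functionD(3)[OF that]]])
  have "(\<forall>\<psi>\<in>test_functions \<Omega>. \<forall>b\<in>Basis. (\<integral>x. f x * frechet_derivative \<psi> (at x) b \<partial>lebesgue_on \<Omega>) = - (\<integral>x. (g x \<bullet> b) * \<psi> x \<partial>lebesgue_on \<Omega>))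
    \<longleftrightarrow> is_wgrad \<Omega> f0 g0"
    unfolding is_wgrad_def by (intro ball_cong refl) (simp only: 1 2)
  then show ?thesis unfolding is_weak_gradient_def by (simp only:)
qed

lemma integrable_mult_test_function:
  fixes u :: "'a::euclidean_space \<Rightarrow> real"
  assumes [measurable]: "u \<in> borel_measurable borel" and \<psi>: "\<psi> \<in> test_functions \<Omega>"
    and loc: "\<And>K. compact K \<Longrightarrow> K \<subseteq> \<Omega> \<Longrightarrow> integrable lborel (\<lambda>y. indicator K y *\<^sub>R u y)"
  shows "integrable lborel (\<lambda>x. u x * \<psi> x)"
proof -
  obtain K B where K: "compact K" "K \<subseteq> \<Omega>" and out: "\<And>x. x \<notin> K \<Longrightarrow> \<psi> x = 0" and B: "\<And>x. \<bar>\<psi> x\<bar> \<le> B"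
    using test_functionD(5)[OF \<psi>] by blast
  have [measurable]: "\<psi> \<in> borel_measurable borel" by (rule test_functionD(3)[OF \<psi>])
  show ?thesis
  proof (rule Bochner_Integration.integrable_bound)
    show "integrable lborel (\<lambda>x. B * (indicator K x *\<^sub>R u x))" using loc[OF K] by (rule integrable_mult_right)
    show "AE x in lborel. norm (u x * \<psi> x) \<le> norm (B * (indicator K x *\<^sub>R u x))"
    proof (rule AE_I2)
      fix x show "norm (u x * \<psi> x) \<le> norm (B * (indicator K x *\<^sub>R u x))"
      proof (cases "x \<in> K")
        case True
        have "\<bar>u x * \<psi> x\<bar> \<le> \<bar>u x\<bar> * \<bar>B\<bar>" unfolding abs_mult using B[of x] by (intro mult_left_mono) auto
        then show ?thesis using True by (simp add: abs_mult mult.commute)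
      qed (simp add: out)
    qed
  qed measurable
qed

text \<open>\<open>weak_gradient\<close> is an arbitrary choice; by this lemma the representative of
  a constructed gradient also represents the chosen one. The coordinates of the difference integrate
  to 0 against every test function.\<close>

lemma weak_gradient_unique:
  fixes f :: "'a::euclidean_space \<Rightarrow> real"
  assumes \<Omega>: "open \<Omega>" and g: "is_weak_gradient \<Omega> f g" and r: "borel_rep \<Omega> h h0" and h: "is_weak_gradient \<Omega> f h"
  shows "borel_rep \<Omega> g h0"
proof -
  have \<Omega>b: "\<Omega> \<in> sets borel" using \<Omega> by simp
  have l: "locally_integrable \<Omega> f" "locally_integrable \<Omega> g" "locally_integrable \<Omega> h"
    using g h by (auto simp: is_weak_gradient_def)
  obtain f0 where f0: "borel_rep \<Omega> f f0" by (rule borel_rep_exists[OF \<Omega>b locally_integrable_measurable[OF \<Omega> l(1)]])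
  obtain g0 where g0: "borel_rep \<Omega> g g0" by (rule borel_rep_exists[OF \<Omega>b locally_integrable_measurable[OF \<Omega> l(2)]])
  have w: "is_wgrad \<Omega> f0 g0" "is_wgrad \<Omega> f0 h0"
    using g h weak_gradient_borel_rep[OF \<Omega> f0 g0] weak_gradient_borel_rep[OF \<Omega> f0 r] by auto
  have [measurable]: "g0 \<in> borel_measurable borel" "h0 \<in> borel_measurable borel"
    using g0 r by (auto simp: borel_rep_def)
  have loc: "integrable lborel (\<lambda>y. indicator K y *\<^sub>R (g0 y \<bullet> b))" "integrable lborel (\<lambda>y. indicator K y *\<^sub>R (h0 y \<bullet> b))"
    if "compact K" "K \<subseteq> \<Omega>" for K b
  proof -
    have "integrable lborel (\<lambda>y. (indicator K y *\<^sub>R g0 y) \<bullet> b)" "integrable lborel (\<lambda>y. (indicator K y *\<^sub>R h0 y) \<bullet> b)"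
      using l locally_integrable_borel_rep[OF g0] locally_integrable_borel_rep[OF r] that
      by (auto intro!: integrable_inner_left simp del: inner_scaleR_left)
    then show "integrable lborel (\<lambda>y. indicator K y *\<^sub>R (g0 y \<bullet> b))" "integrable lborel (\<lambda>y. indicator K y *\<^sub>R (h0 y \<bullet> b))" by simp_all
  qed
  have zero: "AE x in lborel. x \<in> \<Omega> \<longrightarrow> g0 x \<bullet> b - h0 x \<bullet> b = 0" if b: "b \<in> Basis" for b
  proof (rule test_function_vanishing[OF \<Omega>])
    show "integrable lborel (\<lambda>y. indicator K y *\<^sub>R (g0 y \<bullet> b - h0 y \<bullet> b))" if "compact K" "K \<subseteq> \<Omega>" for K
      using Bochner_Integration.integrable_diff[OF loc[OF that, of b]] by (simp add: right_diff_distrib)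
    fix \<psi> assume \<psi>: "\<psi> \<in> test_functions \<Omega>"
    have i: "integrable lborel (\<lambda>x. (g0 x \<bullet> b) * \<psi> x)" "integrable lborel (\<lambda>x. (h0 x \<bullet> b) * \<psi> x)"
      by (rule integrable_mult_test_function[OF _ \<psi> loc(1)]; measurable)
         (rule integrable_mult_test_function[OF _ \<psi> loc(2)]; measurable)
    have "(\<integral>x. (g0 x \<bullet> b) * \<psi> x \<partial>lborel) = (\<integral>x. (h0 x \<bullet> b) * \<psi> x \<partial>lborel)"
      using w(1)[unfolded is_wgrad_def, rule_format, OF \<psi> b] w(2)[unfolded is_wgrad_def, rule_format, OF \<psi> b] by linarith
    then show "(\<integral>x. (g0 x \<bullet> b - h0 x \<bullet> b) * \<psi> x \<partial>lborel) = 0" using i by (simp add: left_diff_distrib)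
  qed
  have "AE x in lborel. \<forall>b\<in>Basis. x \<in> \<Omega> \<longrightarrow> g0 x \<bullet> b - h0 x \<bullet> b = 0"
    by (rule AE_finite_allI) (use zero in auto)
  moreover have "AE x in lborel. x \<in> \<Omega> \<longrightarrow> g x = g0 x" using g0 by (simp add: borel_rep_def)
  ultimately have "AE x in lborel. x \<in> \<Omega> \<longrightarrow> g x = h0 x"
    by eventually_elim (auto intro: euclidean_eqI)
  then show ?thesis using r by (simp add: borel_rep_def)
qed

section \<open>The local maximal operator\<close>

text \<open>The factor in front of the integral, with \<open>r powr (- DIM('a))\<close> split off
  for \<open>unit_avg\<close>. In exponential form its derivative is the function itself times the
  derivative of the exponent.\<close>

definition weight :: "'a::euclidean_space itself \<Rightarrow> real \<Rightarrow> real \<Rightarrow> real \<Rightarrow> real" where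
  "weight _ \<gamma> \<beta> r = exp (\<beta> * ln r + \<gamma> * \<beta> / real DIM('a) * ln (1 + r ^ DIM('a))
     - \<gamma> * ln (1 + unit_ball_vol (real DIM('a)) * r ^ DIM('a))) / unit_ball_vol (real DIM('a))"

lemma weight_eq:
  fixes x :: "'a::euclidean_space"
  assumes r: "0 < r"
  shows "r powr \<beta> * (1 + r ^ DIM('a)) powr (\<gamma> * \<beta> / real DIM('a)) /
      (phi \<gamma> (measure lebesgue (ball x r)) * measure lebesgue (ball x r)) = weight TYPE('a) \<gamma> \<beta> r * r powr (- real DIM('a))"
proof -
  define v where "v = unit_ball_vol (real DIM('a))"
  have v: "0 < v" unfolding v_def by simp
  have m: "measure lebesgue (ball x r) = v * r ^ DIM('a)"
    using content_ball[of r x] r unfolding v_def by simp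
  have p: "0 < r ^ DIM('a)" using r by simp
  have 1: "0 < 1 + r ^ DIM('a)" "0 < 1 + v * r ^ DIM('a)" using p v by (simp_all add: add_pos_pos)
  have e: "exp (\<beta> * ln r + \<gamma> * \<beta> / real DIM('a) * ln (1 + r ^ DIM('a)) - \<gamma> * ln (1 + v * r ^ DIM('a)))
      = r powr \<beta> * (1 + r ^ DIM('a)) powr (\<gamma> * \<beta> / real DIM('a)) / (1 + v * r ^ DIM('a)) powr \<gamma>"
    using r 1 by (simp add: exp_diff exp_add powr_def)
  have i: "r powr (- real DIM('a)) = inverse (r ^ DIM('a))" using r by (simp add: powr_minus powr_realpow)
  show ?thesis
    unfolding m phi_def weight_def v_def[symmetric] e i by (simp add: divide_inverse mult_ac)
qed

text \<open>By \<open>\<beta> \<le> DIM('a)\<close> the exponent of \<open>1 + r ^ n\<close> in the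
  numerator is at most \<open>\<gamma>\<close>, and the power \<open>\<gamma>\<close> of
  \<open>1 + r ^ n\<close> is at most a constant times the denominator; what remains is
  \<open>r powr \<beta>\<close>. Each term of the logarithmic derivative \<open>L'\<close> is of
  order \<open>1 / r\<close>.\<close>

lemma weight_properties:
  assumes \<beta>: "0 \<le> \<beta>" "\<beta> \<le> real DIM('a)" and \<gamma>: "0 \<le> \<gamma>"
  obtains C W' where "0 < C" "\<And>t. 0 < t \<Longrightarrow> (weight TYPE('a::euclidean_space) \<gamma> \<beta> has_real_derivative W' t) (at t)"
    "continuous_on {0<..} W'" "\<And>t. 0 < t \<Longrightarrow> \<bar>weight TYPE('a) \<gamma> \<beta> t\<bar> \<le> C * t powr \<beta>"
    "\<And>t. 0 < t \<Longrightarrow> \<bar>W' t\<bar> \<le> C * t powr (\<beta> - 1)" "\<And>t. 0 < t \<Longrightarrow> 0 \<le> weight TYPE('a) \<gamma> \<beta> t"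
proof -
  define n where "n = DIM('a)"
  have n: "0 < n" unfolding n_def by simp
  define v where "v = unit_ball_vol (real n)"
  have v: "0 < v" unfolding v_def by simp
  define a where "a = \<gamma> * \<beta> / real n"
  have a: "0 \<le> a" "a \<le> \<gamma>"
    using \<beta> \<gamma> n unfolding a_def n_def by (auto simp: divide_le_eq mult_left_mono)
  define W where "W = weight TYPE('a) \<gamma> \<beta>"
  have W_eq: "W r = exp (\<beta> * ln r + a * ln (1 + r ^ n) - \<gamma> * ln (1 + v * r ^ n)) / v" for r
    unfolding W_def weight_def a_def n_def v_def by simp
  define L' where "L' r = \<beta> / r + a * (real n * r ^ (n - 1) / (1 + r ^ n)) - \<gamma> * (v * (real n * r ^ (n - 1)) / (1 + v * r ^ n))" for r
  have pos: "0 < 1 + r ^ n" "0 < 1 + v * r ^ n" if "0 < r" for r using that v by (simp_all add: add_pos_pos)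
  have deriv: "(W has_real_derivative W r * L' r) (at r)" if r: "0 < r" for r
  proof -
    note p = pos[OF r]
    have "((\<lambda>r. exp (\<beta> * ln r + a * ln (1 + r ^ n) - \<gamma> * ln (1 + v * r ^ n)) / v) has_real_derivative W r * L' r) (at r)"
      unfolding W_eq L'_def using r p
      by (auto intro!: derivative_eq_intros simp: divide_inverse mult_ac)
    moreover have "W = (\<lambda>r. exp (\<beta> * ln r + a * ln (1 + r ^ n) - \<gamma> * ln (1 + v * r ^ n)) / v)"
      by (rule ext) (rule W_eq)
    ultimately show ?thesis by (simp only:)
  qed
  have cont: "continuous_on {0<..} (\<lambda>r. W r * L' r)"
  proof -
    have "continuous_on {0<..} W"
      by (rule DERIV_continuous_on[where D="\<lambda>r. W r * L' r"]) (use deriv in \<open>auto intro: has_field_derivative_at_within\<close>)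
    moreover have "continuous_on {0<..} L'"
      unfolding L'_def using pos by (intro continuous_intros) (auto simp: less_imp_neq[THEN not_sym])
    ultimately show ?thesis by (rule continuous_on_mult)
  qed
  \<comment> \<open>Both \<open>1 \<le> m\<close> and \<open>1 \<le> m * v\<close> hold, hence
    \<open>1 + r ^ n \<le> m * (1 + v * r ^ n)\<close> for every positive \<open>r\<close>.\<close>
  define m where "m = max 1 (1 / v)"
  have m: "1 \<le> m" "1 / v \<le> m" unfolding m_def by auto
  have mv: "1 \<le> m * v" using m v by (simp add: divide_le_eq)
  define C0 where "C0 = exp (\<gamma> * ln m) / v"
  have C0: "0 < C0" unfolding C0_def using v by simp
  have W0: "0 \<le> W r" for r unfolding W_eq using v by simp
  have W_le: "W r \<le> C0 * r powr \<beta>" if r: "0 < r" for r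
  proof -
    note p = pos[OF r]
    have "1 + r ^ n \<le> m * (1 + v * r ^ n)"
    proof -
      have "1 * r ^ n \<le> (m * v) * r ^ n" using mv r by (intro mult_right_mono) auto
      then show ?thesis using m by (simp add: distrib_left mult.assoc)
    qed
    then have "ln (1 + r ^ n) \<le> ln m + ln (1 + v * r ^ n)"
    proof -
      assume le: "1 + r ^ n \<le> m * (1 + v * r ^ n)"
      have "ln (1 + r ^ n) \<le> ln (m * (1 + v * r ^ n))" using le p by (intro ln_mono) auto
      also have "\<dots> = ln m + ln (1 + v * r ^ n)" using p m by (simp add: ln_mult)
      finally show ?thesis .
    qed
    then have "\<gamma> * ln (1 + r ^ n) \<le> \<gamma> * (ln m + ln (1 + v * r ^ n))" using \<gamma> by (rule mult_left_mono)
    moreover have "a * ln (1 + r ^ n) \<le> \<gamma> * ln (1 + r ^ n)" using a r by (intro mult_right_mono ln_ge_zero) auto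
    ultimately have "\<beta> * ln r + a * ln (1 + r ^ n) - \<gamma> * ln (1 + v * r ^ n) \<le> \<beta> * ln r + \<gamma> * ln m"
      by (simp add: distrib_left)
    then have "W r \<le> exp (\<beta> * ln r + \<gamma> * ln m) / v" unfolding W_eq using v by (simp add: divide_right_mono)
    also have "\<dots> = C0 * r powr \<beta>" unfolding C0_def using r by (simp add: exp_add powr_def)
    finally show ?thesis .
  qed
  \<comment> \<open>The summand 1 ensures \<open>C0 \<le> C0 * c\<close>, so that one constant
    serves for \<open>W\<close> and for its derivative.\<close>
  define c where "c = 1 + \<beta> + a * real n + \<gamma> * real n"
  have c: "1 \<le> c" unfolding c_def using \<beta> a \<gamma> by simp
  have L'_le: "\<bar>L' r\<bar> \<le> c / r" if r: "0 < r" for r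
  proof -
    note p = pos[OF r]
    have rn: "r ^ (n - 1) * r = r ^ n" using n by (rule power_minus_mult)
    have 1: "0 \<le> real n * r ^ (n - 1) / (1 + r ^ n)" "real n * r ^ (n - 1) / (1 + r ^ n) \<le> real n / r"
    proof -
      show "0 \<le> real n * r ^ (n - 1) / (1 + r ^ n)" using r p by simp
      have "real n * r ^ (n - 1) * r \<le> real n * (1 + r ^ n)" unfolding mult.assoc rn by (intro mult_left_mono) auto
      then show "real n * r ^ (n - 1) / (1 + r ^ n) \<le> real n / r" using r p by (simp add: divide_simps)
    qed
    have 2: "0 \<le> v * (real n * r ^ (n - 1)) / (1 + v * r ^ n)" "v * (real n * r ^ (n - 1)) / (1 + v * r ^ n) \<le> real n / r"
    proof -
      show "0 \<le> v * (real n * r ^ (n - 1)) / (1 + v * r ^ n)" using r p v by simp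
      have "v * (real n * r ^ (n - 1)) * r = real n * (v * r ^ n)" using rn by (simp add: mult_ac)
      also have "\<dots> \<le> real n * (1 + v * r ^ n)" by (intro mult_left_mono) auto
      finally show "v * (real n * r ^ (n - 1)) / (1 + v * r ^ n) \<le> real n / r" using r p by (simp add: divide_simps)
    qed
    have "a * (real n * r ^ (n - 1) / (1 + r ^ n)) \<le> a * (real n / r)" "0 \<le> a * (real n * r ^ (n - 1) / (1 + r ^ n))"
      using a 1 by (auto intro: mult_left_mono mult_nonneg_nonneg simp del: times_divide_eq_right)
    moreover have "\<gamma> * (v * (real n * r ^ (n - 1)) / (1 + v * r ^ n)) \<le> \<gamma> * (real n / r)" "0 \<le> \<gamma> * (v * (real n * r ^ (n - 1)) / (1 + v * r ^ n))"
      using \<gamma> 2 by (auto intro: mult_left_mono mult_nonneg_nonneg simp del: times_divide_eq_right)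
    moreover have "0 \<le> \<beta> / r" "0 \<le> 1 / r" using \<beta> r by auto
    moreover have "c / r = 1 / r + \<beta> / r + a * (real n / r) + \<gamma> * (real n / r)" unfolding c_def by (simp add: add_divide_distrib)
    ultimately show ?thesis unfolding L'_def by linarith
  qed
  show thesis
  proof (rule that[of "C0 * c" "\<lambda>r. W r * L' r"], unfold W_def[symmetric])
    show "0 < C0 * c" using C0 c by simp
    show "continuous_on {0<..} (\<lambda>r. W r * L' r)" by (rule cont)
    fix t :: real assume t: "0 < t"
    show "(W has_real_derivative W t * L' t) (at t)" by (rule deriv[OF t])
    show "0 \<le> W t" by (rule W0)
    have "C0 * t powr \<beta> \<le> C0 * c * t powr \<beta>" using C0 c by (intro mult_right_mono) auto
    then show "\<bar>W t\<bar> \<le> C0 * c * t powr \<beta>" using W_le[OF t] W0[of t] by linarith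
    have "\<bar>W t * L' t\<bar> \<le> (C0 * t powr \<beta>) * (c / t)"
      unfolding abs_mult using W_le[OF t] L'_le[OF t] W0[of t] C0 by (intro mult_mono) auto
    also have "\<dots> = C0 * c * t powr (\<beta> - 1)" using t by (simp add: powr_diff)
    finally show "\<bar>W t * L' t\<bar> \<le> C0 * c * t powr (\<beta> - 1)" .
  qed
qed

text \<open>Balls with admissible radius lie in \<open>\<Omega>\<close>, where \<open>f\<close> and
  \<open>f0\<close> agree almost everywhere.\<close>

lemma local_max_eq_wmax:
  fixes f :: "'a::euclidean_space \<Rightarrow> real"
  assumes \<Omega>: "open \<Omega>" and f: "borel_rep \<Omega> f f0"
  shows "local_max \<gamma> \<beta> \<Omega> f x = wmax (weight TYPE('a) \<gamma> \<beta>) \<Omega> (\<lambda>y. ennreal \<bar>f0 y\<bar>) x"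
  unfolding local_max_def wmax_def
proof (rule SUP_cong[OF refl])
  fix r assume r: "r \<in> admissible_radii \<Omega> x"
  then have r0: "0 < r" by (simp add: admissible_radii_def)
  have [measurable]: "f0 \<in> borel_measurable borel" using f by (simp add: borel_rep_def)
  have W0: "0 \<le> weight TYPE('a) \<gamma> \<beta> r" unfolding weight_def by simp
  have "(\<integral>\<^sup>+y. ennreal \<bar>f y\<bar> \<partial>lebesgue_on (ball x r)) = (\<integral>\<^sup>+y. ennreal \<bar>indicator (ball x r) y *\<^sub>R f0 y\<bar> \<partial>lborel)"
    using borel_rep_integral(4)[OF _ borel_rep_subset[OF f admissible_radii_ball_subset[OF r]]] by simp
  also have "\<dots> = (\<integral>\<^sup>+y. ennreal \<bar>f0 y\<bar> * indicator (ball x r) y \<partial>lborel)"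
    by (intro nn_integral_cong) (auto split: split_indicator)
  finally have I: "(\<integral>\<^sup>+y. ennreal \<bar>f y\<bar> \<partial>lebesgue_on (ball x r)) = (\<integral>\<^sup>+y. ennreal \<bar>f0 y\<bar> * indicator (ball x r) y \<partial>lborel)" .
  have "unit_avg (\<lambda>y. ennreal \<bar>f0 y\<bar>) x r = ennreal (r powr (- real DIM('a))) * (\<integral>\<^sup>+y. ennreal \<bar>f0 y\<bar> * indicator (ball x r) y \<partial>lborel)"
    by (rule unit_avg_eq[OF _ r0]) measurable
  then show "ennreal (r powr \<beta> * (1 + r ^ DIM('a)) powr (\<gamma> * \<beta> / real DIM('a)) /
      (phi \<gamma> (measure lebesgue (ball x r)) * measure lebesgue (ball x r))) * (\<integral>\<^sup>+y. ennreal \<bar>f y\<bar> \<partial>lebesgue_on (ball x r))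
      = ennreal (weight TYPE('a) \<gamma> \<beta> r) * unit_avg (\<lambda>y. ennreal \<bar>f0 y\<bar>) x r"
    unfolding weight_eq[OF r0] I using W0 by (simp add: ennreal_mult mult.assoc)
qed

lemma wmax_le_fmax:
  fixes f :: "'a::euclidean_space \<Rightarrow> ennreal"
  assumes [measurable]: "f \<in> borel_measurable borel" and W: "\<And>t. 0 < t \<Longrightarrow> \<bar>W t\<bar> \<le> C * t powr \<beta>" and C: "0 \<le> C"
  shows "wmax W \<Omega> f x \<le> ennreal C * fmax \<beta> f x"
  unfolding wmax_def
proof (rule SUP_least)
  fix r assume "r \<in> admissible_radii \<Omega> x"
  then have r: "0 < r" by (simp add: admissible_radii_def)
  have "W r \<le> C * r powr \<beta>" using W[OF r] by linarith
  then have "ennreal (W r) \<le> ennreal C * ennreal (r powr \<beta>)" using C by (simp add: ennreal_mult[symmetric] ennreal_leI)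
  then have "ennreal (W r) * unit_avg f x r \<le> ennreal C * ennreal (r powr \<beta>) * unit_avg f x r" by (rule mult_right_mono) simp
  also have "\<dots> \<le> ennreal C * fmax \<beta> f x"
    unfolding mult.assoc by (intro mult_left_mono unit_avg_le_fmax[OF assms(1) r]) simp
  finally show "ennreal (W r) * unit_avg f x r \<le> ennreal C * fmax \<beta> f x" .
qed

lemma wmax_measurable:
  fixes f :: "'a::euclidean_space \<Rightarrow> ennreal"
  assumes f: "f \<in> borel_measurable borel" and \<Omega>: "open \<Omega>"
  shows "(\<lambda>x. if x \<in> \<Omega> then wmax W \<Omega> f x else 0) \<in> borel_measurable borel"
proof (rule borel_measurableI_greater)
  fix a :: ennreal
  have "wmax W \<Omega> f x = (SUP r\<in>admissible_radii \<Omega> x. ennreal (W r) * ennreal (r powr (- real DIM('a))) * (\<integral>\<^sup>+y. f y * indicator (ball x r) y \<partial>lborel))" for x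
    unfolding wmax_def
  proof (rule SUP_cong[OF refl])
    fix r assume "r \<in> admissible_radii \<Omega> x"
    then have "0 < r" by (simp add: admissible_radii_def)
    from unit_avg_eq[OF f this, of x]
    show "ennreal (W r) * unit_avg f x r = ennreal (W r) * ennreal (r powr (- real DIM('a))) * (\<integral>\<^sup>+y. f y * indicator (ball x r) y \<partial>lborel)"
      by (simp only: mult.assoc)
  qed
  then have "open {x\<in>\<Omega>. a < wmax W \<Omega> f x}"
    using open_superlevel_maximal[OF f \<Omega>, of a "\<lambda>r. ennreal (W r) * ennreal (r powr (- real DIM('a)))"] by simp
  moreover have "{x \<in> space borel. a < (if x \<in> \<Omega> then wmax W \<Omega> f x else 0)} = {x\<in>\<Omega>. a < wmax W \<Omega> f x}" by auto
  ultimately show "{x \<in> space borel. a < (if x \<in> \<Omega> then wmax W \<Omega> f x else 0)} \<in> sets borel" by simp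
qed

text \<open>Substitution of \<open>1 - t\<close>. A bound on an absolute difference needs the
  segment inequality in both directions with the same right side.\<close>

lemma segment_integral_reverse:
  fixes G :: "'a::euclidean_space \<Rightarrow> ennreal"
  assumes [measurable]: "G \<in> borel_measurable borel"
  shows "(\<integral>\<^sup>+t. G ((x + h) + t *\<^sub>R (- h)) * indicator {0..1} t \<partial>lborel) = (\<integral>\<^sup>+t. G (x + t *\<^sub>R h) * indicator {0..1} t \<partial>lborel)"
proof -
  have "(\<integral>\<^sup>+t. G (x + t *\<^sub>R h) * indicator {0..1} t \<partial>lborel)
    = ennreal \<bar>- 1\<bar> * (\<integral>\<^sup>+t. G (x + (1 + (- 1) * t) *\<^sub>R h) * indicator {0..1} (1 + (- 1) * t) \<partial>lborel)"
  proof (rule nn_integral_real_affine)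
    show "(\<lambda>t. G (x + t *\<^sub>R h) * indicator {0..1} t) \<in> borel_measurable borel" by measurable
  qed simp
  also have "\<dots> = (\<integral>\<^sup>+t. G ((x + h) + t *\<^sub>R (- h)) * indicator {0..1} t \<partial>lborel)"
    by simp (intro nn_integral_cong, auto simp: algebra_simps split: split_indicator)
  finally show ?thesis by simp
qed

lemma ennreal_abs_diff_le:
  assumes "a < top" "b < top" "a \<le> b + N" "b \<le> a + N"
  shows "ennreal \<bar>enn2real a - enn2real b\<bar> \<le> N"
proof (cases N)
  case (real c)
  obtain a' b' where "a = ennreal a'" "0 \<le> a'" "b = ennreal b'" "0 \<le> b'"
    using assms(1,2) by (cases a; cases b) auto
  with assms(3,4) real show ?thesis
    by (auto simp: ennreal_plus[symmetric] ennreal_le_iff intro!: ennreal_leI simp del: ennreal_plus)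
qed simp

lemma eLp_fmax_0_finite_AE:
  fixes G :: "'a::euclidean_space \<Rightarrow> ennreal"
  assumes [measurable]: "G \<in> borel_measurable borel" and q: "1 < q" and G: "eLp q G < top"
  shows "eLp q (fmax 0 G) < top" "AE x in lborel. fmax 0 G x < top"
proof -
  obtain C where C: "\<And>f::'a \<Rightarrow> ennreal. f \<in> borel_measurable borel \<Longrightarrow> eLp q (fmax 0 f) \<le> ennreal C * eLp q f"
    using fmax_strong_type[of q 0 q, where 'a='a] q by auto
  show "eLp q (fmax 0 G) < top"
    using C[of G] G by (simp add: order_le_less_trans ennreal_mult_less_top)
  then show "AE x in lborel. fmax 0 G x < top"
    using q by (intro eLp_finite_AE) auto
qed

text \<open>Almost everywhere the maximal function is finite, and there the two one-sided segment
  inequalities bound the difference of its real values. \<open>weak_gradient_exists\<close> applies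
  with \<open>H\<close> the real version of a multiple of \<open>fmax 0 G0\<close>, and the norm
  bound follows from the pointwise one.\<close>

lemma wmax_weak_gradient:
  fixes f0 :: "'a::euclidean_space \<Rightarrow> real" and D0 :: "'a \<Rightarrow> 'a"
  assumes \<Omega>: "open \<Omega>" and w: "is_wgrad \<Omega> f0 D0"
    and fm [measurable]: "f0 \<in> borel_measurable borel" "D0 \<in> borel_measurable borel"
    and fi: "\<And>K. compact K \<Longrightarrow> K \<subseteq> \<Omega> \<Longrightarrow> integrable lborel (\<lambda>y. indicator K y *\<^sub>R f0 y)"
    and Di: "\<And>K. compact K \<Longrightarrow> K \<subseteq> \<Omega> \<Longrightarrow> integrable lborel (\<lambda>y. indicator K y *\<^sub>R D0 y)"
    and W: "\<And>t. 0 < t \<Longrightarrow> (W has_real_derivative W' t) (at t)" "continuous_on {0<..} W'"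
    and W_le: "\<And>t. 0 < t \<Longrightarrow> \<bar>W t\<bar> \<le> C * t powr \<beta>" "\<And>t. 0 < t \<Longrightarrow> \<bar>W' t\<bar> \<le> C * t powr (\<beta> - 1)"
    and W0: "\<And>t. 0 < t \<Longrightarrow> 0 \<le> W t" and C: "0 \<le> C" and \<beta>: "\<beta> < real DIM('a)" and q: "1 < q"
    and F: "eLp q (\<lambda>x. if x \<in> \<Omega> then wmax W \<Omega> (\<lambda>y. ennreal \<bar>f0 y\<bar>) x else 0) < top"
    and G: "eLp q (grad_bound C \<beta> f0 D0) < top"
  obtains g where "g \<in> borel_measurable borel" "is_wgrad \<Omega> (\<lambda>x. enn2real (if x \<in> \<Omega> then wmax W \<Omega> (\<lambda>y. ennreal \<bar>f0 y\<bar>) x else 0)) g"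
    "eLp q (\<lambda>x. ennreal (norm (g x))) \<le> ennreal (real DIM('a) * (2 ^ (DIM('a) + 2) / unit_ball_vol (real DIM('a)))) * eLp q (fmax 0 (grad_bound C \<beta> f0 D0))"
proof -
  define M where "M x = (if x \<in> \<Omega> then wmax W \<Omega> (\<lambda>y. ennreal \<bar>f0 y\<bar>) x else 0)" for x
  define F0 where "F0 x = enn2real (M x)" for x
  define G0 where "G0 = grad_bound C \<beta> f0 D0"
  define c where "c = 2 ^ (DIM('a) + 2) / unit_ball_vol (real DIM('a))"
  have c: "0 < c" unfolding c_def by simp
  have [measurable]: "M \<in> borel_measurable borel"
    unfolding M_def[abs_def] by (rule wmax_measurable[OF _ \<Omega>]) measurable
  have F0m [measurable]: "F0 \<in> borel_measurable borel" unfolding F0_def[abs_def] by measurable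
  have G0m [measurable]: "G0 \<in> borel_measurable borel" unfolding G0_def by measurable
  define H where "H x = enn2real (ennreal c * fmax 0 G0 x)" for x
  have Hm [measurable]: "H \<in> borel_measurable borel" unfolding H_def[abs_def] by measurable
  have MG: "eLp q (fmax 0 G0) < top" "AE x in lborel. fmax 0 G0 x < top"
    using eLp_fmax_0_finite_AE[OF G0m q] G unfolding G0_def by auto
  have H_le: "ennreal (H x) \<le> ennreal c * fmax 0 G0 x" for x
    unfolding H_def by (cases "ennreal c * fmax 0 G0 x = top") (simp_all add: less_top[symmetric])
  have eH: "eLp q (\<lambda>x. ennreal (norm (H x))) \<le> ennreal c * eLp q (fmax 0 G0)"
  proof -
    have "eLp q (\<lambda>x. ennreal (norm (H x))) \<le> eLp q (\<lambda>x. ennreal c * fmax 0 G0 x)"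
      using q H_le by (intro eLp_mono_AE AE_I2) (auto simp: H_def)
    also have "\<dots> = ennreal c * eLp q (fmax 0 G0)" using q by (intro eLp_cmult) auto
    finally show ?thesis .
  qed
  have eF: "eLp q (\<lambda>x. ennreal (norm (F0 x))) \<le> eLp q M"
  proof (intro eLp_mono_AE AE_I2)
    fix x show "ennreal (norm (F0 x)) \<le> M x" unfolding F0_def by (cases "M x = top") (simp_all add: less_top[symmetric])
  qed (use q in simp)
  have M_fin: "AE x in lborel. M x < top"
    using F q unfolding M_def by (intro eLp_finite_AE) (use \<open>M \<in> borel_measurable borel\<close> in \<open>auto simp: M_def[abs_def]\<close>)
  have "eLp q M < top" using F unfolding M_def[abs_def] .
  then have F0_fin: "eLp q (\<lambda>x. ennreal (norm (F0 x))) < top" using eF by simp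
  have H_fin: "eLp q (\<lambda>x. ennreal (norm (H x))) < top"
    using eH MG(1) by (simp add: order_le_less_trans ennreal_mult_less_top)
  have seg: "AE x in lborel. x \<in> \<Omega> \<longrightarrow> (\<forall>r>0. ball x r \<subseteq> \<Omega> \<longrightarrow> (AE y in lborel. y \<in> ball x r \<longrightarrow>
       ennreal \<bar>F0 y - F0 x\<bar> \<le> ennreal (norm (y - x)) * (\<integral>\<^sup>+t. G0 (x + t *\<^sub>R (y - x)) * indicator {0..1} t \<partial>lborel)))"
    using M_fin
  proof eventually_elim
    case (elim x)
    show ?case
    proof (intro impI allI)
      fix r :: real assume x: "x \<in> \<Omega>" and r: "0 < r" and sub: "ball x r \<subseteq> \<Omega>"
      show "AE y in lborel. y \<in> ball x r \<longrightarrow>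
         ennreal \<bar>F0 y - F0 x\<bar> \<le> ennreal (norm (y - x)) * (\<integral>\<^sup>+t. G0 (x + t *\<^sub>R (y - x)) * indicator {0..1} t \<partial>lborel)"
        using M_fin
      proof eventually_elim
        case y: (elim y)
        show ?case
        proof
          assume yb: "y \<in> ball x r"
          define h where "h = y - x"
          have inside: "x + t *\<^sub>R h \<in> \<Omega>" if "0 \<le> t" "t \<le> 1" for t
          proof -
            have "norm (t *\<^sub>R h) \<le> 1 * norm h" using that unfolding norm_scaleR by (intro mult_right_mono) auto
            then have "x + t *\<^sub>R h \<in> ball x r" using yb by (simp add: dist_norm h_def norm_minus_commute)
            then show ?thesis using sub by blast
          qed
          have yO: "y \<in> \<Omega>" using yb sub by blast
          let ?u = "wmax W \<Omega> (\<lambda>y. ennreal \<bar>f0 y\<bar>)"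
          let ?N = "ennreal (norm h) * (\<integral>\<^sup>+t. G0 (x + t *\<^sub>R h) * indicator {0..1} t \<partial>lborel)"
          have 1: "?u y \<le> ?u x + ?N"
            using wmax_segment[OF \<Omega> w fm fi Di inside W W_le W0 C \<beta>] unfolding G0_def h_def by simp
          have 2: "?u x \<le> ?u y + ?N"
          proof -
            have in2: "(x + h) + t *\<^sub>R (- h) \<in> \<Omega>" if "0 \<le> t" "t \<le> 1" for t
            proof -
              have eq: "(x + h) + t *\<^sub>R (- h) = x + (1 - t) *\<^sub>R h" by (simp add: algebra_simps)
              have "x + (1 - t) *\<^sub>R h \<in> \<Omega>" using that by (intro inside) auto
              then show ?thesis unfolding eq .
            qed
            have "?u ((x + h) + (- h)) \<le> ?u (x + h) + ennreal (norm (- h)) * (\<integral>\<^sup>+t. grad_bound C \<beta> f0 D0 ((x + h) + t *\<^sub>R (- h)) * indicator {0..1} t \<partial>lborel)"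
              by (rule wmax_segment[OF \<Omega> w fm fi Di in2 W W_le W0 C \<beta>])
            then show ?thesis
              unfolding G0_def[symmetric] segment_integral_reverse[OF G0m] norm_minus_cancel by (simp add: h_def)
          qed
          have fin: "?u x < top" "?u y < top" using elim y x yO by (simp_all add: M_def)
          have "ennreal \<bar>enn2real (?u y) - enn2real (?u x)\<bar> \<le> ?N"
            by (rule ennreal_abs_diff_le[OF fin(2,1) 1 2])
          then show "ennreal \<bar>F0 y - F0 x\<bar> \<le> ennreal (norm (y - x)) * (\<integral>\<^sup>+t. G0 (x + t *\<^sub>R (y - x)) * indicator {0..1} t \<partial>lborel)"
            using x yO by (simp add: F0_def M_def h_def)
        qed
      qed
    qed
  qed
  have Fi: "integrable lborel (\<lambda>y. indicator K y *\<^sub>R F0 y)" if "compact K" for K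
    using q by (intro eLp_locally_integrable[OF F0m _ F0_fin that]) simp
  have Hi: "integrable lborel (\<lambda>y. indicator K y *\<^sub>R H y)" if "compact K" for K
    using q by (intro eLp_locally_integrable[OF Hm _ H_fin that]) simp
  have HA: "AE x in lborel. ennreal (2 ^ (DIM('a) + 2) / unit_ball_vol (real DIM('a))) * fmax 0 G0 x \<le> ennreal (H x)"
    unfolding c_def[symmetric] using MG(2)
  proof eventually_elim
    case (elim x)
    then have "ennreal c * fmax 0 G0 x < top" by (simp add: ennreal_mult_less_top)
    then show ?case unfolding H_def by simp
  qed
  have H0: "0 \<le> H x" for x unfolding H_def by simp
  obtain g where g: "g \<in> borel_measurable borel" "\<And>x. norm (g x) \<le> real DIM('a) * H x" "is_wgrad \<Omega> F0 g"
    by (rule weak_gradient_exists[OF \<Omega> F0m G0m Hm Fi Hi H0 HA seg], assumption, assumption, rule that)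
  show thesis
  proof (rule that[OF g(1)])
    show "is_wgrad \<Omega> (\<lambda>x. enn2real (if x \<in> \<Omega> then wmax W \<Omega> (\<lambda>y. ennreal \<bar>f0 y\<bar>) x else 0)) g"
      using g(3) unfolding F0_def[abs_def] M_def .
    have "eLp q (\<lambda>x. ennreal (norm (g x))) \<le> eLp q (\<lambda>x. ennreal (real DIM('a)) * ennreal (norm (H x)))"
      using q g(2) H0 by (intro eLp_mono_AE AE_I2) (auto simp: ennreal_mult[symmetric] ennreal_leI simp del: ennreal_of_nat_eq_real_of_nat)
    also have "\<dots> = ennreal (real DIM('a)) * eLp q (\<lambda>x. ennreal (norm (H x)))" using q by (intro eLp_cmult) auto
    also have "\<dots> \<le> ennreal (real DIM('a)) * (ennreal c * eLp q (fmax 0 G0))" by (intro mult_left_mono eH) simp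
    also have "\<dots> = ennreal (real DIM('a) * c) * eLp q (fmax 0 G0)"
      using c by (subst ennreal_mult) (auto simp: mult.assoc)
    finally show "eLp q (\<lambda>x. ennreal (norm (g x))) \<le> ennreal (real DIM('a) * (2 ^ (DIM('a) + 2) / unit_ball_vol (real DIM('a)))) * eLp q (fmax 0 (grad_bound C \<beta> f0 D0))"
      unfolding c_def G0_def .
  qed
qed

section \<open>Boundedness from W^{1,p} to W^{1,q}\<close>

theorem theorem1p6:
  fixes \<Omega> :: "(real ^ 'n) set" and p q \<beta> \<gamma> :: real
  assumes "domain_set \<Omega>"
    and "1 < p" and "p < real CARD('n)"
    and "1 \<le> \<beta>" and "\<beta> < real CARD('n) / p"
    and "0 \<le> \<gamma>" and "\<gamma> \<le> real CARD('n)"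
    and "1 / q = 1 / p - \<beta> / real CARD('n)"
    and "admits_Sobolev_embedding p \<Omega>"
  shows "\<exists>C>0. \<forall>f\<in>Sobolev_space p \<Omega>.
           (AE x in lebesgue_on \<Omega>. local_max \<gamma> \<beta> \<Omega> f x < \<infinity>) \<and>
           (\<lambda>x. enn2real (local_max \<gamma> \<beta> \<Omega> f x)) \<in> Sobolev_space q \<Omega> \<and>
           Sobolev_norm q \<Omega> (\<lambda>x. enn2real (local_max \<gamma> \<beta> \<Omega> f x)) \<le> C * Sobolev_norm p \<Omega> f"
proof -
  define n where "n = real CARD('n)"
  have dim: "real DIM((real ^ 'n)) = n" by (simp add: n_def)
  have \<Omega>: "open \<Omega>" using assms(1) by (simp add: domain_set_def)
  then have \<Omega>b: "\<Omega> \<in> sets borel" by simp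
  note p = assms(2) and pn = assms(3)[folded n_def] and \<beta>1 = assms(4) and \<beta>p = assms(5)[folded n_def] and \<gamma> = assms(6)
  note qe = assms(8)[folded n_def]
  have n: "0 < n" using p pn by simp
  have b1: "\<beta> / n < 1 / p" using \<beta>p p n by (simp add: field_simps)
  have \<beta>n: "\<beta> < n"
  proof -
    have "\<beta> < n / p" by (rule \<beta>p)
    also have "\<dots> \<le> n / 1" using p n by (intro divide_left_mono) auto
    finally show ?thesis by simp
  qed
  have q0: "0 < q" using qe b1 by (metis diff_gt_0_iff_gt zero_less_divide_1_iff)
  \<comment> \<open>Required for the bound of \<open>fmax 0\<close> on L^q; it holds because
    \<open>1 / q < 1 / p < 1\<close>.\<close>
  have q: "1 < q"
  proof -
    have "1 / q < 1" using qe p \<beta>1 n by (simp add: add_pos_pos) (smt (verit) divide_less_eq_1_pos divide_pos_pos)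
    then show ?thesis using q0 by simp
  qed
  \<comment> \<open>The exponent of the Sobolev embedding. It exceeds 1, so that the strong-type
    bound of order \<open>\<beta> - 1\<close> can start from L^s, and \<open>qe2\<close> shows that
    it ends in L^q.\<close>
  define s where "s = 1 / (1 / p - 1 / n)"
  have pn': "0 < 1 / p - 1 / n" using p pn by (simp add: divide_strict_left_mono)
  have s0: "0 < s" unfolding s_def using pn' by simp
  have s1: "1 < s"
  proof -
    have "1 / p < 1" "0 < 1 / n" using p n by auto
    then have "1 / p - 1 / n < 1" by linarith
    then show ?thesis unfolding s_def using pn' by simp
  qed
  have se: "1 / s = 1 / p - 1 / n" unfolding s_def by simp
  have qe2: "1 / q = 1 / s - (\<beta> - 1) / n" unfolding se qe by (simp add: diff_divide_distrib)
  obtain CS where CS: "0 < CS" "\<And>f. f \<in> Sobolev_space p \<Omega> \<Longrightarrow> f \<in> Lp_space s \<Omega> \<and> Lp_norm s \<Omega> f \<le> CS * Sobolev_norm p \<Omega> f"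
    using assms(9) unfolding admits_Sobolev_embedding_def Let_def dim s_def by blast
  obtain C1 where C1: "0 < C1" "\<And>f::(real ^ 'n) \<Rightarrow> ennreal. f \<in> borel_measurable borel \<Longrightarrow> eLp q (fmax \<beta> f) \<le> ennreal C1 * eLp p f"
    by (rule fmax_strong_type[of p \<beta> q, where 'a="(real ^ 'n)"]) (use p \<beta>1 q0 qe in \<open>simp_all add: n_def\<close>)
  obtain C2 where C2: "0 < C2" "\<And>f::(real ^ 'n) \<Rightarrow> ennreal. f \<in> borel_measurable borel \<Longrightarrow> eLp q (fmax (\<beta> - 1) f) \<le> ennreal C2 * eLp s f"
    by (rule fmax_strong_type[of s "\<beta> - 1" q, where 'a="(real ^ 'n)"]) (use s1 \<beta>1 q0 qe2 in \<open>simp_all add: n_def\<close>)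
  obtain C3 where C3: "0 < C3" "\<And>f::(real ^ 'n) \<Rightarrow> ennreal. f \<in> borel_measurable borel \<Longrightarrow> eLp q (fmax 0 f) \<le> ennreal C3 * eLp q f"
    by (rule fmax_strong_type[of q 0 q, where 'a="(real ^ 'n)"]) (use q in simp_all)
  define W where "W = weight TYPE((real ^ 'n)) \<gamma> \<beta>"
  obtain C W' where C: "0 < C" and W: "\<And>t. 0 < t \<Longrightarrow> (W has_real_derivative W' t) (at t)" "continuous_on {0<..} W'"
    and W_le: "\<And>t. 0 < t \<Longrightarrow> \<bar>W t\<bar> \<le> C * t powr \<beta>" "\<And>t. 0 < t \<Longrightarrow> \<bar>W' t\<bar> \<le> C * t powr (\<beta> - 1)"
    and W0: "\<And>t. 0 < t \<Longrightarrow> 0 \<le> W t"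
    using weight_properties[of \<beta> \<gamma>, where 'a="(real ^ 'n)"] \<beta>1 \<beta>n \<gamma> unfolding W_def dim by auto
  define c where "c = n * (2 ^ (CARD('n) + 2) / unit_ball_vol n)"
  have c: "0 < c" unfolding c_def using n by simp
  define d where "d = 2 * 2 powr (1 / q)"
  have d: "0 < d" unfolding d_def by simp
  define A where "A = C * C1"
  \<comment> \<open>The factors \<open>c\<close> and \<open>C3\<close> come from the gradient bound
    and from \<open>fmax 0\<close> on L^q, \<open>d\<close> from the quasi-triangle inequality. The
    summands belong to the two terms of \<open>grad_bound\<close>; the embedding constant
    \<open>CS\<close> enters the one that contains \<open>f\<close>.\<close>
  define B where "B = c * (C3 * (d * (C * C2 * CS + 2 * C * C1)))"
  have AB: "0 < A" "0 \<le> B" unfolding A_def B_def using C C1(1) C2(1) C3(1) CS(1) c d by auto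
  show ?thesis
  proof (intro exI[of _ "A + B"] conjI ballI)
    show "0 < A + B" using AB by simp
    fix f assume f: "f \<in> Sobolev_space p \<Omega>"
    define g where "g = weak_gradient \<Omega> f"
    have fp: "f \<in> Lp_space p \<Omega>" and gp: "g \<in> Lp_space p \<Omega>" and ex: "\<exists>g. is_weak_gradient \<Omega> f g"
      using f unfolding Sobolev_space_def g_def by auto
    have wg: "is_weak_gradient \<Omega> f g"
      unfolding g_def weak_gradient_def by (rule someI_ex[OF ex])
    have fs: "f \<in> Lp_space s \<Omega>" "Lp_norm s \<Omega> f \<le> CS * Sobolev_norm p \<Omega> f" using CS(2)[OF f] by auto
    obtain f0 where f0: "borel_rep \<Omega> f f0"
      by (rule borel_rep_exists[OF \<Omega>b]) (use fp in \<open>auto simp: Lp_space_def\<close>)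
    obtain g0 where g0: "borel_rep \<Omega> g g0"
      by (rule borel_rep_exists[OF \<Omega>b]) (use gp in \<open>auto simp: Lp_space_def\<close>)
    have m [measurable]: "f0 \<in> borel_measurable borel" "g0 \<in> borel_measurable borel"
      using f0 g0 by (auto simp: borel_rep_def)
    have w: "is_wgrad \<Omega> f0 g0" and loc: "locally_integrable \<Omega> f" "locally_integrable \<Omega> g"
      using wg weak_gradient_borel_rep[OF \<Omega> f0 g0] by auto
    have fi: "integrable lborel (\<lambda>y. indicator K y *\<^sub>R f0 y)" if "compact K" "K \<subseteq> \<Omega>" for K
      using loc(1) that unfolding locally_integrable_borel_rep[OF f0] by blast
    have gi: "integrable lborel (\<lambda>y. indicator K y *\<^sub>R g0 y)" if "compact K" "K \<subseteq> \<Omega>" for K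
      using loc(2) that unfolding locally_integrable_borel_rep[OF g0] by blast
    define fe where "fe y = ennreal \<bar>f0 y\<bar>" for y
    define ge where "ge y = ennreal (norm (g0 y))" for y
    have [measurable]: "fe \<in> borel_measurable borel" "ge \<in> borel_measurable borel"
      unfolding fe_def[abs_def] ge_def[abs_def] by measurable
    have Nf: "eLp p fe = ennreal (Lp_norm p \<Omega> f)" and Nfs: "eLp s fe = ennreal (Lp_norm s \<Omega> f)" and Ng: "eLp p ge = ennreal (Lp_norm p \<Omega> g)"
      using borel_rep_Lp(2)[OF \<Omega>b f0 _ fp] borel_rep_Lp(2)[OF \<Omega>b f0 s0 fs(1)] borel_rep_Lp(2)[OF \<Omega>b g0 _ gp] p
      unfolding fe_def[abs_def] ge_def[abs_def] by auto
    define M where "M x = (if x \<in> \<Omega> then wmax W \<Omega> fe x else 0)" for x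
    have Mm [measurable]: "M \<in> borel_measurable borel"
      unfolding M_def[abs_def] by (rule wmax_measurable[OF _ \<Omega>]) measurable
    have lm: "local_max \<gamma> \<beta> \<Omega> f x = wmax W \<Omega> fe x" for x
      unfolding W_def fe_def[abs_def] by (rule local_max_eq_wmax[OF \<Omega> f0])
    have EM: "eLp q M \<le> ennreal (A * Lp_norm p \<Omega> f)"
    proof -
      have "eLp q M \<le> eLp q (\<lambda>x. ennreal C * fmax \<beta> fe x)"
        using C q0 by (intro eLp_mono_AE AE_I2) (auto simp: M_def intro!: wmax_le_fmax W_le)
      also have "\<dots> = ennreal C * eLp q (fmax \<beta> fe)" using q0 by (intro eLp_cmult) auto
      also have "\<dots> \<le> ennreal C * (ennreal C1 * eLp p fe)" by (intro mult_left_mono C1(2)) auto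
      also have "\<dots> = ennreal (A * Lp_norm p \<Omega> f)"
        unfolding Nf A_def using C C1(1) by (simp add: ennreal_mult mult.assoc Lp_norm_def)
      finally show ?thesis .
    qed
    define G where "G = grad_bound C \<beta> f0 g0"
    have Gm [measurable]: "G \<in> borel_measurable borel" unfolding G_def by measurable
    have EG: "eLp q G \<le> ennreal (d * (C * C2 * CS + 2 * C * C1) * Sobolev_norm p \<Omega> f)"
    proof -
      let ?S = "Sobolev_norm p \<Omega> f"
      have N0: "0 \<le> Lp_norm p \<Omega> f" "0 \<le> Lp_norm p \<Omega> g" "0 \<le> Lp_norm s \<Omega> f" by (simp_all add: Lp_norm_def)
      have S: "Lp_norm p \<Omega> g \<le> ?S" "0 \<le> ?S" using N0 by (simp_all add: Sobolev_norm_def g_def)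
      have a: "eLp q (\<lambda>x. ennreal C * fmax (\<beta> - 1) fe x) \<le> ennreal (C * C2 * CS * ?S)"
      proof -
        have "eLp q (\<lambda>x. ennreal C * fmax (\<beta> - 1) fe x) = ennreal C * eLp q (fmax (\<beta> - 1) fe)"
          using q0 by (intro eLp_cmult) auto
        also have "\<dots> \<le> ennreal C * (ennreal C2 * eLp s fe)" by (intro mult_left_mono C2(2)) auto
        also have "\<dots> = ennreal (C * C2 * Lp_norm s \<Omega> f)"
          unfolding Nfs using C C2(1) N0 by (simp add: ennreal_mult mult.assoc)
        also have "\<dots> \<le> ennreal (C * C2 * (CS * ?S))"
          using C C2(1) fs(2) by (intro ennreal_leI mult_left_mono) auto
        finally show ?thesis by (simp add: mult.assoc)
      qed
      have b: "eLp q (\<lambda>x. ennreal (2 * C) * fmax \<beta> ge x) \<le> ennreal (2 * C * C1 * ?S)"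
      proof -
        have "eLp q (\<lambda>x. ennreal (2 * C) * fmax \<beta> ge x) = ennreal (2 * C) * eLp q (fmax \<beta> ge)"
          using q0 by (intro eLp_cmult) auto
        also have "\<dots> \<le> ennreal (2 * C) * (ennreal C1 * eLp p ge)" by (intro mult_left_mono C1(2)) auto
        also have "\<dots> = ennreal (2 * C * C1 * Lp_norm p \<Omega> g)"
          unfolding Ng using C C1(1) N0 by (simp add: ennreal_mult mult.assoc)
        also have "\<dots> \<le> ennreal (2 * C * C1 * ?S)"
          using C C1(1) S by (intro ennreal_leI mult_left_mono) auto
        finally show ?thesis .
      qed
      have "eLp q G = eLp q (\<lambda>x. ennreal C * fmax (\<beta> - 1) fe x + ennreal (2 * C) * fmax \<beta> ge x)"
        unfolding G_def grad_bound_def[abs_def] fe_def[abs_def] ge_def[abs_def] ..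
      also have "\<dots> \<le> ennreal d * (eLp q (\<lambda>x. ennreal C * fmax (\<beta> - 1) fe x) + eLp q (\<lambda>x. ennreal (2 * C) * fmax \<beta> ge x))"
        unfolding d_def using q0 by (intro eLp_add_le) measurable
      also have "\<dots> \<le> ennreal d * (ennreal (C * C2 * CS * ?S) + ennreal (2 * C * C1 * ?S))"
        by (intro mult_left_mono add_mono a b) simp
      also have "\<dots> = ennreal (d * (C * C2 * CS * ?S + 2 * C * C1 * ?S))"
        using C C1(1) C2(1) CS(1) S d by (simp add: ennreal_mult[symmetric] ennreal_plus[symmetric] del: ennreal_plus)
      also have "d * (C * C2 * CS * ?S + 2 * C * C1 * ?S) = d * (C * C2 * CS + 2 * C * C1) * ?S" by (simp add: algebra_simps)
      finally show ?thesis .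
    qed
    have M_top: "eLp q M < top" and G_top: "eLp q G < top"
      using EM EG by (auto intro: order_le_less_trans)
    obtain h where h [measurable]: "h \<in> borel_measurable borel" and wh: "is_wgrad \<Omega> (\<lambda>x. enn2real (M x)) h"
      and Eh: "eLp q (\<lambda>x. ennreal (norm (h x))) \<le> ennreal c * eLp q (fmax 0 G)"
    proof (rule wmax_weak_gradient[OF \<Omega> w m fi gi W W_le W0 less_imp_le[OF C] _ q])
      show "eLp q (\<lambda>x. if x \<in> \<Omega> then wmax W \<Omega> (\<lambda>y. ennreal \<bar>f0 y\<bar>) x else 0) < top"
        using M_top unfolding M_def[abs_def] fe_def[abs_def] .
      show "eLp q (grad_bound C \<beta> f0 g0) < top" using G_top unfolding G_def .
      show "\<beta> < real DIM((real ^ 'n))" using \<beta>n dim by simp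
      fix h assume "h \<in> borel_measurable borel"
        "is_wgrad \<Omega> (\<lambda>x. enn2real (if x \<in> \<Omega> then wmax W \<Omega> (\<lambda>y. ennreal \<bar>f0 y\<bar>) x else 0)) h"
        "eLp q (\<lambda>x. ennreal (norm (h x))) \<le> ennreal (real DIM((real ^ 'n)) * (2 ^ (DIM((real ^ 'n)) + 2) / unit_ball_vol (real DIM((real ^ 'n))))) * eLp q (fmax 0 (grad_bound C \<beta> f0 g0))"
      then show thesis
        using that[of h] unfolding M_def[abs_def] fe_def[abs_def] G_def c_def n_def by simp
    qed
    define u where "u x = enn2real (local_max \<gamma> \<beta> \<Omega> f x)" for x
    define u0 where "u0 x = enn2real (M x)" for x
    have u0m: "u0 \<in> borel_measurable borel" unfolding u0_def[abs_def] by measurable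
    have u0: "borel_rep \<Omega> u u0"
      using u0m unfolding borel_rep_def u_def u0_def lm by (simp add: M_def)
    \<comment> \<open>Restricted to \<open>\<Omega>\<close>, the gradient is its own Borel
      representative; the integration by parts identity is unaffected because test functions vanish
      elsewhere.\<close>
    define h0 where "h0 x = indicator \<Omega> x *\<^sub>R h x" for x
    have h0m: "h0 \<in> borel_measurable borel" unfolding h0_def[abs_def] using \<Omega>b by measurable
    have h0: "borel_rep \<Omega> h0 h0" using h0m unfolding borel_rep_def by (simp add: h0_def)
    have wh0: "is_wgrad \<Omega> u0 h0"
      unfolding is_wgrad_def
    proof (intro ballI)
      fix \<psi> and b :: "real ^ 'n" assume \<psi>: "\<psi> \<in> test_functions \<Omega>" and b: "b \<in> Basis"
      have "\<psi> x = 0" if "x \<notin> \<Omega>" for x using test_functionD(5)[OF \<psi>] that by blast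
      then have "(\<integral>x. (h x \<bullet> b) * \<psi> x \<partial>lborel) = (\<integral>x. (h0 x \<bullet> b) * \<psi> x \<partial>lborel)"
        by (intro Bochner_Integration.integral_cong) (auto simp: h0_def indicator_def)
      then show "(\<integral>x. u0 x * frechet_derivative \<psi> (at x) b \<partial>lborel) = - (\<integral>x. (h0 x \<bullet> b) * \<psi> x \<partial>lborel)"
        using wh[unfolded is_wgrad_def, rule_format, OF \<psi> b] unfolding u0_def by simp
    qed
    have Eu: "eLp q (\<lambda>x. ennreal (norm (u0 x))) \<le> ennreal (A * Lp_norm p \<Omega> f)"
    proof -
      have "ennreal (norm (u0 x)) \<le> M x" for x
        unfolding u0_def by (cases "M x = top") (simp_all add: less_top[symmetric])
      then have "eLp q (\<lambda>x. ennreal (norm (u0 x))) \<le> eLp q M" using q0 by (intro eLp_mono_AE AE_I2)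
      with EM show ?thesis by (rule order_trans[rotated])
    qed
    have Eh0: "eLp q (\<lambda>x. ennreal (norm (h0 x))) \<le> ennreal (B * Sobolev_norm p \<Omega> f)"
    proof -
      have "eLp q (\<lambda>x. ennreal (norm (h0 x))) \<le> eLp q (\<lambda>x. ennreal (norm (h x)))"
        using q0 by (intro eLp_mono_AE AE_I2) (auto simp: h0_def indicator_def)
      also note Eh
      also have "ennreal c * eLp q (fmax 0 G) \<le> ennreal c * (ennreal C3 * ennreal (d * (C * C2 * CS + 2 * C * C1) * Sobolev_norm p \<Omega> f))"
        by (intro mult_left_mono order_trans[OF C3(2) mult_left_mono[OF EG]] Gm) auto
      also have "\<dots> = ennreal (c * (C3 * (d * (C * C2 * CS + 2 * C * C1) * Sobolev_norm p \<Omega> f)))"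
        using c C3(1) C C1(1) C2(1) CS(1) d by (simp add: ennreal_mult Sobolev_norm_def Lp_norm_def)
      also have "c * (C3 * (d * (C * C2 * CS + 2 * C * C1) * Sobolev_norm p \<Omega> f)) = B * Sobolev_norm p \<Omega> f"
        unfolding B_def by (simp only: mult.assoc)
      finally show ?thesis .
    qed
    have uq: "u \<in> Lp_space q \<Omega>"
      unfolding borel_rep_Lp(1)[OF \<Omega>b u0 q0] using Eu by (rule order_le_less_trans) simp
    have uN: "Lp_norm q \<Omega> u \<le> A * Lp_norm p \<Omega> f"
    proof -
      have "ennreal (Lp_norm q \<Omega> u) \<le> ennreal (A * Lp_norm p \<Omega> f)"
        unfolding borel_rep_Lp(2)[OF \<Omega>b u0 q0 uq] by (rule Eu)
      moreover have "0 \<le> A * Lp_norm p \<Omega> f" using AB(1) by (simp add: Lp_norm_def)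
      ultimately show ?thesis by (simp only: ennreal_le_iff)
    qed
    have h0q: "h0 \<in> Lp_space q \<Omega>"
      unfolding borel_rep_Lp(1)[OF \<Omega>b h0 q0] using Eh0 by (rule order_le_less_trans) simp
    have lu: "locally_integrable \<Omega> u"
      unfolding locally_integrable_borel_rep[OF u0]
    proof (intro allI impI)
      fix K :: "(real ^ 'n) set" assume "compact K"
      then show "integrable lborel (\<lambda>x. indicator K x *\<^sub>R u0 x)"
        using Eu q by (intro eLp_locally_integrable[OF u0m, of q]) (auto intro: order_le_less_trans)
    qed
    have lh: "locally_integrable \<Omega> h0"
      unfolding locally_integrable_borel_rep[OF h0]
    proof (intro allI impI)
      fix K :: "(real ^ 'n) set" assume "compact K"
      then show "integrable lborel (\<lambda>x. indicator K x *\<^sub>R h0 x)"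
        using Eh0 q by (intro eLp_locally_integrable[OF h0m, of q]) (auto intro: order_le_less_trans)
    qed
    have wu: "is_weak_gradient \<Omega> u h0"
      unfolding weak_gradient_borel_rep[OF \<Omega> u0 h0] using lu lh wh0 by blast
    \<comment> \<open>Existence of some weak gradient justifies the choice in
      \<open>weak_gradient\<close>; uniqueness then passes the bound of \<open>h0\<close> on to the
      chosen one.\<close>
    then have wgu: "is_weak_gradient \<Omega> u (weak_gradient \<Omega> u)"
      unfolding weak_gradient_def by (rule someI[of "is_weak_gradient \<Omega> u"])
    have rg: "borel_rep \<Omega> (weak_gradient \<Omega> u) h0"
      by (rule weak_gradient_unique[OF \<Omega> wgu h0 wu])
    have gq: "weak_gradient \<Omega> u \<in> Lp_space q \<Omega>"
      unfolding borel_rep_Lp(1)[OF \<Omega>b rg q0] using Eh0 by (rule order_le_less_trans) simp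
    have gN: "Lp_norm q \<Omega> (weak_gradient \<Omega> u) \<le> B * Sobolev_norm p \<Omega> f"
    proof -
      have "ennreal (Lp_norm q \<Omega> (weak_gradient \<Omega> u)) \<le> ennreal (B * Sobolev_norm p \<Omega> f)"
        unfolding borel_rep_Lp(2)[OF \<Omega>b rg q0 gq] by (rule Eh0)
      moreover have "0 \<le> B * Sobolev_norm p \<Omega> f" using AB(2) by (simp add: Sobolev_norm_def Lp_norm_def)
      ultimately show ?thesis by (simp only: ennreal_le_iff)
    qed
    show "AE x in lebesgue_on \<Omega>. local_max \<gamma> \<beta> \<Omega> f x < \<infinity>"
    proof -
      have "AE x in lborel. M x < top" using M_top q0 by (intro eLp_finite_AE[OF Mm])
      then have "AE x in lebesgue. x \<in> \<Omega> \<longrightarrow> local_max \<gamma> \<beta> \<Omega> f x < \<infinity>"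
        unfolding AE_completion_iff lm by eventually_elim (auto simp: M_def)
      then show ?thesis using \<Omega>b by (subst AE_restrict_space_iff) auto
    qed
    show "(\<lambda>x. enn2real (local_max \<gamma> \<beta> \<Omega> f x)) \<in> Sobolev_space q \<Omega>"
      unfolding u_def[abs_def, symmetric] Sobolev_space_def using uq wu gq by blast
    have "Lp_norm p \<Omega> f \<le> Sobolev_norm p \<Omega> f" by (simp add: Sobolev_norm_def Lp_norm_def)
    then have "A * Lp_norm p \<Omega> f \<le> A * Sobolev_norm p \<Omega> f" using AB(1) by (intro mult_left_mono) auto
    with uN gN have "Sobolev_norm q \<Omega> u \<le> (A + B) * Sobolev_norm p \<Omega> f"
      unfolding Sobolev_norm_def[of q] distrib_right by linarith
    then show "Sobolev_norm q \<Omega> (\<lambda>x. enn2real (local_max \<gamma> \<beta> \<Omega> f x)) \<le> (A + B) * Sobolev_norm p \<Omega> f"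
      unfolding u_def[abs_def] .
  qed
qed

end
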